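(* Let $\Omega\subset\mathbb{R}^2$ be one of the following two kinds of domains: (i) an eccentric circle annular domain; (ii) an exterior petal-like domain whose exterior boundary $\gamma_E$ is an ellipse. Let $f(u)\ge 0$ be a decreasing and real analytic function and let $u$ be a non-constant solution of $$\Delta u+f(u)=0\ \text{ in }\Omega,\qquad u=0\ \text{ on }\partial\Omega .$$ Then $u$ has exactly two critical points on each symmetry axis of $\Omega$, $u$ has no critical points in $\Omega$ off the symmetry axes, and the maximum points of $u$ are located on the long symmetric semi-axes and the saddle points of $u$ on the short symmetric semi-axes.
   Context: The function $f:\mathbb{R}\to\mathbb{R}$ satisfies $f\ge 0$; "decreasing" is meant in the sense $f'\le 0$ (constants are allowed). Solutions are understood in the classical sense. A critical point of $u$ is a point of $\Omega$ at which $\nabla u=0$. Eccentric circle annular domain: up to rigid motion, the domain between the interior boundary $\gamma_I$, the circle of radius $r$ centered at $(a,0)$ with $a>0$, and the exterior boundary $\gamma_E$, the circle of radius $R$ centered at $(0,0)$, where $a+r<R$. Its symmetry axis is the $x$-axis; its long symmetric semi-axis is the segment $\{(x,0):-R<x<a-r\}$ and its short symmetric semi-axis is the segment $\{(x,0):a+r<x<R\}$. Exterior petal-like domain whose exterior boundary is an ellipse: the domain between an exterior boundary $\gamma_E$, a non-circular ellipse, and an interior boundary $\gamma_I$, a circle lying inside $\gamma_E$ whose center is the center of the ellipse. Its symmetry axes are the two axes of the ellipse; the long (respectively short) symmetric semi-axes are the two components of the intersection of $\Omega$ with the line containing the major (respectively minor) axis of the ellipse. *)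

theory Defs
  imports "HOL-Analysis.Analysis"
begin

definition real_analytic :: "(real \<Rightarrow> real) \<Rightarrow> bool" where
  "real_analytic f \<longleftrightarrow>
     (\<forall>x0. \<exists>d>0. \<exists>c::nat \<Rightarrow> real. \<forall>x. \<bar>x - x0\<bar> < d \<longrightarrow> (\<lambda>n. c n * (x - x0) ^ n) sums f x)"

(* Arbitrary where u is not differentiable; C2_on supplies the existence of the derivatives used. *)
definition partial_deriv :: "'n::finite \<Rightarrow> (real ^ 'n \<Rightarrow> real) \<Rightarrow> real ^ 'n \<Rightarrow> real" where
  "partial_deriv i u p = frechet_derivative u (at p) (axis i 1)"

definition C2_on :: "(real ^ 'n::finite \<Rightarrow> real) \<Rightarrow> (real ^ 'n) set \<Rightarrow> bool" where
  "C2_on u \<Omega> \<longleftrightarrow>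
     (\<forall>p\<in>\<Omega>. u differentiable (at p)) \<and>
     (\<forall>i. \<forall>p\<in>\<Omega>. partial_deriv i u differentiable (at p)) \<and>
     (\<forall>i j. continuous_on \<Omega> (partial_deriv j (partial_deriv i u)))"

definition laplacian :: "(real ^ 'n::finite \<Rightarrow> real) \<Rightarrow> real ^ 'n \<Rightarrow> real" where
  "laplacian u p = (\<Sum>i\<in>UNIV. partial_deriv i (partial_deriv i u) p)"

definition classical_dirichlet_solution ::
    "(real \<Rightarrow> real) \<Rightarrow> (real ^ 'n::finite) set \<Rightarrow> (real ^ 'n \<Rightarrow> real) \<Rightarrow> bool" where
  "classical_dirichlet_solution f \<Omega> u \<longleftrightarrow>
     C2_on u \<Omega> \<and> continuous_on (closure \<Omega>) u \<and>
     (\<forall>p\<in>\<Omega>. laplacian u p + f (u p) = 0) \<and> (\<forall>p\<in>frontier \<Omega>. u p = 0)"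

definition critical_point :: "('a::real_inner \<Rightarrow> real) \<Rightarrow> 'a \<Rightarrow> bool" where
  "critical_point u p \<longleftrightarrow> GDERIV u p :> 0"

definition maximum_point :: "('a::topological_space \<Rightarrow> real) \<Rightarrow> 'a \<Rightarrow> bool" where
  "maximum_point u p \<longleftrightarrow> (\<forall>\<^sub>F q in nhds p. u q \<le> u p)"

definition minimum_point :: "('a::topological_space \<Rightarrow> real) \<Rightarrow> 'a \<Rightarrow> bool" where
  "minimum_point u p \<longleftrightarrow> (\<forall>\<^sub>F q in nhds p. u p \<le> u q)"

(* No nondegeneracy of the Hessian is required. *)
definition saddle_point :: "('a::real_inner \<Rightarrow> real) \<Rightarrow> 'a \<Rightarrow> bool" where
  "saddle_point u p \<longleftrightarrow> critical_point u p \<and> \<not> maximum_point u p \<and> \<not> minimum_point u p"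

definition rigid_motion :: "(real ^ 2 \<Rightarrow> real ^ 2) \<Rightarrow> bool" where
  "rigid_motion T \<longleftrightarrow> (\<exists>c g. orthogonal_transformation g \<and> T = (\<lambda>p. c + g p))"

definition x_axis :: "(real ^ 2) set" where
  "x_axis = {p. p $ 2 = 0}"

definition y_axis :: "(real ^ 2) set" where
  "y_axis = {p. p $ 1 = 0}"

definition eccentric_annulus :: "real \<Rightarrow> real \<Rightarrow> real \<Rightarrow> (real ^ 2) set" where
  "eccentric_annulus a r R = ball 0 R - cball (vector [a, 0]) r"

definition ellipse_petal :: "real \<Rightarrow> real \<Rightarrow> real \<Rightarrow> (real ^ 2) set" where
  "ellipse_petal A B r = {p. (p $ 1 / A)\<^sup>2 + (p $ 2 / B)\<^sup>2 < 1} - cball 0 r"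

(* The two predicates below relate a domain to its set of symmetry axes (lines in the plane)
   and its sets of long and short symmetric semi-axes. *)

definition eccentric_circle_annular_domain ::
    "(real ^ 2) set \<Rightarrow> (real ^ 2) set set \<Rightarrow> (real ^ 2) set set \<Rightarrow> (real ^ 2) set set \<Rightarrow> bool" where
  "eccentric_circle_annular_domain \<Omega> axes longs shorts \<longleftrightarrow>
     (\<exists>T a r R. rigid_motion T \<and> 0 < a \<and> 0 < r \<and> a + r < R \<and>
        \<Omega> = T ` eccentric_annulus a r R \<and>
        axes = {T ` x_axis} \<and>
        longs = {T ` {p. p $ 2 = 0 \<and> - R < p $ 1 \<and> p $ 1 < a - r}} \<and>
        shorts = {T ` {p. p $ 2 = 0 \<and> a + r < p $ 1 \<and> p $ 1 < R}})"

(* Since B < A, the major axis of the ellipse lies on the x-axis and the ellipse is not a circle;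
   r < B says that the interior circle lies strictly inside the ellipse. *)
definition elliptic_exterior_petal_domain ::
    "(real ^ 2) set \<Rightarrow> (real ^ 2) set set \<Rightarrow> (real ^ 2) set set \<Rightarrow> (real ^ 2) set set \<Rightarrow> bool" where
  "elliptic_exterior_petal_domain \<Omega> axes longs shorts \<longleftrightarrow>
     (\<exists>T A B r. rigid_motion T \<and> 0 < r \<and> r < B \<and> B < A \<and>
        \<Omega> = T ` ellipse_petal A B r \<and>
        axes = {T ` x_axis, T ` y_axis} \<and>
        longs = components (\<Omega> \<inter> T ` x_axis) \<and>
        shorts = components (\<Omega> \<inter> T ` y_axis))"

end

theory Submission
  imports Defs "HOL-Complex_Analysis.Cauchy_Integral_Formula"
begin

text \<open>
  Since \<open>f\<close> is analytic, nonnegative and decreasing, either \<open>f = 0\<close> and \<open>u\<close> is constant, or \<open>f > 0\<close>,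
  so that \<open>u > 0\<close> in the domain and \<open>u\<close> is invariant under the reflections of the domain. All sign
  information comes from comparing \<open>u\<close> with its composition with a reflection, for which the maximum
  principle needs no regularity of \<open>u\<close> up to the boundary.

  Eccentric annulus. Reflecting in any line separating the two centres makes \<open>u\<close> decrease across
  that line towards the hole. Such lines with a whole range of directions pass through every point off
  the axis, which excludes critical points there; on the short semi-axis one gets
  \<open>u\<^sub>y\<^sub>y \<ge> 0\<close>, hence \<open>u\<^sub>x\<^sub>x < 0\<close>, at critical points. At a critical point of the long semi-axis
  \<open>u\<^sub>y\<^sub>y < u\<^sub>x\<^sub>x\<close> is impossible: the nodal domains of the difference of \<open>u\<close> and its reflection in a slightly
  tilted line would have to cross. So \<open>u\<^sub>x\<^sub>x < 0\<close> again, and the critical points on each semi-axis are unique.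

  Ellipse. Reflecting a quarter sector in its bounding line through the centre shows that \<open>u\<close> strictly
  decreases in the angle from the major to the minor axis. Uniqueness on the short semi-axes is as
  before. On the long ones let \<open>(x\<^sub>1, 0)\<close> be critical: the crossing argument on vertical lines
  and the strong maximum principle give \<open>u\<^sub>x \<le> 0\<close> on the line \<open>x = x\<^sub>1\<close>, hence to the right of it, and
  a second critical point would force \<open>u\<^sub>x = 0\<close> there.
\<close>

section \<open>Laplacians and the maximum principle\<close>

text \<open>Since \<open>f\<close> decreases, the difference of \<open>u\<close> and a reflected
  copy has a Laplacian of the right sign wherever the difference has the wrong sign. So every mirror
  is treated in one step, with no continuous motion of it, and a nodal domain of the difference
  cannot stay where both functions solve the equation. Extension by zero, an explicit barrier that
  tolerates a uniform error, and difference quotients take their place. The two domains differ on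
  the long semi-axes: the part of a disc above a slightly tilted line reflects into the disc
  whenever the centre lies below the line, but the corresponding part of an ellipse may leave the
  ellipse, so no sign of the Hessian is obtained there. Vertical lines still reflect well, and they
  give signs on whole lines and regions; this is why uniqueness on the long semi-axes of the ellipse
  is a global argument.\<close>

lemma has_derivative_vec_nth [derivative_intros]:
  assumes "(f has_derivative f') F"
  shows "((\<lambda>x. f x $ i) has_derivative (\<lambda>h. f' h $ i)) F"
  by (rule bounded_linear.has_derivative[OF bounded_linear_vec_nth assms])

text \<open>The second derivative is assumed at 0 only. If it were negative, \<open>\<phi>'\<close>
  would be negative just to the right of 0 and \<phi> would drop below its minimum.\<close>

lemma second_derivative_nonneg_at_min:
  fixes \<phi> \<phi>' :: "real \<Rightarrow> real"
  assumes "d > 0" and d1: "\<And>t. \<bar>t\<bar> < d \<Longrightarrow> (\<phi> has_real_derivative \<phi>' t) (at t)"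
    and d2: "(\<phi>' has_real_derivative D) (at 0)"
    and mn: "\<And>t. \<bar>t\<bar> < d \<Longrightarrow> \<phi> 0 \<le> \<phi> t"
  shows "\<phi>' 0 = 0 \<and> D \<ge> 0"
proof -
  have z: "\<phi>' 0 = 0"
    using DERIV_local_min[OF d1[of 0] \<open>d > 0\<close>] mn \<open>d > 0\<close> by simp
  have "D \<ge> 0"
  proof (rule ccontr)
    assume "\<not> D \<ge> 0"
    then obtain e where e: "e > 0" "\<And>h. h > 0 \<Longrightarrow> h < e \<Longrightarrow> \<phi>' (0 + h) < \<phi>' 0"
      using DERIV_neg_dec_right[OF d2] by auto
    define h where "h = min d e / 2"
    have h: "0 < h" "h < d" "h < e" using \<open>d > 0\<close> e(1) by (auto simp: h_def)
    have "\<phi> h < \<phi> 0"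
    proof (rule DERIV_neg_imp_decreasing_open[OF h(1)])
      fix x assume "0 < x" "x < h"
      then show "\<exists>y. (\<phi> has_real_derivative y) (at x) \<and> y < 0"
        using d1[of x] e(2)[of x] h z by (intro exI[of _ "\<phi>' x"]) auto
    next
      show "continuous_on {0..h} \<phi>"
      proof (intro continuous_at_imp_continuous_on ballI)
        fix x assume "x \<in> {0..h}"
        then show "isCont \<phi> x" using DERIV_isCont[OF d1[of x]] h by simp
      qed
    qed
    then show False using mn[of h] h by simp
  qed
  with z show ?thesis by simp
qed

text \<open>Second derivatives are asked for at the single point \<open>p\<close>, through the
  derivative of the gradient \<open>G\<close>. This suffices for the minimum test and passes to
  sums, multiples and rigid copies with no continuity argument.\<close>

definition has_laplacian :: "(real ^ 2 \<Rightarrow> real) \<Rightarrow> real ^ 2 \<Rightarrow> real \<Rightarrow> bool" where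
  "has_laplacian \<psi> p L \<longleftrightarrow> (\<exists>U G M. open U \<and> p \<in> U \<and>
     (\<forall>q\<in>U. (\<psi> has_derivative (\<lambda>h. G q \<bullet> h)) (at q)) \<and>
     (G has_derivative (\<lambda>h. M *v h)) (at p) \<and> trace M = L)"

lemma has_laplacianI:
  assumes "open U" "p \<in> U" "\<And>q. q \<in> U \<Longrightarrow> (\<psi> has_derivative (\<lambda>h. G q \<bullet> h)) (at q)"
    "(G has_derivative (\<lambda>h. M *v h)) (at p)" "trace M = L"
  shows "has_laplacian \<psi> p L"
  using assms unfolding has_laplacian_def by blast

lemma has_laplacian_add:
  assumes "has_laplacian \<phi> p K" "has_laplacian \<psi> p L"
  shows "has_laplacian (\<lambda>q. \<phi> q + \<psi> q) p (K + L)"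
proof -
  obtain U G M where 1: "open U" "p \<in> U" "\<forall>q\<in>U. (\<phi> has_derivative (\<lambda>h. G q \<bullet> h)) (at q)"
     "(G has_derivative (\<lambda>h. M *v h)) (at p)" "trace M = K"
    using assms(1) unfolding has_laplacian_def by blast
  obtain V G' M' where 2: "open V" "p \<in> V" "\<forall>q\<in>V. (\<psi> has_derivative (\<lambda>h. G' q \<bullet> h)) (at q)"
     "(G' has_derivative (\<lambda>h. M' *v h)) (at p)" "trace M' = L"
    using assms(2) unfolding has_laplacian_def by blast
  show ?thesis
    by (rule has_laplacianI[of "U \<inter> V" _ _ "\<lambda>q. G q + G' q" "M + M'"])
      (use 1 2 in \<open>auto intro!: derivative_eq_intros simp: trace_add inner_add_left
        matrix_vector_mult_add_rdistrib\<close>)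
qed

lemma has_laplacian_cmul:
  assumes "has_laplacian \<phi> p K"
  shows "has_laplacian (\<lambda>q. c * \<phi> q) p (c * K)"
proof -
  obtain U G M where 1: "open U" "p \<in> U" "\<forall>q\<in>U. (\<phi> has_derivative (\<lambda>h. G q \<bullet> h)) (at q)"
     "(G has_derivative (\<lambda>h. M *v h)) (at p)" "trace M = K"
    using assms(1) unfolding has_laplacian_def by blast
  show ?thesis
    by (rule has_laplacianI[of U _ _ "\<lambda>q. c *\<^sub>R G q" "c *\<^sub>R M"])
      (use 1 in \<open>auto intro!: derivative_eq_intros simp: trace_def sum_distrib_left
         scaleR_matrix_vector_assoc[symmetric]\<close>)
qed

lemma has_laplacian_diff:
  assumes "has_laplacian \<phi> p K" "has_laplacian \<psi> p L"
  shows "has_laplacian (\<lambda>q. \<phi> q - \<psi> q) p (K - L)"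
  using has_laplacian_add[OF assms(1) has_laplacian_cmul[OF assms(2), of "-1"]] by simp

lemma has_laplacian_const: "has_laplacian (\<lambda>q. c) p 0"
  by (rule has_laplacianI[of UNIV _ _ "\<lambda>q. 0" 0]) (auto simp: trace_def)

lemma has_laplacian_norm_sq: "has_laplacian (\<lambda>p. (norm (p - q))\<^sup>2) p 4"
proof (rule has_laplacianI[of UNIV _ _ "\<lambda>p. 2 *\<^sub>R (p - q)" "2 *\<^sub>R mat 1"])
  fix p :: "real^2"
  show "((\<lambda>p. (norm (p - q))\<^sup>2) has_derivative (\<lambda>h. (2 *\<^sub>R (p - q)) \<bullet> h)) (at p)"
    unfolding power2_norm_eq_inner
    by (auto intro!: derivative_eq_intros simp: inner_commute algebra_simps)
  show "trace (2 *\<^sub>R mat 1 :: real^2^2) = 4" by (simp add: trace_def mat_def sum_2)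
qed (auto intro!: derivative_eq_intros simp: scaleR_matrix_vector_assoc[symmetric])

text \<open>The radial building block of Hopf's barrier: it is subharmonic outside a given disc
  about \<open>q\<close> once \<alpha> is large.\<close>

lemma has_laplacian_gaussian:
  "has_laplacian (\<lambda>p. exp (- \<alpha> * (norm (p - q))\<^sup>2)) p
     (exp (- \<alpha> * (norm (p - q))\<^sup>2) * (4 * \<alpha>\<^sup>2 * (norm (p - q))\<^sup>2 - 4 * \<alpha>))"
proof -
  define e where "e = (\<lambda>p. exp (- \<alpha> * (norm (p - q))\<^sup>2))"
  have de: "(e has_derivative (\<lambda>h. ((- 2 * \<alpha> * e p) *\<^sub>R (p - q)) \<bullet> h)) (at p)" for p
    unfolding e_def power2_norm_eq_inner
    by (auto intro!: derivative_eq_intros simp: inner_commute algebra_simps)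
  define M :: "real^2^2" where "M = (\<chi> i j. - 2 * \<alpha> * e p * (if i = j then 1 else 0)
     + 4 * \<alpha>\<^sup>2 * e p * ((p - q) $ i) * ((p - q) $ j))"
  have "has_laplacian e p (e p * (4 * \<alpha>\<^sup>2 * (norm (p - q))\<^sup>2 - 4 * \<alpha>))"
  proof (rule has_laplacianI[of UNIV _ _ "\<lambda>p. (- 2 * \<alpha> * e p) *\<^sub>R (p - q)" M])
    have "(\<lambda>h. M *v h) = (\<lambda>h. (- 2 * \<alpha> * e p) *\<^sub>R h
        + (- 2 * \<alpha> * (((- 2 * \<alpha> * e p) *\<^sub>R (p - q)) \<bullet> h)) *\<^sub>R (p - q))"
      by (rule ext) (simp add: M_def vec_eq_iff matrix_vector_mult_def forall_2 sum_2 inner_vec_def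
          algebra_simps power2_eq_square)
    then show "((\<lambda>p. (- 2 * \<alpha> * e p) *\<^sub>R (p - q)) has_derivative (\<lambda>h. M *v h)) (at p)"
      by (auto intro!: derivative_eq_intros de)
    show "trace M = e p * (4 * \<alpha>\<^sup>2 * (norm (p - q))\<^sup>2 - 4 * \<alpha>)"
      unfolding power2_norm_eq_inner
      by (simp add: M_def trace_def sum_2 inner_vec_def algebra_simps power2_eq_square)
  qed (use de in auto)
  then show ?thesis by (simp add: e_def)
qed

lemma has_laplacian_quadratic:
  "has_laplacian (\<lambda>p. a * (p $ 1)\<^sup>2 + b * (p $ 2)\<^sup>2) p (2 * a + 2 * b)"
proof (rule has_laplacianI[of UNIV _ _ "\<lambda>p. vector [2 * a * p $ 1, 2 * b * p $ 2]"
      "vector [vector [2 * a, 0], vector [0, 2 * b]]"])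
  fix p :: "real^2"
  show "((\<lambda>p. a * (p $ 1)\<^sup>2 + b * (p $ 2)\<^sup>2) has_derivative
      (\<lambda>h. (vector [2 * a * p $ 1, 2 * b * p $ 2] :: real^2) \<bullet> h)) (at p)"
    by (auto intro!: derivative_eq_intros simp: inner_vec_def sum_2 algebra_simps)
next
  have "((\<lambda>p::real^2. vector [2 * a * p $ 1, 2 * b * p $ 2] :: real^2) has_derivative
     (\<lambda>h. vector [2 * a * h $ 1, 2 * b * h $ 2])) (at p)"
    by (intro has_derivative_componentwise_within[THEN iffD2])
      (auto simp: Basis_vec_def inner_axis forall_2 intro!: derivative_eq_intros)
  moreover have "(\<lambda>h. vector [vector [2 * a, 0], vector [0, 2 * b]] *v h)
      = (\<lambda>h::real^2. vector [2 * a * h $ 1, 2 * b * h $ 2] :: real^2)"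
    by (rule ext) (simp add: vec_eq_iff forall_2 matrix_vector_mult_def sum_2)
  ultimately show "((\<lambda>p::real^2. vector [2 * a * p $ 1, 2 * b * p $ 2] :: real^2) has_derivative
     (\<lambda>h. vector [vector [2 * a, 0], vector [0, 2 * b]] *v h)) (at p)"
    by simp
qed (auto simp: trace_def sum_2)

lemma has_laplacian_min:
  assumes "has_laplacian \<psi> p L" "open V" "p \<in> V" "\<And>q. q \<in> V \<Longrightarrow> \<psi> p \<le> \<psi> q"
  shows "L \<ge> 0"
proof -
  obtain U G M where 1: "open U" "p \<in> U" "\<And>q. q\<in>U \<Longrightarrow> (\<psi> has_derivative (\<lambda>h. G q \<bullet> h)) (at q)"
     "(G has_derivative (\<lambda>h. M *v h)) (at p)" "trace M = L"
    using assms(1) unfolding has_laplacian_def by blast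
  have "open (U \<inter> V)" "p \<in> U \<inter> V" using 1 assms by auto
  then obtain d where d: "d > 0" "ball p d \<subseteq> U \<inter> V" by (meson openE)
  have "M $ i $ i \<ge> 0" for i
  proof -
    define h :: "real^2" where "h = axis i 1"
    have nh: "norm h = 1" by (simp add: h_def)
    have inb: "p + t *\<^sub>R h \<in> U \<inter> V" if "\<bar>t\<bar> < d" for t
      using that d(2) nh by (auto simp: subset_iff dist_norm)
    have "(\<lambda>t. G (p + t *\<^sub>R h) \<bullet> h) 0 = 0 \<and> (M *v h) \<bullet> h \<ge> 0"
    proof (rule second_derivative_nonneg_at_min[OF d(1), of "\<lambda>t. \<psi> (p + t *\<^sub>R h)"])
      fix t :: real assume t: "\<bar>t\<bar> < d"
      have "((\<lambda>t. \<psi> (p + t *\<^sub>R h)) has_derivative (\<lambda>s. G (p + t *\<^sub>R h) \<bullet> (s *\<^sub>R h))) (at t)"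
        by (rule has_derivative_compose[where f="\<lambda>t. p + t *\<^sub>R h" and f'="\<lambda>s. s *\<^sub>R h", OF _ 1(3)])
          (use inb[OF t] in \<open>auto intro!: derivative_eq_intros\<close>)
      then show "((\<lambda>t. \<psi> (p + t *\<^sub>R h)) has_real_derivative (G (p + t *\<^sub>R h) \<bullet> h)) (at t)"
        by (simp add: has_field_derivative_def mult.commute[of _ "G _ \<bullet> h"])
      show "\<psi> (p + 0 *\<^sub>R h) \<le> \<psi> (p + t *\<^sub>R h)"
        using assms(4) inb[OF t] by simp
    next
      have "((\<lambda>t. G (p + t *\<^sub>R h)) has_derivative (\<lambda>s. M *v (s *\<^sub>R h))) (at 0)"
        by (rule has_derivative_compose[where f="\<lambda>t. p + t *\<^sub>R h" and f'="\<lambda>s. s *\<^sub>R h" and g=G])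
          (use 1(4) in \<open>auto intro!: derivative_eq_intros\<close>)
      then have "((\<lambda>t. G (p + t *\<^sub>R h) \<bullet> h) has_derivative (\<lambda>s. (M *v (s *\<^sub>R h)) \<bullet> h)) (at 0)"
        by (auto intro!: derivative_eq_intros)
      then show "((\<lambda>t. G (p + t *\<^sub>R h) \<bullet> h) has_real_derivative ((M *v h) \<bullet> h)) (at 0)"
        by (simp add: has_field_derivative_def mult.commute[of _ "(M *v h) \<bullet> h"] matrix_vector_mult_scaleR)
    qed
    moreover have "(M *v h) \<bullet> h = M $ i $ i"
      by (simp add: h_def inner_axis matrix_vector_mult_basis column_def)
    ultimately show ?thesis by simp
  qed
  then have "M $ 1 $ 1 \<ge> 0" "M $ 2 $ 2 \<ge> 0" by auto
  then show ?thesis using 1(5) by (simp add: trace_def sum_2)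
qed

text \<open>The sign of the Laplacian is demanded only where \<open>\<psi>\<close> is negative,
  because that is what the monotonicity of \<open>f\<close> provides. Subtracting a small multiple
  of the squared norm makes it strictly negative, which an interior minimum forbids.\<close>

lemma max_principle:
  fixes \<psi> :: "real^2 \<Rightarrow> real"
  assumes "open U" "bounded U" "continuous_on (closure U) \<psi>"
    and bd: "\<And>p. p \<in> frontier U \<Longrightarrow> \<psi> p \<ge> 0"
    and lap: "\<And>p. p \<in> U \<Longrightarrow> \<psi> p < 0 \<Longrightarrow> \<exists>L\<le>0. has_laplacian \<psi> p L"
    and "p \<in> U"
  shows "\<psi> p \<ge> 0"
proof (rule ccontr)
  assume "\<not> \<psi> p \<ge> 0"
  then have neg: "\<psi> p < 0" by simp
  obtain R where R: "R > 0" "\<And>q. q \<in> closure U \<Longrightarrow> norm q \<le> R"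
    using bounded_closure[OF \<open>bounded U\<close>] unfolding bounded_pos by auto
  \<comment> \<open>Small enough that \<open>e * R\<^sup>2\<close> stays below
    \<open>- \<psi> p\<close>: the minimiser of the perturbed function then still has
    \<open>\<psi> < 0\<close>, so it is not on the frontier.\<close>
  define e where "e = - \<psi> p / (2 * R\<^sup>2)"
  have "e * R\<^sup>2 = - \<psi> p / 2" using R(1) by (simp add: e_def)
  then have e2: "e * R\<^sup>2 < - \<psi> p" using neg by linarith
  have e: "e > 0" unfolding e_def using neg R(1) by (intro divide_pos_pos) (simp_all add: zero_less_power)
  note e = e e2
  define \<omega> where "\<omega> = (\<lambda>q. \<psi> q - e * (norm (q - 0))\<^sup>2)"
  have cpt: "compact (closure U)" using assms(2) by simp
  have pc: "p \<in> closure U" using assms(6) closure_subset by blast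
  have "continuous_on (closure U) \<omega>" unfolding \<omega>_def by (intro continuous_intros assms)
  then obtain q where q: "q \<in> closure U" "\<And>r. r \<in> closure U \<Longrightarrow> \<omega> q \<le> \<omega> r"
    using continuous_attains_inf[OF cpt, of \<omega>] pc by fastforce
  have nsq: "0 \<le> e * (norm r)\<^sup>2" "r \<in> closure U \<Longrightarrow> e * (norm r)\<^sup>2 \<le> e * R\<^sup>2" for r
    using R(2)[of r] e(1) by (auto intro!: mult_left_mono power_mono)
  have "\<omega> q \<le> \<psi> p" using q(2)[OF pc] nsq(1)[of p] by (simp add: \<omega>_def)
  then have qneg: "\<psi> q < 0" using nsq(2)[OF q(1)] e(2) by (simp add: \<omega>_def)
  then have "q \<notin> frontier U" using bd[of q] by auto
  then have qU: "q \<in> U" using q(1) assms(1) by (simp add: frontier_def interior_open)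
  obtain L where L: "L \<le> 0" "has_laplacian \<psi> q L" using lap[OF qU qneg] by blast
  have "has_laplacian \<omega> q (L - e * 4)"
    unfolding \<omega>_def by (intro has_laplacian_diff has_laplacian_cmul has_laplacian_norm_sq L)
  then have "L - e * 4 \<ge> 0"
    by (rule has_laplacian_min[OF _ assms(1) qU]) (use q(2) closure_subset[of U] in auto)
  then show False using L(1) e(1) by simp
qed

section \<open>Strong maximum principle and solutions of the Dirichlet problem\<close>

text \<open>\<open>exp (- \<alpha> * \<rho>\<^sup>2) * (\<alpha> * \<rho>)\<close> is half the
  inward slope of the Gaussian on the outer circle. The value of \<alpha> makes
  \<open>\<alpha> * \<epsilon>\<^sup>2\<close> at least \<open>2 + k\<close>, so that the Laplacian
  of the Gaussian absorbs the zero-order term. The constant depends on the radii and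
  \<open>k\<close> alone, hence an approximation error can be chosen after it.\<close>

definition barrier_const :: "real \<Rightarrow> real \<Rightarrow> real \<Rightarrow> real" where
  "barrier_const \<epsilon> \<rho> k = (let \<alpha> = (2 + k) / \<epsilon>\<^sup>2 + 1 in exp (- \<alpha> * \<rho>\<^sup>2) * (\<alpha> * \<rho>))"

lemma barrier_const_pos:
  assumes "0 < \<rho>" "0 \<le> k"
  shows "0 < barrier_const \<epsilon> \<rho> k"
proof -
  have "0 \<le> (2 + k) / \<epsilon>\<^sup>2" using assms by simp
  then have "0 < (2 + k) / \<epsilon>\<^sup>2 + 1" by linarith
  then show ?thesis
    unfolding barrier_const_def Let_def using assms by (intro mult_pos_pos exp_gt_zero)
qed

text \<open>Hopf's comparison with a multiple of a Gaussian shifted to vanish on the outer circle,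
  in a form that tolerates an error \<eta>. Where the comparison would fail, \<open>z\<close> is at
  most \<open>c\<close> times the barrier, so the barrier also bounds the term with
  \<open>k\<close>. The bound linear in the distance to the outer circle is what later yields a
  strict sign of a derivative.\<close>

lemma barrier:
  fixes \<epsilon> \<rho> k :: real
  assumes pos: "0 < \<epsilon>" "\<epsilon> < \<rho>" "0 \<le> k"
    and c: "0 < c" and \<eta>: "0 \<le> \<eta>" and cont: "continuous_on (cball q \<rho>) z"
    and lap: "\<And>p. p \<in> ball q \<rho> \<Longrightarrow> \<exists>L. has_laplacian z p L \<and> L \<le> k * max (z p) 0"
    and outer: "\<And>p. dist q p = \<rho> \<Longrightarrow> - \<eta> \<le> z p" and inner: "\<And>p. dist q p = \<epsilon> \<Longrightarrow> c - \<eta> \<le> z p"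
    and p: "\<epsilon> \<le> dist q p" "dist q p \<le> \<rho>"
  shows "c * barrier_const \<epsilon> \<rho> k * (\<rho> - dist q p) - \<eta> \<le> z p"
proof -
  define \<alpha> where "\<alpha> = (2 + k) / \<epsilon>\<^sup>2 + 1"
  have \<alpha>1: "\<alpha> \<ge> 1" using pos by (simp add: \<alpha>_def)
  have "\<alpha> * \<epsilon>\<^sup>2 = (2 + k) + \<epsilon>\<^sup>2" using pos by (simp add: \<alpha>_def field_simps)
  then have \<alpha>2: "\<alpha> * \<epsilon>\<^sup>2 - 1 \<ge> 1 + k" using pos by simp
  define m where "m = exp (- \<alpha> * \<rho>\<^sup>2) * (\<alpha> * \<rho>)"
  have "c * m * (\<rho> - dist q p) - \<eta> \<le> z p"
  proof -
    define \<beta> where "\<beta> = (\<lambda>p. exp (- \<alpha> * (norm (p - q))\<^sup>2) - exp (- \<alpha> * \<rho>\<^sup>2))"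
    have \<beta>lap: "has_laplacian \<beta> p
       (exp (- \<alpha> * (norm (p - q))\<^sup>2) * (4 * \<alpha>\<^sup>2 * (norm (p - q))\<^sup>2 - 4 * \<alpha>))" for p
      using has_laplacian_diff[OF has_laplacian_gaussian has_laplacian_const] by (simp add: \<beta>_def)
    have dn: "dist q p = norm (p - q)" for p by (simp add: dist_norm norm_minus_commute)
    have \<beta>nn: "\<beta> p \<ge> 0" if "dist q p \<le> \<rho>" for p
      using that \<alpha>1 by (auto simp: \<beta>_def dn intro!: power_mono)
    have \<beta>0: "\<beta> p = 0" if "dist q p = \<rho>" for p using that by (simp add: \<beta>_def dn)
    have \<beta>1: "\<beta> p \<le> 1" for p
    proof -
      have "exp (- \<alpha> * (norm (p - q))\<^sup>2) \<le> 1" using \<alpha>1 by simp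
      then show ?thesis unfolding \<beta>_def by (smt (verit) exp_gt_zero)
    qed
    define \<psi> where "\<psi> = (\<lambda>p. z p - c * \<beta> p + \<eta>)"
    define U where "U = ball q \<rho> - cball q \<epsilon>"
    have U: "open U" "bounded U" by (auto simp: U_def bounded_diff)
    have clU: "closure U \<subseteq> cball q \<rho> - ball q \<epsilon>"
      by (rule closure_minimal) (auto simp: U_def)
    have psi_nn: "\<psi> p \<ge> 0" if pb: "dist q p = \<rho> \<or> dist q p = \<epsilon>" for p
      using pb
    proof
      assume "dist q p = \<rho>" then show ?thesis using outer[of p] \<beta>0[of p] by (simp add: \<psi>_def)
    next
      assume "dist q p = \<epsilon>"
      moreover have "c * \<beta> p \<le> c" using \<beta>1[of p] c by simp
      ultimately show ?thesis using inner[of p] by (simp add: \<psi>_def)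
    qed
    have "\<psi> p \<ge> 0"
    proof (cases "p \<in> U")
      case True
      show ?thesis
      proof (rule max_principle[OF U _ _ _ True])
        have "closure U \<subseteq> cball q \<rho>" using clU by blast
        then have "continuous_on (closure U) z" using cont continuous_on_subset by blast
        then show "continuous_on (closure U) \<psi>"
          unfolding \<psi>_def \<beta>_def by (intro continuous_intros)
        show "0 \<le> \<psi> r" if "r \<in> frontier U" for r
        proof -
          have "r \<in> cball q \<rho> - ball q \<epsilon>" "r \<notin> U"
            using that clU U(1) by (auto simp: frontier_def interior_open)
          then show ?thesis by (intro psi_nn) (auto simp: U_def)
        qed
        show "\<exists>L\<le>0. has_laplacian \<psi> r L" if r: "r \<in> U" and neg: "\<psi> r < 0" for r
        proof -
          have rb: "r \<in> ball q \<rho>" "\<epsilon> < norm (r - q)" using r by (auto simp: U_def dn)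
          obtain L where L: "has_laplacian z r L" "L \<le> k * max (z r) 0" using lap[OF rb(1)] by blast
          define E where "E = exp (- \<alpha> * (norm (r - q))\<^sup>2)"
          have b: "0 \<le> \<beta> r" "\<beta> r \<le> E" using rb \<beta>nn[of r] by (auto simp: \<beta>_def E_def)
          have "z r \<le> c * \<beta> r" using neg \<eta> by (simp add: \<psi>_def)
          moreover have "0 \<le> c * \<beta> r" using b c by simp
          ultimately have "max (z r) 0 \<le> c * \<beta> r" by simp
          then have "L \<le> k * (c * \<beta> r)" using L(2) pos(3) by (meson mult_left_mono order_trans)
          also have "\<dots> \<le> k * (c * E)" using b c pos(3) by (intro mult_left_mono) auto
          finally have "L \<le> c * (E * k)" by (simp add: mult_ac)
          moreover have "E * k \<le> E * (4 * \<alpha>\<^sup>2 * (norm (r - q))\<^sup>2 - 4 * \<alpha>)"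
          proof (rule mult_left_mono)
            have "\<epsilon>\<^sup>2 \<le> (norm (r - q))\<^sup>2" using rb pos(1) by (intro power_mono) auto
            then have "\<alpha> * \<epsilon>\<^sup>2 \<le> \<alpha> * (norm (r - q))\<^sup>2" using \<alpha>1 by simp
            then have a: "1 + k \<le> \<alpha> * (norm (r - q))\<^sup>2 - 1" using \<alpha>2 by linarith
            have "k \<le> (4 * \<alpha>) * (1 + k)" using \<alpha>1 pos(3)
              by (smt (verit) mult_le_cancel_right1)
            also have "\<dots> \<le> (4 * \<alpha>) * (\<alpha> * (norm (r - q))\<^sup>2 - 1)"
              using a \<alpha>1 by (intro mult_left_mono) auto
            finally show "k \<le> 4 * \<alpha>\<^sup>2 * (norm (r - q))\<^sup>2 - 4 * \<alpha>"
              by (simp add: algebra_simps power2_eq_square)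
          qed (simp add: E_def)
          ultimately have "L \<le> c * (E * (4 * \<alpha>\<^sup>2 * (norm (r - q))\<^sup>2 - 4 * \<alpha>))"
            using c by (smt (verit) mult_left_mono)
          moreover have "has_laplacian \<psi> r (L - c * (E * (4 * \<alpha>\<^sup>2 * (norm (r - q))\<^sup>2 - 4 * \<alpha>)) + 0)"
            unfolding \<psi>_def E_def
            by (intro has_laplacian_add has_laplacian_diff has_laplacian_cmul \<beta>lap L has_laplacian_const)
          ultimately show ?thesis by (intro exI[of _ "L - c * (E * (4 * \<alpha>\<^sup>2 * (norm (r - q))\<^sup>2 - 4 * \<alpha>)) + 0"]) simp
        qed
      qed
    next
      case False
      then show ?thesis using p by (intro psi_nn) (auto simp: U_def)
    qed
    moreover have "m * (\<rho> - dist q p) \<le> \<beta> p"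
    proof -
      define d where "d = dist q p"
      have d: "0 \<le> d" "d \<le> \<rho>" using p by (auto simp: d_def)
      have "\<alpha> * \<rho> * (\<rho> - d) \<le> \<alpha> * (\<rho>\<^sup>2 - d\<^sup>2)"
      proof -
        have "\<rho> * (\<rho> - d) \<le> (\<rho> + d) * (\<rho> - d)" using d by (intro mult_right_mono) auto
        then have "\<alpha> * (\<rho> * (\<rho> - d)) \<le> \<alpha> * ((\<rho> + d) * (\<rho> - d))"
          using \<alpha>1 by (intro mult_left_mono) auto
        then show ?thesis by (simp add: power2_eq_square algebra_simps)
      qed
      also have "\<dots> \<le> exp (\<alpha> * (\<rho>\<^sup>2 - d\<^sup>2)) - 1" using exp_ge_add_one_self[of "\<alpha> * (\<rho>\<^sup>2 - d\<^sup>2)"] by linarith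
      finally have "exp (- \<alpha> * \<rho>\<^sup>2) * (\<alpha> * \<rho> * (\<rho> - d)) \<le> exp (- \<alpha> * \<rho>\<^sup>2) * (exp (\<alpha> * (\<rho>\<^sup>2 - d\<^sup>2)) - 1)"
        by (intro mult_left_mono) auto
      also have "\<dots> = exp (- \<alpha> * d\<^sup>2) - exp (- \<alpha> * \<rho>\<^sup>2)"
        by (simp add: right_diff_distrib exp_add[symmetric])
      finally show ?thesis by (simp add: m_def \<beta>_def d_def dn mult_ac)
    qed
    then have "c * (m * (\<rho> - dist q p)) \<le> c * \<beta> p" using c by simp
    ultimately show ?thesis by (simp add: \<psi>_def mult.assoc)
  qed
  moreover have "barrier_const \<epsilon> \<rho> k = m" by (simp only: barrier_const_def m_def \<alpha>_def Let_def)
  ultimately show ?thesis by simp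
qed

text \<open>\<open>v\<close> may lack a Laplacian: on discs it only has to be a uniform limit of
  functions satisfying the differential inequality, as is the case for a first derivative of
  \<open>u\<close>. The zero set is open, because a positive value at \<open>q\<close> close to a
  zero \<open>x\<close> pushes a good approximation at \<open>x\<close> above its error.\<close>

lemma strong_max_principle:
  fixes v :: "real^2 \<Rightarrow> real"
  assumes "open U" "connected U" "0 \<le> k" and cont: "continuous_on U v"
    and nn: "\<And>p. p \<in> U \<Longrightarrow> v p \<ge> 0"
    and approx: "\<And>q \<rho> \<eta>. cball q \<rho> \<subseteq> U \<Longrightarrow> 0 < \<eta> \<Longrightarrow> \<exists>z. continuous_on (cball q \<rho>) z \<and>
       (\<forall>p\<in>ball q \<rho>. \<exists>L. has_laplacian z p L \<and> L \<le> k * max (z p) 0) \<and>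
       (\<forall>p\<in>cball q \<rho>. \<bar>z p - v p\<bar> \<le> \<eta>)"
    and p0: "p0 \<in> U" "v p0 = 0" and "p \<in> U"
  shows "v p = 0"
proof (rule ccontr)
  assume "v p \<noteq> 0"
  define P where "P = {p \<in> U. v p > 0}"
  define Z where "Z = {p \<in> U. v p = 0}"
  have "P = U \<inter> v -` {0<..}" by (auto simp: P_def)
  then have "open P" using continuous_open_preimage[OF cont assms(1)] by simp
  moreover have "open Z"
    unfolding open_contains_ball
  proof
    fix x assume x: "x \<in> Z"
    then have xU: "x \<in> U" "v x = 0" by (auto simp: Z_def)
    obtain r0 where r0: "r0 > 0" "cball x r0 \<subseteq> U" using assms(1) xU(1) open_contains_cball by blast
    define r where "r = r0 / 3"
    have r: "r > 0" "cball x (3 * r) \<subseteq> U" using r0 by (auto simp: r_def)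
    have "ball x r \<subseteq> Z"
    proof
      fix q assume q: "q \<in> ball x r"
      have cq: "cball q (2 * r) \<subseteq> U"
      proof
        fix w assume "w \<in> cball q (2 * r)"
        then have "dist x w \<le> 3 * r" using q dist_triangle[of x w q] by (auto simp: dist_commute)
        then show "w \<in> U" using r by auto
      qed
      then have qU: "q \<in> U" using r by auto
      show "q \<in> Z"
      proof (rule ccontr)
        assume "q \<notin> Z"
        then have vq: "v q > 0" using nn[OF qU] qU by (auto simp: Z_def)
        then have "q \<noteq> x" using xU by auto
        have "continuous (at q) v" using cont assms(1) qU continuous_on_eq_continuous_at by blast
        then obtain d where d: "d > 0" "\<And>w. dist w q < d \<Longrightarrow> dist (v w) (v q) < v q / 2"
          using vq unfolding continuous_at_eps_delta by (metis half_gt_zero)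
        \<comment> \<open>Within distance \<open>d\<close> of \<open>q\<close> the value stays above
          \<open>v q / 2\<close>; the second entry keeps \<open>x\<close> out of the open inner
          disc, so that the barrier applies at \<open>x\<close>.\<close>
        define e where "e = min (d / 2) (dist q x)"
        have e: "e > 0" "e < d" "e \<le> dist q x" "e < 2 * r"
          using d \<open>q \<noteq> x\<close> q r by (auto simp: e_def dist_commute min_def)
        define m where "m = barrier_const e (2 * r) k"
        have m: "m > 0" unfolding m_def using r assms(3) by (intro barrier_const_pos) auto
        \<comment> \<open>A quarter of the gain at \<open>x\<close>: the barrier gives at least
          \<open>4 * \<eta> - \<eta>\<close> there, while the approximation of a zero is at most
          \<eta>.\<close>
        define \<eta> where "\<eta> = v q / 2 * m * r / 4"
        have \<eta>: "\<eta> > 0" using vq m r by (simp add: \<eta>_def)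
        obtain z where z: "continuous_on (cball q (2*r)) z"
          "\<forall>p\<in>ball q (2*r). \<exists>L. has_laplacian z p L \<and> L \<le> k * max (z p) 0"
          "\<forall>p\<in>cball q (2*r). \<bar>z p - v p\<bar> \<le> \<eta>"
          using approx[OF cq \<eta>] by blast
        have zl: "z w \<ge> v w - \<eta>" if "dist q w \<le> 2 * r" for w
          using z(3)[rule_format, of w] that by auto
        have dx: "dist q x < r" using q by (simp add: dist_commute)
        have "v q / 2 * m * (2*r - dist q x) - \<eta> \<le> z x"
          unfolding m_def
        proof (rule barrier[OF e(1) e(4) assms(3) _ _ z(1)])
          show "- \<eta> \<le> z w" if "dist q w = 2 * r" for w
          proof -
            have "w \<in> U" using that cq by (auto simp: subset_iff)
            then show ?thesis using zl[of w] that nn[of w] by simp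
          qed
          show "v q / 2 - \<eta> \<le> z w" if "dist q w = e" for w
          proof -
            have "dist (v w) (v q) < v q / 2" using d(2)[of w] that e by (simp add: dist_commute)
            then have "v w \<ge> v q / 2" by (auto simp: dist_real_def abs_if split: if_splits)
            then show ?thesis using zl[of w] that e by auto
          qed
        qed (use vq \<eta> z e dx in auto)
        moreover have "z x \<le> \<eta>" using z(3)[rule_format, of x] xU dx r by auto
        moreover have "v q / 2 * m * r \<le> v q / 2 * m * (2*r - dist q x)"
          using vq m dx by (intro mult_left_mono) auto
        ultimately show False using \<eta> by (simp add: \<eta>_def)
      qed
    qed
    then show "\<exists>e>0. ball x e \<subseteq> Z" using r by blast
  qed
  moreover have "U \<subseteq> P \<union> Z" "P \<inter> Z \<inter> U = {}" using nn by (auto simp: P_def Z_def less_le)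
  moreover have "p \<in> P" "p0 \<in> Z" using \<open>v p \<noteq> 0\<close> nn[OF \<open>p \<in> U\<close>] p0 \<open>p \<in> U\<close> by (auto simp: P_def Z_def less_le)
  ultimately show False using connectedD[OF assms(2), of P Z] p0 \<open>p \<in> U\<close> by blast
qed

text \<open>Here \<open>u\<close> is extended by zero outside \<open>\<Omega>\<close>; \<open>g\<close> is its gradient and \<open>H\<close> its Hessian.\<close>

locale dirichlet_solution =
  fixes f :: "real \<Rightarrow> real" and \<Omega> :: "(real^2) set" and u :: "real^2 \<Rightarrow> real"
    and g :: "real^2 \<Rightarrow> real^2" and H :: "real^2 \<Rightarrow> real^2^2"
  assumes f_pos: "\<And>t. 0 < f t"
    and f_anti: "\<And>s t. s \<le> t \<Longrightarrow> f t \<le> f s"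
    and f_lip: "\<And>M. \<exists>k\<ge>0. \<forall>s t. 0 \<le> s \<and> s \<le> t \<and> t \<le> M \<longrightarrow> f s - f t \<le> k * (t - s)"
    and op: "open \<Omega>" and bdd: "bounded \<Omega>"
    and cont: "continuous_on UNIV u"
    and zero: "\<And>p. p \<notin> \<Omega> \<Longrightarrow> u p = 0"
    and grad: "\<And>p. p \<in> \<Omega> \<Longrightarrow> (u has_derivative (\<lambda>h. g p \<bullet> h)) (at p)"
    and hess: "\<And>p. p \<in> \<Omega> \<Longrightarrow> (g has_derivative (\<lambda>h. H p *v h)) (at p)"
    and eqn: "\<And>p. p \<in> \<Omega> \<Longrightarrow> trace (H p) = - f (u p)"
begin

lemma lap: "p \<in> \<Omega> \<Longrightarrow> has_laplacian u p (- f (u p))"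
  using op grad hess eqn by (intro has_laplacianI[of \<Omega> p u g "H p"]) auto

lemma u_nonneg: "u p \<ge> 0"
proof (cases "p \<in> \<Omega>")
  case True
  show ?thesis
  proof (rule max_principle[OF op bdd _ _ _ True])
    show "continuous_on (closure \<Omega>) u" using cont continuous_on_subset by blast
    show "0 \<le> u q" if "q \<in> frontier \<Omega>" for q
      using that op zero[of q] by (auto simp: frontier_def interior_open)
    show "\<exists>L\<le>0. has_laplacian u q L" if "q \<in> \<Omega>" for q
      using lap[OF that] f_pos[of "u q"] by (intro exI[of _ "- f (u q)"]) auto
  qed
qed (simp add: zero)

lemma u_pos: "p \<in> \<Omega> \<Longrightarrow> u p > 0"
proof (rule ccontr)
  assume p: "p \<in> \<Omega>" and "\<not> u p > 0"
  then have "u p \<le> u q" for q using u_nonneg[of q] by linarith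
  then have "- f (u p) \<ge> 0" using has_laplacian_min[OF lap[OF p] op p] by blast
  then show False using f_pos[of "u p"] by simp
qed

lemma u_pos_iff: "u p > 0 \<longleftrightarrow> p \<in> \<Omega>"
  using u_pos zero by fastforce

lemma u_bounded: "\<exists>M. \<forall>p. u p \<le> M"
proof -
  have "compact (u ` closure \<Omega>)"
    using bdd cont continuous_on_subset by (intro compact_continuous_image) auto
  then obtain M where "\<forall>x\<in>u ` closure \<Omega>. norm x \<le> M" using compact_imp_bounded bounded_iff by metis
  then have "u p \<le> max M 0" for p
    using zero[of p] closure_subset[of \<Omega>] by (cases "p \<in> \<Omega>") (force simp: max_def)+
  then show ?thesis by blast
qed

lemma lip_const:
  obtains k where "k \<ge> 0" "\<And>p q. u q \<le> u p \<Longrightarrow> f (u q) - f (u p) \<le> k * (u p - u q)"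
  using u_bounded f_lip u_nonneg by meson

lemma transform:
  assumes Q: "orthogonal_matrix Q"
  shows "dirichlet_solution f {p. c + Q *v p \<in> \<Omega>} (\<lambda>p. u (c + Q *v p))
    (\<lambda>p. transpose Q *v g (c + Q *v p)) (\<lambda>p. transpose Q ** H (c + Q *v p) ** Q)"
proof -
  have cT: "continuous_on UNIV (\<lambda>p. c + Q *v p)" by (intro continuous_intros)
  have nQ: "norm (Q *v p) = norm p" for p
    using Q by (simp add: orthogonal_transformation_norm orthogonal_transformation_matrix
        matrix_of_matrix_vector_mul)
  have dT: "((\<lambda>p. c + Q *v p) has_derivative (\<lambda>h. Q *v h)) (at p)" for p
    using has_derivative_add[OF has_derivative_const[of c]
        bounded_linear_imp_has_derivative[OF matrix_vector_mul_bounded_linear[of Q]]] by simp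
  show ?thesis
  proof
    show "open {p. c + Q *v p \<in> \<Omega>}"
      using continuous_open_preimage[OF cT open_UNIV op] by (simp add: vimage_def)
    obtain R where R: "\<forall>p\<in>\<Omega>. norm p \<le> R" using bdd bounded_iff by blast
    show "bounded {p. c + Q *v p \<in> \<Omega>}"
      unfolding bounded_iff
    proof (intro exI ballI)
      fix p assume "p \<in> {p. c + Q *v p \<in> \<Omega>}"
      then have "norm (c + Q *v p) \<le> R" using R by auto
      moreover have "norm (Q *v p) \<le> norm (c + Q *v p) + norm c"
        using norm_triangle_ineq4[of "c + Q *v p" c] by simp
      ultimately show "norm p \<le> R + norm c" by (simp add: nQ)
    qed
    show "continuous_on UNIV (\<lambda>p. u (c + Q *v p))"
      by (rule continuous_on_compose2[OF cont cT]) auto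
  next
    fix p assume "p \<in> {p. c + Q *v p \<in> \<Omega>}"
    then have p: "c + Q *v p \<in> \<Omega>" by simp
    have "((\<lambda>p. u (c + Q *v p)) has_derivative (\<lambda>h. g (c + Q *v p) \<bullet> (Q *v h))) (at p)"
      by (rule has_derivative_compose[OF dT grad[OF p]])
    then show "((\<lambda>p. u (c + Q *v p)) has_derivative (\<lambda>h. (transpose Q *v g (c + Q *v p)) \<bullet> h)) (at p)"
      by (simp add: dot_lmul_matrix transpose_matrix_vector)
    have "((\<lambda>p. g (c + Q *v p)) has_derivative (\<lambda>h. H (c + Q *v p) *v (Q *v h))) (at p)"
      by (rule has_derivative_compose[OF dT hess[OF p]])
    then have "((\<lambda>p. transpose Q *v g (c + Q *v p)) has_derivative
        (\<lambda>h. transpose Q *v (H (c + Q *v p) *v (Q *v h)))) (at p)"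
      by (intro bounded_linear.has_derivative[OF matrix_vector_mul_bounded_linear])
    then show "((\<lambda>p. transpose Q *v g (c + Q *v p)) has_derivative
        (\<lambda>h. (transpose Q ** H (c + Q *v p) ** Q) *v h)) (at p)"
      by (simp add: matrix_vector_mul_assoc matrix_mul_assoc)
    have "trace (transpose Q ** H (c + Q *v p) ** Q) = trace (Q ** (transpose Q ** H (c + Q *v p)))"
      by (rule trace_mul_sym)
    also have "\<dots> = trace (H (c + Q *v p))"
      using Q by (simp add: matrix_mul_assoc orthogonal_matrix_def)
    finally show "trace (transpose Q ** H (c + Q *v p) ** Q) = - f (u (c + Q *v p))"
      using eqn[OF p] by simp
  qed (use f_pos f_anti f_lip zero in auto)
qed

lemma lap_rigid:
  assumes "orthogonal_matrix Q" "c + Q *v p \<in> \<Omega>"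
  shows "has_laplacian (\<lambda>p. u (c + Q *v p)) p (- f (u (c + Q *v p)))"
  using dirichlet_solution.lap[OF transform[OF assms(1)], of p c] assms(2) by simp

text \<open>Where \<open>u1 < u2\<close>, monotonicity of \<open>f\<close> makes
  \<open>u1 - u2\<close> superharmonic, and this is exactly the set on which
  \<open>max_principle\<close> asks for it.\<close>

lemma comparison:
  assumes "open U" "bounded U" "continuous_on UNIV u1" "continuous_on UNIV u2"
    and "\<And>p. p \<in> frontier U \<Longrightarrow> u2 p \<le> u1 p"
    and "\<And>p. p \<in> U \<Longrightarrow> u1 p < u2 p \<Longrightarrow> has_laplacian u1 p (- f (u1 p))"
    and "\<And>p. p \<in> U \<Longrightarrow> u1 p < u2 p \<Longrightarrow> has_laplacian u2 p (- f (u2 p))"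
    and "p \<in> U"
  shows "u2 p \<le> u1 p"
proof -
  have "0 \<le> u1 p - u2 p"
  proof (rule max_principle[OF assms(1,2) _ _ _ assms(8)])
    show "continuous_on (closure U) (\<lambda>p. u1 p - u2 p)"
      by (intro continuous_on_diff continuous_on_subset[OF assms(3)] continuous_on_subset[OF assms(4)]) auto
    fix p assume "p \<in> U" "u1 p - u2 p < 0"
    moreover from this have "has_laplacian (\<lambda>p. u1 p - u2 p) p (- f (u1 p) - - f (u2 p))"
      by (intro has_laplacian_diff assms) auto
    ultimately show "\<exists>L\<le>0. has_laplacian (\<lambda>p. u1 p - u2 p) p L"
      using f_anti[of "u1 p" "u2 p"] by (intro exI[of _ "- f (u1 p) - - f (u2 p)"]) auto
  qed (use assms(5) in auto)
  then show ?thesis by simp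
qed

text \<open>Uniqueness for the Dirichlet problem: \<open>u\<close> and its image under
  \<open>Q\<close> solve the same problem, and the comparison applies in both directions.\<close>

lemma symmetric:
  assumes Q: "orthogonal_matrix Q" and inv: "\<And>p. Q *v p \<in> \<Omega> \<longleftrightarrow> p \<in> \<Omega>"
  shows "u (Q *v p) = u p"
proof (cases "p \<in> \<Omega>")
  case True
  have cQ: "continuous_on UNIV (\<lambda>p. u (Q *v p))"
    by (rule continuous_on_compose2[OF cont]) (auto intro!: continuous_intros)
  have lapQ: "has_laplacian (\<lambda>p. u (Q *v p)) p (- f (u (Q *v p)))" if "p \<in> \<Omega>" for p
    using lap_rigid[OF Q, of 0 p] inv that by simp
  have fr: "u (Q *v p) = u p" if "p \<in> frontier \<Omega>" for p
    using that op inv[of p] zero[of p] zero[of "Q *v p"] by (auto simp: frontier_def interior_open)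
  have "u (Q *v p) \<le> u p" by (rule comparison[OF op bdd cont cQ _ _ _ True]) (use fr lapQ lap in auto)
  moreover have "u p \<le> u (Q *v p)" by (rule comparison[OF op bdd cQ cont _ _ _ True]) (use fr lapQ lap in auto)
  ultimately show ?thesis by simp
qed (use inv[of p] zero in auto)

lemma grad_symmetric:
  assumes Q: "orthogonal_matrix Q" and inv: "\<And>p. Q *v p \<in> \<Omega> \<longleftrightarrow> p \<in> \<Omega>" and p: "p \<in> \<Omega>"
  shows "g p = transpose Q *v g (Q *v p)"
proof -
  interpret s: dirichlet_solution f "{p. 0 + Q *v p \<in> \<Omega>}" "\<lambda>p. u (0 + Q *v p)"
    "\<lambda>p. transpose Q *v g (0 + Q *v p)" "\<lambda>p. transpose Q ** H (0 + Q *v p) ** Q"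
    by (rule transform[OF Q])
  have "(u has_derivative (\<lambda>h. (transpose Q *v g (0 + Q *v p)) \<bullet> h)) (at p)"
    using s.grad[of p] inv p symmetric[OF Q inv] by simp
  from has_derivative_unique[OF this grad[OF p]]
  have "(transpose Q *v g (Q *v p)) \<bullet> h = g p \<bullet> h" for h by (metis add.left_neutral)
  then show ?thesis by (metis vector_eq_rdot)
qed

lemma deriv_u_line:
  assumes "p + t *\<^sub>R h \<in> \<Omega>"
  shows "((\<lambda>t. u (p + t *\<^sub>R h)) has_real_derivative (g (p + t *\<^sub>R h) \<bullet> h)) (at t)"
proof -
  have "((\<lambda>t. u (p + t *\<^sub>R h)) has_derivative (\<lambda>s. g (p + t *\<^sub>R h) \<bullet> (s *\<^sub>R h))) (at t)"
    by (rule has_derivative_compose[where f="\<lambda>t. p + t *\<^sub>R h" and f'="\<lambda>s. s *\<^sub>R h", OF _ grad])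
      (use assms in \<open>auto intro!: derivative_eq_intros\<close>)
  then show ?thesis by (simp add: has_field_derivative_def mult.commute[of _ "g _ \<bullet> h"])
qed

lemma deriv_reflected_difference:
  assumes "p \<in> \<Omega>"
  shows "((\<lambda>t. u (p + (- t) *\<^sub>R n) - u (p + t *\<^sub>R n)) has_real_derivative (- 2 * (g p \<bullet> n))) (at 0)"
proof -
  have d1: "((\<lambda>t. u (p + t *\<^sub>R n)) has_real_derivative (g p \<bullet> n)) (at 0)"
    using deriv_u_line[of p 0 n] assms by simp
  have "((\<lambda>t. u (p + (- t) *\<^sub>R n)) has_real_derivative ((g p \<bullet> n) * (- 1))) (at 0)"
    by (rule DERIV_chain2[where g="\<lambda>t. - t" and f="\<lambda>t. u (p + t *\<^sub>R n)"])
      (use d1 in \<open>auto intro!: derivative_eq_intros\<close>)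
  from DERIV_diff[OF this d1] show ?thesis by simp
qed

lemma deriv_g_line:
  assumes "p + t *\<^sub>R h \<in> \<Omega>"
  shows "((\<lambda>t. g (p + t *\<^sub>R h) \<bullet> w) has_real_derivative ((H (p + t *\<^sub>R h) *v h) \<bullet> w)) (at t)"
proof -
  have "((\<lambda>t. g (p + t *\<^sub>R h)) has_derivative (\<lambda>s. H (p + t *\<^sub>R h) *v (s *\<^sub>R h))) (at t)"
    by (rule has_derivative_compose[where f="\<lambda>t. p + t *\<^sub>R h" and f'="\<lambda>s. s *\<^sub>R h" and g=g, OF _ hess])
      (use assms in \<open>auto intro!: derivative_eq_intros\<close>)
  then have "((\<lambda>t. g (p + t *\<^sub>R h) \<bullet> w) has_derivative (\<lambda>s. (H (p + t *\<^sub>R h) *v (s *\<^sub>R h)) \<bullet> w)) (at t)"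
    by (auto intro!: derivative_eq_intros)
  then show ?thesis
    by (simp add: has_field_derivative_def mult.commute[of _ "(H _ *v h) \<bullet> w"] matrix_vector_mult_scaleR)
qed

lemma isCont_g: "p \<in> \<Omega> \<Longrightarrow> isCont g p"
  using hess has_derivative_continuous by blast

lemma g_zero_at_extremum:
  assumes "p \<in> \<Omega>" "open V" "p \<in> V" "(\<forall>q\<in>V. u q \<le> u p) \<or> (\<forall>q\<in>V. u p \<le> u q)"
  shows "g p = 0"
proof -
  have "(\<lambda>h. g p \<bullet> h) = (\<lambda>h. 0)"
    using differential_zero_maxmin[OF assms(3,2) grad[OF assms(1)] assms(4)] .
  then have "g p \<bullet> g p = 0" by metis
  then show ?thesis by simp
qed

end

section \<open>The crossing lemma\<close>

abbreviation pt :: "real \<Rightarrow> real \<Rightarrow> real^2" where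
  "pt x y \<equiv> vector [x, y]"

lemma vec2_eq_iff: "(p::real^2) = q \<longleftrightarrow> p $ 1 = q $ 1 \<and> p $ 2 = q $ 2"
  by (simp add: vec_eq_iff forall_2)

text \<open>The Fashoda theorem in a half plane. The end points of \<open>f\<close> enclose the
  start of \<open>g\<close> on the axis; \<open>g\<close> is prolonged to a point of the axis beyond
  all of \<open>f\<close>, so that the four end points interlace on the bottom edge of a
  box.\<close>

lemma half_plane_crossing:
  fixes f g :: "real \<Rightarrow> real^2"
  assumes "path f" "path g" "\<And>p. p \<in> path_image f \<Longrightarrow> 0 \<le> p $ 2" "\<And>p. p \<in> path_image g \<Longrightarrow> 0 \<le> p $ 2"
    and "pathstart f = pt x1 0" "pathfinish f = pt x3 0" "pathstart g = pt x2 0" "x1 < x2" "x2 < x3"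
    and up: "\<And>s. 0 \<le> s \<Longrightarrow> pathfinish g + s *\<^sub>R axis 2 1 \<notin> path_image f"
  shows "\<exists>z. z \<in> path_image f \<and> z \<in> path_image g"
proof -
  have "bounded (path_image f \<union> path_image g)" using assms by (simp add: bounded_path_image)
  then obtain M where M: "\<And>p. p \<in> path_image f \<union> path_image g \<Longrightarrow> norm p \<le> M"
    unfolding bounded_iff by blast
  have Mi: "\<bar>p $ i\<bar> \<le> M" if "p \<in> path_image f \<union> path_image g" for p i
    using M[OF that] component_le_norm_cart[of p i] by linarith
  define L where "L = M + 1"
  define e where "e = pathfinish g"
  have eg: "e \<in> path_image g" by (simp add: e_def pathfinish_in_path_image)
  have e: "0 \<le> e $ 2" "\<bar>e $ 1\<bar> \<le> M" "\<bar>e $ 2\<bar> \<le> M" using assms(4)[OF eg] Mi[of e 1] Mi[of e 2] eg by auto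
  \<comment> \<open>Straight up, to the right, and down again. The first segment avoids
    \<open>f\<close> by \<open>up\<close>, the other two because \<open>L = M + 1\<close> exceeds
    every coordinate on \<open>f\<close>.\<close>
  define g' where "g' = g +++ linepath e (pt (e $ 1) L) +++ linepath (pt (e $ 1) L) (pt L L) +++ linepath (pt L L) (pt L 0)"
  have img: "path_image g' = path_image g \<union> (closed_segment e (pt (e $ 1) L) \<union>
      (closed_segment (pt (e $ 1) L) (pt L L) \<union> closed_segment (pt L L) (pt L 0)))"
    by (simp add: g'_def path_image_join e_def)
  have box: "p \<in> cbox (pt (- L) 0) (pt L L)" if "p \<in> path_image f \<union> path_image g" for p
    using that Mi[OF that, of 1] Mi[OF that, of 2] assms(3)[of p] assms(4)[of p]
    by (auto simp: mem_box_cart forall_2 L_def)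
  have x1: "pt x1 0 \<in> path_image f" and x3: "pt x3 0 \<in> path_image f"
    using assms(5,6) pathstart_in_path_image[of f] pathfinish_in_path_image[of f] by auto
  obtain z where z: "z \<in> path_image f" "z \<in> path_image g'"
  proof (rule fashoda_interlace[of f g' "pt (- L) 0" "pt L L"])
    show "path g'" using assms(2) by (simp add: g'_def e_def)
    show "path_image f \<subseteq> cbox (pt (- L) 0) (pt L L)" using box by blast
    have seg: "closed_segment a b \<subseteq> cbox (pt (- L) 0) (pt L L)"
      if "a \<in> cbox (pt (- L) 0) (pt L L)" "b \<in> cbox (pt (- L) 0) (pt L L)" for a b
      using that by (simp add: closed_segment_subset)
    have "e \<in> cbox (pt (- L) 0) (pt L L)" "pt (e $ 1) L \<in> cbox (pt (- L) 0) (pt L L)"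
      "pt L L \<in> cbox (pt (- L) 0) (pt L L)" "pt L 0 \<in> cbox (pt (- L) 0) (pt L L)"
      using e by (auto simp: mem_box_cart forall_2 L_def abs_le_iff)
    then show "path_image g' \<subseteq> cbox (pt (- L) 0) (pt L L)" using box seg unfolding img by blast
    show "pathfinish f $ 1 < pathfinish g' $ 1"
      using Mi[of "pt x3 0" 1] x3 assms(6) by (simp add: g'_def L_def)
  qed (use assms in \<open>auto simp: g'_def\<close>)
  have "z \<notin> closed_segment e (pt (e $ 1) L)"
  proof
    assume "z \<in> closed_segment e (pt (e $ 1) L)"
    then obtain t where t: "0 \<le> t" "t \<le> 1" "z = (1 - t) *\<^sub>R e + t *\<^sub>R pt (e $ 1) L"
      unfolding closed_segment_def by blast
    have "z = e + (t * (L - e $ 2)) *\<^sub>R axis 2 1"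
      by (simp add: t(3) vec2_eq_iff axis_def algebra_simps)
    moreover have "0 \<le> t * (L - e $ 2)" using t e by (simp add: L_def)
    ultimately show False using up[of "t * (L - e $ 2)"] z(1) by (simp add: e_def)
  qed
  moreover have "z \<notin> closed_segment (pt (e $ 1) L) (pt L L)"
  proof
    assume "z \<in> closed_segment (pt (e $ 1) L) (pt L L)"
    then obtain t where "z = (1 - t) *\<^sub>R pt (e $ 1) L + t *\<^sub>R pt L L" unfolding closed_segment_def by blast
    then have "z $ 2 = (1 - t) * L + t * L" by simp
    then have "z $ 2 = L" by (simp add: algebra_simps)
    then show False using Mi[of z 2] z(1) by (simp add: L_def)
  qed
  moreover have "z \<notin> closed_segment (pt L L) (pt L 0)"
  proof
    assume "z \<in> closed_segment (pt L L) (pt L 0)"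
    then obtain t where "z = (1 - t) *\<^sub>R pt L L + t *\<^sub>R pt L 0" unfolding closed_segment_def by blast
    then have "z $ 1 = (1 - t) * L + t * L" by simp
    then have "z $ 1 = L" by (simp add: algebra_simps)
    then show False using Mi[of z 1] z(1) by (simp add: L_def)
  qed
  ultimately show ?thesis using z img by blast
qed

section \<open>Nodal domains of the difference of a solution and its reflection\<close>

definition refl_x :: "real^2^2" where
  "refl_x = vector [vector [1, 0], vector [0, -1]]"

definition refl_y :: "real^2^2" where
  "refl_y = vector [vector [-1, 0], vector [0, 1]]"

lemma refl_nth [simp]:
  "(refl_x *v p) $ 1 = p $ 1" "(refl_x *v p) $ 2 = - p $ 2"
  "(refl_y *v p) $ 1 = - p $ 1" "(refl_y *v p) $ 2 = p $ 2"
  by (simp_all add: refl_x_def refl_y_def matrix_vector_mult_def sum_2)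

lemma transpose_refl [simp]: "transpose refl_x = refl_x" "transpose refl_y = refl_y"
  by (simp_all add: refl_x_def refl_y_def transpose_def vec_eq_iff forall_2)

lemma orthogonal_refl [simp]: "orthogonal_matrix refl_x" "orthogonal_matrix refl_y"
  by (simp_all add: orthogonal_matrix) (simp_all add: refl_x_def refl_y_def matrix_matrix_mult_def mat_def vec_eq_iff forall_2 sum_2)

text \<open>\<open>D\<close> is the domain with its hole filled and \<open>K\<close> is the hole, in
  coordinates with the mirror on the first axis. The upper parts of both sets reflect into the sets,
  with opposite effects on the reflected difference: the outer boundary favours a nonnegative sign,
  the hole a nonpositive one. \<open>D_up\<close> lets a path that has left \<open>D\<close> escape
  upwards.\<close>

locale half_plane_reflection = dirichlet_solution +
  fixes D K :: "(real^2) set"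
  assumes Om: "\<Omega> = D - K" and conv: "convex D" "convex K"
    and D_up: "\<And>p s. p \<notin> D \<Longrightarrow> 0 \<le> p $ 2 \<Longrightarrow> 0 \<le> s \<Longrightarrow> p + s *\<^sub>R axis 2 1 \<notin> D"
    and D_refl: "\<And>p. p \<in> D \<Longrightarrow> 0 \<le> p $ 2 \<Longrightarrow> refl_x *v p \<in> D"
    and K_refl: "\<And>p. p \<in> K \<Longrightarrow> 0 \<le> p $ 2 \<Longrightarrow> refl_x *v p \<in> K"
begin

definition Z :: "real^2 \<Rightarrow> real" where
  "Z p = u (refl_x *v p) - u p"

lemma Z_axis: "p $ 2 = 0 \<Longrightarrow> Z p = 0"
proof -
  assume "p $ 2 = 0"
  then have "refl_x *v p = p" by (simp add: vec2_eq_iff)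
  then show ?thesis by (simp add: Z_def)
qed

lemma cont_Z: "continuous_on UNIV Z"
  unfolding Z_def by (intro continuous_intros continuous_on_compose2[OF cont]) auto

lemma Z_neg_D: "Z p < 0 \<Longrightarrow> p \<in> D"
  using u_nonneg[of "refl_x *v p"] u_pos_iff[of p] by (auto simp: Z_def Om)

lemma Z_refl_K: "refl_x *v p \<in> K \<Longrightarrow> Z p \<le> 0"
  using u_nonneg[of p] u_pos_iff[of "refl_x *v p"] by (auto simp: Z_def Om zero)

text \<open>Otherwise the component is an open set on which both \<open>u\<close> and its reflection
  solve the equation, with \<open>s * Z\<close> nonnegative on its frontier, and the maximum
  principle contradicts the sign at \<open>p0\<close>. The factor \<open>s\<close> treats both kinds
  of nodal domains at once.\<close>

lemma component_leaves:
  assumes s: "s = 1 \<or> s = -1" and p0: "0 < p0 $ 2" "s * Z p0 < 0"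
  shows "\<exists>p. path_component {p. 0 < p $ 2 \<and> s * Z p < 0} p0 p \<and> (p \<notin> D \<or> refl_x *v p \<in> K)"
proof (rule ccontr)
  assume neg: "\<not> ?thesis"
  define A where "A = {p. 0 < p $ 2 \<and> s * Z p < 0}"
  define S where "S = path_component_set A p0"
  have "continuous_on UNIV (\<lambda>p::real^2. p $ 2)" "continuous_on UNIV (\<lambda>p. s * Z p)"
    by (intro continuous_intros cont_Z)+
  then have A: "open A"
    unfolding A_def by (intro open_Collect_conj open_Collect_less continuous_intros cont_Z)
  then have S: "open S" unfolding S_def by (rule open_path_component)
  have SA: "S \<subseteq> A" unfolding S_def by (rule path_component_subset)
  have p0A: "p0 \<in> A" using p0 by (simp add: A_def)
  then have p0S: "p0 \<in> S" by (simp add: S_def path_component_refl)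
  have SD: "p \<in> D" "refl_x *v p \<notin> K" if "p \<in> S" for p
    using neg that by (auto simp: S_def A_def)
  have Sy: "0 < p $ 2" if "p \<in> S" for p using SA that by (auto simp: A_def)
  have SOm: "p \<in> \<Omega>" "refl_x *v p \<in> \<Omega>" if "p \<in> S" for p
    using SD[OF that] Sy[OF that] D_refl[of p] K_refl[of p] by (auto simp: Om)
  have "bounded S" using bdd SOm(1) bounded_subset by blast
  have "0 \<le> s * Z p0"
  proof (rule max_principle[OF S \<open>bounded S\<close> _ _ _ p0S])
    show "continuous_on (closure S) (\<lambda>p. s * Z p)"
      by (intro continuous_on_subset[OF \<open>continuous_on UNIV (\<lambda>p. s * Z p)\<close>]) auto
    show "0 \<le> s * Z p" if p: "p \<in> frontier S" for p
    proof (rule ccontr)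
      assume n: "\<not> 0 \<le> s * Z p"
      have pc: "p \<in> closure S" "p \<notin> S" using p S by (auto simp: frontier_def interior_open)
      have "closure S \<subseteq> {p. 0 \<le> p $ 2}"
        by (rule closure_minimal) (use Sy in \<open>auto intro!: closed_Collect_le continuous_intros simp: less_imp_le\<close>)
      then have "0 \<le> p $ 2" using pc by auto
      moreover have "p $ 2 \<noteq> 0" using n Z_axis[of p] by auto
      ultimately have pA: "p \<in> A" using n by (simp add: A_def)
      have "open (path_component_set A p)" "p \<in> path_component_set A p"
        using open_path_component[OF A] pA by (auto simp: path_component_refl)
      then obtain q where "q \<in> S" "path_component A p q"
        using pc(1) unfolding closure_iff_nhds_not_empty by blast
      then have "p \<in> S" unfolding S_def using path_component_trans path_component_sym
        by (metis mem_Collect_eq)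
      then show False using pc by simp
    qed
    show "\<exists>L\<le>0. has_laplacian (\<lambda>p. s * Z p) p L" if p: "p \<in> S" and n: "s * Z p < 0" for p
    proof -
      have "has_laplacian (\<lambda>p. s * Z p) p (s * (- f (u (refl_x *v p)) - - f (u p)))"
        unfolding Z_def
        using lap_rigid[OF orthogonal_refl(1), of 0 p] lap[of p] SOm[OF p]
        by (intro has_laplacian_cmul has_laplacian_diff) auto
      moreover have "s * (- f (u (refl_x *v p)) - - f (u p)) \<le> 0"
        using s n f_anti[of "u (refl_x *v p)" "u p"] f_anti[of "u p" "u (refl_x *v p)"]
        by (auto simp: Z_def)
      ultimately show ?thesis by blast
    qed
  qed
  then show False using p0 by simp
qed

lemma Z_sign_near_axis:
  assumes "pt x 0 \<in> \<Omega>" "s * (g (pt x 0) $ 2) > 0"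
  obtains t where "t > 0" "\<And>y. 0 < y \<Longrightarrow> y \<le> t \<Longrightarrow> s * Z (pt x y) < 0"
proof -
  have e: "pt x y = pt x 0 + y *\<^sub>R axis 2 1" "refl_x *v pt x y = pt x 0 + (- y) *\<^sub>R axis 2 1" for y
    by (simp_all add: vec2_eq_iff axis_def)
  have Ze: "Z (pt x y) = u (pt x 0 + (- y) *\<^sub>R axis 2 1) - u (pt x 0 + y *\<^sub>R axis 2 1)" for y
    unfolding Z_def e(2)[of y] by (subst e(1)[of y]) simp
  have "((\<lambda>y. s * Z (pt x y)) has_real_derivative s * (- 2 * (g (pt x 0) \<bullet> axis 2 1))) (at 0)"
    unfolding Ze by (intro DERIV_cmult deriv_reflected_difference assms(1))
  moreover have "s * (- 2 * (g (pt x 0) \<bullet> axis 2 1)) < 0"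
    using assms(2) by (simp add: inner_axis)
  ultimately obtain d where d: "d > 0" "\<And>h. 0 < h \<Longrightarrow> h < d \<Longrightarrow> s * Z (pt x (0 + h)) < s * Z (pt x 0)"
    using DERIV_neg_dec_right by blast
  show ?thesis
    by (rule that[of "d / 2"]) (use d Z_axis[of "pt x 0"] in auto)
qed

lemma leaves_from_axis:
  assumes s: "s = 1 \<or> s = -1" and x: "pt x 0 \<in> \<Omega>" "s * (g (pt x 0) $ 2) > 0"
  obtains p where "0 < p $ 2" "s * Z p < 0" "p \<notin> D \<or> refl_x *v p \<in> K"
    "path_component (insert (pt x 0) {p. 0 < p $ 2 \<and> s * Z p < 0}) (pt x 0) p"
proof -
  let ?A = "{p. 0 < p $ 2 \<and> s * Z p < 0}"
  obtain t where t: "t > 0" "\<And>y. 0 < y \<Longrightarrow> y \<le> t \<Longrightarrow> s * Z (pt x y) < 0"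
    using Z_sign_near_axis[OF x] by blast
  have "path_component (insert (pt x 0) ?A) (pt x 0) (pt x t)"
  proof (rule path_component_linepath)
    show "closed_segment (pt x 0) (pt x t) \<subseteq> insert (pt x 0) ?A"
    proof
      fix z assume "z \<in> closed_segment (pt x 0) (pt x t)"
      then obtain c where c: "0 \<le> c" "c \<le> 1" "z = (1 - c) *\<^sub>R pt x 0 + c *\<^sub>R pt x t"
        unfolding closed_segment_def by blast
      then have z: "z = pt x (c * t)" by (simp add: vec2_eq_iff algebra_simps)
      show "z \<in> insert (pt x 0) ?A"
      proof (cases "c = 0")
        case False
        then have "0 < c * t" "c * t \<le> t" using c t(1) by (auto simp: mult_le_cancel_right1)
        then show ?thesis using t(2) z by simp
      qed (simp add: z)
    qed
  qed
  moreover obtain p where p: "path_component ?A (pt x t) p" "p \<notin> D \<or> refl_x *v p \<in> K"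
    using component_leaves[OF s, of "pt x t"] t by auto
  moreover have "path_component (insert (pt x 0) ?A) (pt x t) p"
    using p(1) by (rule path_component_of_subset[rotated]) auto
  moreover have "p \<in> ?A" using p(1) path_component_mem(2) by blast
  ultimately show ?thesis using that path_component_trans by blast
qed

text \<open>In the upper half plane every component of \<open>{Z < 0}\<close> reaches the reflected hole, and every component
  of \<open>{Z > 0}\<close> leaves \<open>D\<close>. Hence paths that start alternately on the axis would have to meet.\<close>

lemma crossing:
  assumes x: "x1 < x2" "x2 < x3" and x1: "pt x1 0 \<in> \<Omega>" "g (pt x1 0) $ 2 > 0"
    and x2: "pt x2 0 \<in> \<Omega>" "g (pt x2 0) $ 2 < 0"
    and x3: "pt x3 0 \<in> D" "pt x3 0 \<in> K \<or> g (pt x3 0) $ 2 > 0"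
  shows False
proof -
  \<comment> \<open>Both sign sets are enlarged. In \<open>N\<close>, the points of \<open>D\<close>
    on or above the axis whose mirror image lies in the hole form a convex set, through which the
    two outer paths are joined; in \<open>P\<close>, the complement of \<open>D\<close> gives room
    for the upward continuation of the middle path.\<close>
  define N where "N = {p. 0 \<le> p $ 2 \<and> (Z p < 0 \<or> refl_x *v p \<in> K \<and> p \<in> D)} \<union> {pt x1 0, pt x3 0}"
  define P where "P = {p. 0 \<le> p $ 2 \<and> (Z p > 0 \<or> p \<notin> D)} \<union> {pt x2 0}"
  have fix0: "refl_x *v pt x 0 = pt x 0" for x by (simp add: vec2_eq_iff)
  have reach: "\<exists>p. 0 \<le> p $ 2 \<and> refl_x *v p \<in> K \<and> p \<in> D \<and> path_component N (pt x 0) p"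
    if "pt x 0 \<in> \<Omega>" "g (pt x 0) $ 2 > 0" "pt x 0 \<in> N" for x
  proof -
    obtain p where p: "0 < p $ 2" "1 * Z p < 0" "p \<notin> D \<or> refl_x *v p \<in> K"
      "path_component (insert (pt x 0) {p. 0 < p $ 2 \<and> 1 * Z p < 0}) (pt x 0) p"
      using leaves_from_axis[of 1 x] \<open>pt x 0 \<in> \<Omega>\<close> \<open>g (pt x 0) $ 2 > 0\<close> by auto
    have "insert (pt x 0) {p. 0 < p $ 2 \<and> 1 * Z p < 0} \<subseteq> N" using that(3) by (auto simp: N_def)
    then have "path_component N (pt x 0) p" using p(4) path_component_of_subset by blast
    then show ?thesis using p Z_neg_D[of p] by (intro exI[of _ p]) auto
  qed
  have x1N: "pt x1 0 \<in> N" "pt x3 0 \<in> N" by (auto simp: N_def)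
  obtain p1 where p1: "0 \<le> p1 $ 2" "refl_x *v p1 \<in> K" "p1 \<in> D" "path_component N (pt x1 0) p1"
    using reach[OF x1 x1N(1)] by blast
  obtain p3 where p3: "0 \<le> p3 $ 2" "refl_x *v p3 \<in> K" "p3 \<in> D" "path_component N (pt x3 0) p3"
  proof (cases "pt x3 0 \<in> K")
    case True
    then show ?thesis using that[of "pt x3 0"] x3 fix0[of x3] x1N(2) by (simp add: path_component_refl)
  next
    case False
    then show ?thesis using that reach[of x3] x3 x1N(2) by (auto simp: Om)
  qed
  have "path_component N p1 p3"
  proof (rule path_component_linepath)
    have "convex ({p. 0 \<le> p $ 2} \<inter> {p. refl_x *v p \<in> K} \<inter> D)"
    proof (intro convex_Int conv)
      show "convex {p::real^2. 0 \<le> p $ 2}"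
        using convex_halfspace_ge[of 0 "axis 2 1 :: real^2"] by (simp add: inner_axis')
      have "convex ((\<lambda>p. refl_x *v p) -` K)"
        by (rule convex_linear_vimage) (auto simp: conv matrix_vector_mul_linear)
      then show "convex {p. refl_x *v p \<in> K}" by (simp add: vimage_def)
    qed
    moreover have "{p. 0 \<le> p $ 2} \<inter> {p. refl_x *v p \<in> K} \<inter> D \<subseteq> N" by (auto simp: N_def)
    ultimately show "closed_segment p1 p3 \<subseteq> N"
      using p1 p3 closed_segment_subset[of p1 "{p. 0 \<le> p $ 2} \<inter> {p. refl_x *v p \<in> K} \<inter> D" p3] by auto
  qed
  then have "path_component N (pt x1 0) (pt x3 0)"
    using p1 p3 path_component_trans path_component_sym by metis
  then obtain a where a: "path a" "path_image a \<subseteq> N" "pathstart a = pt x1 0" "pathfinish a = pt x3 0"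
    unfolding path_component_def by blast
  obtain p2 where p2: "0 < p2 $ 2" "-1 * Z p2 < 0" "p2 \<notin> D \<or> refl_x *v p2 \<in> K"
      "path_component (insert (pt x2 0) {p. 0 < p $ 2 \<and> -1 * Z p < 0}) (pt x2 0) p2"
    using leaves_from_axis[of "-1" x2] x2 by auto
  \<comment> \<open>\<open>Z p2 > 0\<close> excludes that the mirror image of \<open>p2\<close> lies
    in the hole, so this path has left \<open>D\<close>.\<close>
  have p2D: "p2 \<notin> D" using p2 Z_refl_K[of p2] by auto
  have "insert (pt x2 0) {p. 0 < p $ 2 \<and> -1 * Z p < 0} \<subseteq> P" by (auto simp: P_def)
  then have "path_component P (pt x2 0) p2" using p2(4) path_component_of_subset by blast
  then obtain b where b: "path b" "path_image b \<subseteq> P" "pathstart b = pt x2 0" "pathfinish b = p2"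
    unfolding path_component_def by blast
  have disj: "N \<inter> P = {}"
  proof -
    have "pt x1 0 \<in> D" using x1 by (simp add: Om)
    moreover have "pt x2 0 \<notin> K" "pt x2 0 \<noteq> pt x1 0" "pt x2 0 \<noteq> pt x3 0"
      using x2 x by (auto simp: Om vec2_eq_iff)
    ultimately have False if "p \<in> N" "p \<in> P" for p
      using that Z_neg_D[of p] Z_refl_K[of p] Z_axis[of "pt x1 0"] Z_axis[of "pt x2 0"] Z_axis[of "pt x3 0"]
        x3(1) fix0[of x2] by (auto simp: N_def P_def)
    then show ?thesis by blast
  qed
  have NP: "0 \<le> p $ 2" if "p \<in> N \<union> P" for p using that by (auto simp: N_def P_def)
  have "\<exists>z. z \<in> path_image a \<and> z \<in> path_image b"
  proof (rule half_plane_crossing[OF a(1) b(1) _ _ a(3) a(4) b(3) x])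
    fix s :: real assume "0 \<le> s"
    then have "p2 + s *\<^sub>R axis 2 1 \<notin> D" using D_up p2D p2(1) by auto
    moreover have "0 \<le> (p2 + s *\<^sub>R axis 2 1) $ 2" using p2(1) \<open>0 \<le> s\<close> by (simp add: axis_def)
    ultimately have "p2 + s *\<^sub>R axis 2 1 \<in> P" by (simp add: P_def)
    then show "pathfinish b + s *\<^sub>R axis 2 1 \<notin> path_image a" using a(2) disj b(4) by auto
  qed (use a b NP in auto)
  then show False using a b disj by blast
qed

end

section \<open>Reflections, critical points on a line\<close>

lemma nonneg_derivative_at_right:
  fixes W :: "real \<Rightarrow> real"
  assumes "(W has_real_derivative D) (at 0)" "0 < d" "\<And>t. 0 < t \<Longrightarrow> t < d \<Longrightarrow> W 0 \<le> W t"
  shows "0 \<le> D"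
proof (rule ccontr)
  assume "\<not> 0 \<le> D"
  then obtain e where e: "e > 0" "\<And>h. 0 < h \<Longrightarrow> h < e \<Longrightarrow> W (0 + h) < W 0"
    using DERIV_neg_dec_right[OF assms(1)] by auto
  define h where "h = min d e / 2"
  have "0 < h" "h < d" "h < e" using e(1) assms(2) by (auto simp: h_def)
  then show False using e(2)[of h] assms(3)[of h] by auto
qed

section \<open>Reflection in a line and comparison in one step\<close>

definition householder :: "real^2 \<Rightarrow> real^2^2" where
  "householder n = (\<chi> i j. (if i = j then 1 else 0) - 2 * n $ i * n $ j)"

lemma householder_mult: "householder n *v p = p - (2 * (p \<bullet> n)) *\<^sub>R n"
  by (simp add: householder_def vec2_eq_iff matrix_vector_mult_def sum_2 inner_vec_def algebra_simps)

lemma orthogonal_householder: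
  assumes "norm n = 1"
  shows "orthogonal_matrix (householder n)"
proof -
  have "householder n *v (householder n *v p) = p" for p
  proof -
    have "n \<bullet> n = 1" using assms by (simp add: dot_square_norm)
    then show ?thesis by (simp add: householder_mult inner_diff_left vec2_eq_iff algebra_simps)
  qed
  then have "householder n ** householder n = mat 1"
    by (metis matrix_eq matrix_vector_mul_assoc matrix_vector_mul_lid)
  moreover have "transpose (householder n) = householder n"
    by (simp add: householder_def transpose_def vec_eq_iff)
  ultimately show ?thesis by (simp add: orthogonal_matrix)
qed

context dirichlet_solution
begin

text \<open>On the part of the frontier outside \<Omega> the left side is zero and the right side
  nonnegative, so only frontier points inside \<Omega> have to be checked and nothing is asked of
  \<open>u\<close> near its boundary.\<close>

lemma reflection_comparison:
  assumes n: "norm n = 1" and U: "open U" "U \<subseteq> \<Omega>"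
    and into: "\<And>p. p \<in> U \<Longrightarrow> p - (2 * (p \<bullet> n - s)) *\<^sub>R n \<in> \<Omega>"
    and fr: "\<And>p. p \<in> \<Omega> \<Longrightarrow> p \<in> frontier U \<Longrightarrow> u p \<le> u (p - (2 * (p \<bullet> n - s)) *\<^sub>R n)"
    and p: "p \<in> U"
  shows "u p \<le> u (p - (2 * (p \<bullet> n - s)) *\<^sub>R n)"
proof -
  have e: "(2 * s) *\<^sub>R n + householder n *v p = p - (2 * (p \<bullet> n - s)) *\<^sub>R n" for p
    by (simp add: householder_mult algebra_simps)
  show ?thesis
    unfolding e[symmetric]
  proof (rule comparison[where ?u2.0 = u and ?u1.0 = "\<lambda>p. u ((2 * s) *\<^sub>R n + householder n *v p)", OF U(1) _ _ cont _ _ _ p])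
    show "bounded U" using bdd U(2) bounded_subset by blast
    show "continuous_on UNIV (\<lambda>p. u ((2 * s) *\<^sub>R n + householder n *v p))"
      by (rule continuous_on_compose2[OF cont]) (auto intro!: continuous_intros)
    show "u p \<le> u ((2 * s) *\<^sub>R n + householder n *v p)" if "p \<in> frontier U" for p
      using fr[of p] that u_nonneg zero[of p] unfolding e by (cases "p \<in> \<Omega>") auto
    show "has_laplacian (\<lambda>p. u ((2 * s) *\<^sub>R n + householder n *v p)) p
        (- f (u ((2 * s) *\<^sub>R n + householder n *v p)))" if "p \<in> U" for p
      by (rule lap_rigid[OF orthogonal_householder[OF n]]) (use into[OF that] e in simp)
  qed (use U(2) lap in auto)
qed

lemma normal_derivative_nonpos:
  assumes n: "norm n = 1" and p: "p \<in> \<Omega>"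
    and cmp: "\<And>q. q \<in> \<Omega> \<Longrightarrow> q \<bullet> n > p \<bullet> n \<Longrightarrow> u q \<le> u (q - (2 * (q \<bullet> n - p \<bullet> n)) *\<^sub>R n)"
  shows "g p \<bullet> n \<le> 0"
proof -
  obtain d where d: "d > 0" "ball p d \<subseteq> \<Omega>" using op p by (meson openE)
  have nn: "n \<bullet> n = 1" using n by (simp add: dot_square_norm)
  have "0 \<le> - 2 * (g p \<bullet> n)"
  proof (rule nonneg_derivative_at_right[OF deriv_reflected_difference[OF p] d(1)])
    fix t :: real assume t: "0 < t" "t < d"
    have "p + t *\<^sub>R n \<in> \<Omega>" using d(2) t n by (auto simp: subset_iff dist_norm)
    moreover have "p \<bullet> n < (p + t *\<^sub>R n) \<bullet> n" using t nn by (simp add: inner_add_left)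
    moreover have eq: "p + t *\<^sub>R n - (2 * ((p + t *\<^sub>R n) \<bullet> n - p \<bullet> n)) *\<^sub>R n = p + (- t) *\<^sub>R n"
      using nn by (simp add: inner_add_left vec2_eq_iff)
    ultimately have "u (p + t *\<^sub>R n) \<le> u (p + (- t) *\<^sub>R n)"
      using cmp[of "p + t *\<^sub>R n"] unfolding eq by blast
    then show "u (p + (- 0) *\<^sub>R n) - u (p + 0 *\<^sub>R n) \<le> u (p + (- t) *\<^sub>R n) - u (p + t *\<^sub>R n)"
      by simp
  qed
  then show ?thesis by simp
qed

section \<open>Critical points on a segment and on a symmetry axis\<close>

lemma critical_on_segment:
  assumes "\<alpha> < \<beta>" "\<And>t. \<alpha> < t \<Longrightarrow> t < \<beta> \<Longrightarrow> p + t *\<^sub>R h \<in> \<Omega>" "p + \<alpha> *\<^sub>R h \<notin> \<Omega>" "p + \<beta> *\<^sub>R h \<notin> \<Omega>"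
  shows "\<exists>t. \<alpha> < t \<and> t < \<beta> \<and> g (p + t *\<^sub>R h) \<bullet> h = 0"
proof -
  have "\<exists>z. \<alpha> < z \<and> z < \<beta> \<and> ((\<lambda>t. u (p + t *\<^sub>R h)) has_real_derivative 0) (at z)"
  proof (rule Rolle[OF assms(1)])
    show "continuous_on {\<alpha>..\<beta>} (\<lambda>t. u (p + t *\<^sub>R h))"
      by (rule continuous_on_compose2[OF cont]) (auto intro!: continuous_intros)
    show "(\<lambda>t. u (p + t *\<^sub>R h)) differentiable at z" if "\<alpha> < z" "z < \<beta>" for z
      using deriv_u_line[OF assms(2)[OF that]] real_differentiable_def by blast
  qed (use assms zero in auto)
  then show ?thesis using deriv_u_line assms(2) DERIV_unique by metis
qed

text \<open>Two critical points would both be strict local maxima along the segment and enclose an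
  interior minimum, where the second derivative is nonnegative.\<close>

lemma critical_unique_on_segment:
  assumes seg: "\<And>t. \<alpha> < t \<Longrightarrow> t < \<beta> \<Longrightarrow> p + t *\<^sub>R h \<in> \<Omega>"
    and neg: "\<And>t. \<alpha> < t \<Longrightarrow> t < \<beta> \<Longrightarrow> g (p + t *\<^sub>R h) \<bullet> h = 0 \<Longrightarrow> (H (p + t *\<^sub>R h) *v h) \<bullet> h < 0"
    and s: "\<alpha> < s" "s < \<beta>" "g (p + s *\<^sub>R h) \<bullet> h = 0"
    and t: "\<alpha> < t" "t < \<beta>" "g (p + t *\<^sub>R h) \<bullet> h = 0"
  shows "s = t"
proof -
  define \<phi> where "\<phi> = (\<lambda>t. u (p + t *\<^sub>R h))"
  define \<phi>' where "\<phi>' = (\<lambda>t. g (p + t *\<^sub>R h) \<bullet> h)"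
  have d1: "(\<phi> has_real_derivative \<phi>' t) (at t)" if "\<alpha> < t" "t < \<beta>" for t
    unfolding \<phi>_def \<phi>'_def by (rule deriv_u_line[OF seg[OF that]])
  have d2: "(\<phi>' has_real_derivative (H (p + t *\<^sub>R h) *v h) \<bullet> h) (at t)" if "\<alpha> < t" "t < \<beta>" for t
    unfolding \<phi>'_def by (rule deriv_g_line[OF seg[OF that]])
  have False if st: "s < t" "\<alpha> < s" "t < \<beta>" "\<phi>' s = 0" "\<phi>' t = 0" for s t
  proof -
    have "\<exists>e>0. \<forall>h>0. h < e \<longrightarrow> \<phi>' (s + h) < \<phi>' s"
      using DERIV_neg_dec_right[OF d2[of s]] neg[of s] st by (simp add: \<phi>'_def)
    then obtain e1 where e1: "e1 > 0" "\<And>h. 0 < h \<Longrightarrow> h < e1 \<Longrightarrow> \<phi>' (s + h) < 0" using st by auto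
    have "\<exists>e>0. \<forall>h>0. h < e \<longrightarrow> \<phi>' (t - h) > \<phi>' t"
      using DERIV_neg_dec_left[OF d2[of t]] neg[of t] st by (simp add: \<phi>'_def)
    then obtain e2 where e2: "e2 > 0" "\<And>h. 0 < h \<Longrightarrow> h < e2 \<Longrightarrow> \<phi>' (t - h) > 0" using st by auto
    define k where "k = min (min e1 e2) (t - s) / 2"
    have k: "0 < k" "k < e1" "k < e2" "k < t - s" using e1(1) e2(1) st by (auto simp: k_def)
    have ct: "continuous_on {a..b} \<phi>" if "s \<le> a" "b \<le> t" for a b
      using st that by (intro continuous_at_imp_continuous_on ballI DERIV_isCont[OF d1]) auto
    have l: "\<phi> (s + k) < \<phi> s"
    proof (rule DERIV_neg_imp_decreasing_open[of s "s + k" \<phi>])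
      show "\<exists>y. (\<phi> has_real_derivative y) (at x) \<and> y < 0" if "s < x" "x < s + k" for x
        using d1[of x] e1(2)[of "x - s"] that st k by (intro exI[of _ "\<phi>' x"]) auto
    qed (use k ct in auto)
    have r: "\<phi> (t - k) < \<phi> t"
    proof (rule DERIV_pos_imp_increasing_open[of "t - k" t \<phi>])
      show "\<exists>y. (\<phi> has_real_derivative y) (at x) \<and> y > 0" if "t - k < x" "x < t" for x
        using d1[of x] e2(2)[of "t - x"] that st k by (intro exI[of _ "\<phi>' x"]) auto
    qed (use k ct in auto)
    obtain x where x: "x \<in> {s..t}" "\<And>y. y \<in> {s..t} \<Longrightarrow> \<phi> x \<le> \<phi> y"
      using continuous_attains_inf[OF _ _ ct[of s t]] st by auto
    have "x \<noteq> s" "x \<noteq> t" using x(2)[of "s + k"] x(2)[of "t - k"] l r k by auto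
    then have xs: "s < x" "x < t" using x(1) by auto
    have "\<phi>' (0 + x) = 0 \<and> (H (p + x *\<^sub>R h) *v h) \<bullet> h \<ge> 0"
    proof (rule second_derivative_nonneg_at_min[of "min (x - s) (t - x)" "\<lambda>y. \<phi> (y + x)" "\<lambda>y. \<phi>' (y + x)"])
      show "((\<lambda>y. \<phi> (y + x)) has_real_derivative \<phi>' (y + x)) (at y)" if "\<bar>y\<bar> < min (x - s) (t - x)" for y
        using d1[of "y + x"] that st by (subst DERIV_shift[symmetric]) (auto simp: abs_less_iff)
      show "((\<lambda>y. \<phi>' (y + x)) has_real_derivative (H (p + x *\<^sub>R h) *v h) \<bullet> h) (at 0)"
        using d2[of x] xs st by (subst DERIV_shift[symmetric]) auto
      show "\<phi> (0 + x) \<le> \<phi> (y + x)" if "\<bar>y\<bar> < min (x - s) (t - x)" for y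
        using x(2)[of "y + x"] that by (simp add: abs_less_iff)
    qed (use xs in auto)
    then show False using neg[of x] xs st by (auto simp: \<phi>'_def)
  qed
  from this[of s t] this[of t s] show ?thesis using s t by (fastforce simp: \<phi>'_def)
qed

lemma global_max_exists:
  assumes "\<Omega> \<noteq> {}"
  obtains p where "p \<in> \<Omega>" "\<And>q. u q \<le> u p"
proof -
  have "compact (closure \<Omega>)" "closure \<Omega> \<noteq> {}" using bdd assms by auto
  moreover have "continuous_on (closure \<Omega>) u" using cont continuous_on_subset by blast
  ultimately obtain p where p: "p \<in> closure \<Omega>" "\<And>q. q \<in> closure \<Omega> \<Longrightarrow> u q \<le> u p"
    using continuous_attains_sup[of "closure \<Omega>" u] by auto
  obtain q0 where "q0 \<in> \<Omega>" using assms by blast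
  then have "u p > 0" using p(2)[of q0] u_pos[of q0] closure_subset[of \<Omega>] by force
  then have pO: "p \<in> \<Omega>" by (simp add: u_pos_iff)
  have "u q \<le> u p" for q
    using p(2)[of q] zero[of q] closure_subset[of \<Omega>] u_pos[OF pO] by (cases "q \<in> \<Omega>") auto
  then show ?thesis using that pO by blast
qed

text \<open>The two mixed entries have separate reasons: one vanishes because \<open>g $ 2\<close>
  is zero along the axis, the other because \<open>g $ 1\<close> is even across it.\<close>

lemma on_symmetry_axis:
  assumes inv: "\<And>p. refl_x *v p \<in> \<Omega> \<longleftrightarrow> p \<in> \<Omega>" and p: "p \<in> \<Omega>" "p $ 2 = 0"
  shows "g p $ 2 = 0" "H p $ 2 $ 1 = 0" "H p $ 1 $ 2 = 0"
proof -
  note gs = grad_symmetric[OF orthogonal_refl(1) inv]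
  have g2: "g q $ 2 = 0" if "q \<in> \<Omega>" "q $ 2 = 0" for q
  proof -
    have "refl_x *v q = q" using that by (simp add: vec2_eq_iff)
    then have "g q $ 2 = - (g q $ 2)" using arg_cong[OF gs[OF that(1)], of "\<lambda>v. v $ 2"] by simp
    then show ?thesis by simp
  qed
  show "g p $ 2 = 0" by (rule g2[OF p])
  obtain d where d: "d > 0" "ball p d \<subseteq> \<Omega>" using op p by (meson openE)
  have inO: "p + t *\<^sub>R axis i 1 \<in> \<Omega>" if "\<bar>t\<bar> < d" for t i
    using d that by (auto simp: subset_iff dist_norm)
  have "((\<lambda>t. g (p + t *\<^sub>R axis 1 1) \<bullet> axis 2 1) has_real_derivative (H p *v axis 1 1) \<bullet> axis 2 1) (at 0)"
    using deriv_g_line[of p 0 "axis 1 1" "axis 2 1"] p by simp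
  moreover have "((\<lambda>t. g (p + t *\<^sub>R axis 1 1) \<bullet> axis 2 1) has_real_derivative 0) (at 0)"
  proof (rule has_field_derivative_transform_within[where f="\<lambda>t. 0"])
    fix t :: real assume "dist t 0 < d"
    then show "0 = g (p + t *\<^sub>R axis 1 1) \<bullet> axis 2 1"
      using g2[OF inO[of t 1]] p by (simp add: inner_axis) (simp add: axis_def)
  qed (use d in auto)
  ultimately have "(H p *v axis 1 1) \<bullet> axis 2 1 = 0" using DERIV_unique by blast
  then show "H p $ 2 $ 1 = 0" by (simp add: inner_axis matrix_vector_mult_basis column_def)
  have D: "((\<lambda>t. g (p + t *\<^sub>R axis 2 1) \<bullet> axis 1 1) has_real_derivative (H p *v axis 2 1) \<bullet> axis 1 1) (at 0)"
    using deriv_g_line[of p 0 "axis 2 1" "axis 1 1"] p by simp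
  have "((\<lambda>t. g (p + (- t) *\<^sub>R axis 2 1) \<bullet> axis 1 1) has_real_derivative ((H p *v axis 2 1) \<bullet> axis 1 1) * (- 1)) (at 0)"
    by (rule DERIV_chain2[where g="\<lambda>t. - t" and f="\<lambda>t. g (p + t *\<^sub>R axis 2 1) \<bullet> axis 1 1"])
      (use D in \<open>auto intro!: derivative_eq_intros\<close>)
  then have "((\<lambda>t. g (p + t *\<^sub>R axis 2 1) \<bullet> axis 1 1) has_real_derivative ((H p *v axis 2 1) \<bullet> axis 1 1) * (- 1)) (at 0)"
  proof (rule has_field_derivative_transform_within)
    fix t :: real assume t: "dist t 0 < d"
    have "refl_x *v (p + t *\<^sub>R axis 2 1) = p + (- t) *\<^sub>R axis 2 1"
      using p by (simp add: vec2_eq_iff axis_def)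
    then have "g (p + t *\<^sub>R axis 2 1) $ 1 = g (p + (- t) *\<^sub>R axis 2 1) $ 1"
      using arg_cong[OF gs[OF inO[of t 2]], of "\<lambda>v. v $ 1"] t by simp
    then show "g (p + (- t) *\<^sub>R axis 2 1) \<bullet> axis 1 1 = g (p + t *\<^sub>R axis 2 1) \<bullet> axis 1 1"
      by (simp add: inner_axis)
  qed (use d in auto)
  then have "(H p *v axis 2 1) \<bullet> axis 1 1 = ((H p *v axis 2 1) \<bullet> axis 1 1) * (- 1)"
    using D DERIV_unique by blast
  then show "H p $ 1 $ 2 = 0" by (simp add: inner_axis matrix_vector_mult_basis column_def)
qed

end

section \<open>The eccentric annulus\<close>

lemma norm_sq_2: "(norm (p::real^2))\<^sup>2 = (p $ 1)\<^sup>2 + (p $ 2)\<^sup>2"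
  unfolding power2_norm_eq_inner by (simp add: inner_vec_def sum_2 power2_eq_square)

lemma norm_less_2: "0 < R \<Longrightarrow> norm (p::real^2) < R \<longleftrightarrow> (p $ 1)\<^sup>2 + (p $ 2)\<^sup>2 < R\<^sup>2"
  unfolding norm_sq_2[symmetric]
  using power_less_imp_less_base[of "norm p" 2 R] power_strict_mono[of "norm p" R 2] by auto

lemma norm_le_2: "0 \<le> R \<Longrightarrow> norm (p::real^2) \<le> R \<longleftrightarrow> (p $ 1)\<^sup>2 + (p $ 2)\<^sup>2 \<le> R\<^sup>2"
  unfolding norm_sq_2[symmetric]
  using power2_le_imp_le[of "norm p" R] power_mono[of "norm p" R 2] by auto

lemma norm_pt_axis [simp]: "norm (pt x 0) = \<bar>x\<bar>" "norm (pt 0 x) = \<bar>x\<bar>"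
  by (simp_all add: norm_vec_def L2_set_def sum_2)

locale eccentric = dirichlet_solution +
  fixes a r R :: real
  assumes a: "0 < a" and r: "0 < r" and aR: "a + r < R"
    and Om: "\<Omega> = ball 0 R - cball (pt a 0) r"
begin

lemma R_pos: "0 < R" using a r aR by simp

lemma mem_iff: "p \<in> \<Omega> \<longleftrightarrow> norm p < R \<and> r < norm (p - pt a 0)"
  by (auto simp: Om dist_norm norm_minus_commute)

lemma mem_axis: "pt x 0 \<in> \<Omega> \<longleftrightarrow> (- R < x \<and> x < a - r) \<or> (a + r < x \<and> x < R)"
proof -
  have "pt x 0 - pt a 0 = pt (x - a) 0" by (simp add: vec2_eq_iff)
  then show ?thesis unfolding mem_iff using a r aR by auto
qed

lemma inv: "refl_x *v p \<in> \<Omega> \<longleftrightarrow> p \<in> \<Omega>"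
proof -
  have "norm (refl_x *v q) = norm q" for q
    by (rule power2_eq_imp_eq) (simp_all add: norm_sq_2)
  from this[of p] this[of "p - pt a 0"] show ?thesis
    by (simp add: mem_iff matrix_vector_mult_diff_distrib)
      (simp add: vec2_eq_iff norm_vec_def L2_set_def sum_2)
qed

text \<open>The mirror separates the two centres. Reflecting the side of the hole's centre brings a
  point nearer to the centre of the outer disc and further from that of the hole, so its image stays
  in \<Omega>.\<close>

lemma moving_plane:
  assumes n: "norm n = 1" and s: "0 \<le> s" "s \<le> a * n $ 1" and p: "p \<in> \<Omega>" "s \<le> p \<bullet> n"
  shows "u p \<le> u (p - (2 * (p \<bullet> n - s)) *\<^sub>R n)"
proof (cases "p \<bullet> n = s")
  case False
  define U where "U = {p \<in> \<Omega>. s < p \<bullet> n}"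
  have nn: "n \<bullet> n = 1" using n by (simp add: dot_square_norm)
  have U: "open U"
  proof -
    have "U = \<Omega> \<inter> {p. s < n \<bullet> p}" by (auto simp: U_def inner_commute)
    then show ?thesis using op open_halfspace_gt by auto
  qed
  show ?thesis
  proof (rule reflection_comparison[OF n U])
    show "q - (2 * (q \<bullet> n - s)) *\<^sub>R n \<in> \<Omega>" if "q \<in> U" for q
    proof -
      define k where "k = 2 * (q \<bullet> n - s)"
      have q: "norm q < R" "r < norm (q - pt a 0)" "0 < k" using that by (auto simp: U_def mem_iff k_def)
      have an: "pt a 0 \<bullet> n = a * n $ 1" by (simp add: inner_vec_def sum_2)
      have "(norm (q - k *\<^sub>R n))\<^sup>2 = (norm q)\<^sup>2 - 2 * k * s"
        unfolding power2_norm_eq_inner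
        by (simp add: inner_diff inner_commute nn k_def algebra_simps)
      moreover have "0 \<le> 2 * k * s" using q s by simp
      ultimately have "(norm (q - k *\<^sub>R n))\<^sup>2 \<le> (norm q)\<^sup>2" by linarith
      then have 1: "norm (q - k *\<^sub>R n) \<le> norm q" by (rule power2_le_imp_le) simp
      have "(norm (q - k *\<^sub>R n - pt a 0))\<^sup>2 = (norm (q - pt a 0))\<^sup>2 + 2 * k * (a * n $ 1 - s)"
        unfolding power2_norm_eq_inner an[symmetric]
        by (simp add: inner_diff inner_commute nn k_def algebra_simps)
      moreover have "0 \<le> 2 * k * (a * n $ 1 - s)" using q s by simp
      ultimately have "(norm (q - pt a 0))\<^sup>2 \<le> (norm (q - k *\<^sub>R n - pt a 0))\<^sup>2" by linarith
      then have 2: "norm (q - pt a 0) \<le> norm (q - k *\<^sub>R n - pt a 0)" by (rule power2_le_imp_le) simp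
      show ?thesis using 1 2 q by (simp add: mem_iff k_def)
    qed
    show "u q \<le> u (q - (2 * (q \<bullet> n - s)) *\<^sub>R n)" if q: "q \<in> \<Omega>" "q \<in> frontier U" for q
    proof -
      have "closure U \<subseteq> {p. s \<le> n \<bullet> p}"
        by (rule closure_minimal[OF _ closed_halfspace_ge]) (auto simp: U_def inner_commute)
      then have "s \<le> q \<bullet> n" using q by (auto simp: frontier_def inner_commute)
      moreover have "\<not> s < q \<bullet> n" using q U by (auto simp: frontier_def interior_open U_def)
      ultimately have "q \<bullet> n = s" by simp
      then show ?thesis by simp
    qed
  qed (use p False in \<open>auto simp: U_def\<close>)
qed simp

lemma grad_nonpos:
  assumes p: "p \<in> \<Omega>" and w: "w \<noteq> 0" "0 \<le> p \<bullet> w" "p \<bullet> w \<le> a * w $ 1"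
  shows "g p \<bullet> w \<le> 0"
proof -
  define n where "n = (1 / norm w) *\<^sub>R w"
  have n: "norm n = 1" using w by (simp add: n_def)
  have "p \<bullet> n = p \<bullet> w / norm w" "a * n $ 1 = a * w $ 1 / norm w" by (simp_all add: n_def)
  then have "0 \<le> p \<bullet> n" "p \<bullet> n \<le> a * n $ 1" using w by (simp_all add: divide_right_mono)
  then have "g p \<bullet> n \<le> 0"
    using normal_derivative_nonpos[OF n p] moving_plane[OF n, of "p \<bullet> n"] by simp
  then show ?thesis using w by (simp add: n_def divide_le_0_iff)
qed

text \<open>For a whole range of directions \<open>w\<close> the function \<open>g \<bullet> w\<close> is nonpositive near \<open>p\<close> and vanishes
  at a critical point \<open>p\<close>; so its gradient vanishes there, and two directions kill the Hessian.\<close>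

lemma not_critical:
  assumes p: "p \<in> \<Omega>" and pos: "p $ 2 \<noteq> 0 \<or> 0 < p $ 1 \<and> p $ 1 < a"
  shows "g p \<noteq> 0"
proof
  assume g0: "g p = 0"
  have key: "(H p *v h) \<bullet> pt 1 \<nu> = 0" if nu: "0 < p \<bullet> pt 1 \<nu>" "p \<bullet> pt 1 \<nu> < a" for \<nu> h
  proof -
    have "isCont (\<lambda>t. (p + t *\<^sub>R h) \<bullet> pt 1 \<nu>) 0" "isCont (\<lambda>t. p + t *\<^sub>R h) 0" by (intro continuous_intros)+
    then have "((\<lambda>t. (p + t *\<^sub>R h) \<bullet> pt 1 \<nu>) \<longlongrightarrow> p \<bullet> pt 1 \<nu>) (at 0)" "((\<lambda>t. p + t *\<^sub>R h) \<longlongrightarrow> p) (at 0)"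
      by (simp_all add: isCont_def)
    then have "\<forall>\<^sub>F t in at 0. 0 < (p + t *\<^sub>R h) \<bullet> pt 1 \<nu>" "\<forall>\<^sub>F t in at 0. (p + t *\<^sub>R h) \<bullet> pt 1 \<nu> < a"
      "\<forall>\<^sub>F t in at 0. p + t *\<^sub>R h \<in> \<Omega>"
      using nu p op by (auto intro: order_tendstoD topological_tendstoD)
    then have "\<forall>\<^sub>F t in at 0. g (p + t *\<^sub>R h) \<bullet> pt 1 \<nu> \<le> 0"
    proof eventually_elim
      case (elim t)
      then show ?case using grad_nonpos[of "p + t *\<^sub>R h" "pt 1 \<nu>"] by (simp add: vec2_eq_iff)
    qed
    then obtain d where d: "d > 0" "\<And>t. t \<noteq> 0 \<Longrightarrow> dist t 0 < d \<Longrightarrow> g (p + t *\<^sub>R h) \<bullet> pt 1 \<nu> \<le> 0"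
      unfolding eventually_at by blast
    have "((\<lambda>t. g (p + t *\<^sub>R h) \<bullet> pt 1 \<nu>) has_real_derivative (H p *v h) \<bullet> pt 1 \<nu>) (at 0)"
      using deriv_g_line[of p 0 h "pt 1 \<nu>"] p by simp
    then show ?thesis
    proof (rule DERIV_local_max[OF _ d(1)])
      show "\<forall>y. \<bar>0 - y\<bar> < d \<longrightarrow> g (p + y *\<^sub>R h) \<bullet> pt 1 \<nu> \<le> g (p + 0 *\<^sub>R h) \<bullet> pt 1 \<nu>"
        using d(2) g0 by (metis abs_minus_commute dist_real_def inner_zero_left order_refl scaleR_zero_left add_0_right)
    qed
  qed
  \<comment> \<open>On the axis the product with \<open>pt 1 \<nu>\<close> does not depend on \<nu>,
    so any two slopes do. Off the axis the slopes are solved for so that the product takes the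
    values \<open>a / 2\<close> and \<open>a / 3\<close>.\<close>
  obtain \<nu>1 \<nu>2 where nu: "\<nu>1 \<noteq> \<nu>2" "0 < p \<bullet> pt 1 \<nu>1" "p \<bullet> pt 1 \<nu>1 < a" "0 < p \<bullet> pt 1 \<nu>2" "p \<bullet> pt 1 \<nu>2 < a"
  proof (cases "p $ 2 = 0")
    case True
    then show ?thesis using pos that[of 0 1] by (simp add: inner_vec_def sum_2)
  next
    case False
    then show ?thesis using a that[of "(a / 2 - p $ 1) / p $ 2" "(a / 3 - p $ 1) / p $ 2"]
      by (simp add: inner_vec_def sum_2)
  qed
  have "H p $ i $ i = 0" for i
  proof -
    have e: "(H p *v axis i 1) \<bullet> pt 1 \<nu> = H p $ 1 $ i + \<nu> * H p $ 2 $ i" for \<nu>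
      by (simp add: inner_vec_def sum_2 matrix_vector_mult_basis column_def)
    have "H p $ 1 $ i + \<nu>1 * H p $ 2 $ i = 0" "H p $ 1 $ i + \<nu>2 * H p $ 2 $ i = 0"
      using key[OF nu(2,3), of "axis i 1"] key[OF nu(4,5), of "axis i 1"] unfolding e by auto
    then have "(\<nu>1 - \<nu>2) * H p $ 2 $ i = 0" unfolding left_diff_distrib by linarith
    then have "H p $ 2 $ i = 0" using nu(1) by simp
    then have "H p $ 1 $ i = 0" "H p $ 2 $ i = 0" using \<open>H p $ 1 $ i + \<nu>1 * H p $ 2 $ i = 0\<close> by auto
    then show ?thesis using exhaust_2[of i] by auto
  qed
  then have "trace (H p) = 0" by (simp add: trace_def)
  then show False using eqn[OF p] f_pos[of "u p"] by simp
qed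

text \<open>The direction \<open>pt t (- x)\<close> is orthogonal to the point at height
  \<open>t\<close> above \<open>pt x 0\<close>, so the mirror passes through the origin and the
  angular derivative has a sign. Differentiating it at \<open>t = 0\<close> gives a nonnegative
  second derivative across the axis, and the negative trace makes the one along the axis
  negative.\<close>

lemma short_hessian:
  assumes x: "a + r < x" "x < R" and g0: "g (pt x 0) = 0"
  shows "H (pt x 0) $ 1 $ 1 < 0"
proof -
  let ?p = "pt x 0"
  have p: "?p \<in> \<Omega>" using x by (simp add: mem_axis)
  obtain d where d: "d > 0" "ball ?p d \<subseteq> \<Omega>" using op p by (meson openE)
  have "((\<lambda>t. x * (g (?p + t *\<^sub>R axis 2 1) \<bullet> axis 2 1) - t * (g (?p + t *\<^sub>R axis 2 1) \<bullet> axis 1 1))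
     has_real_derivative x * ((H ?p *v axis 2 1) \<bullet> axis 2 1) -
       (1 * (g (?p + 0 *\<^sub>R axis 2 1) \<bullet> axis 1 1) + ((H ?p *v axis 2 1) \<bullet> axis 1 1) * 0)) (at 0)"
    using deriv_g_line[of ?p 0 "axis 2 1"] p
    by (intro DERIV_diff DERIV_cmult DERIV_mult DERIV_ident) simp_all
  then have "0 \<le> x * ((H ?p *v axis 2 1) \<bullet> axis 2 1) -
       (1 * (g (?p + 0 *\<^sub>R axis 2 1) \<bullet> axis 1 1) + ((H ?p *v axis 2 1) \<bullet> axis 1 1) * 0)"
  proof (rule nonneg_derivative_at_right[OF _ d(1)])
    fix t :: real assume t: "0 < t" "t < d"
    have q: "?p + t *\<^sub>R axis 2 1 \<in> \<Omega>" using d(2) t by (auto simp: subset_iff dist_norm)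
    have "g (?p + t *\<^sub>R axis 2 1) \<bullet> pt t (- x) \<le> 0"
      by (rule grad_nonpos[OF q]) (use t a in \<open>auto simp: vec2_eq_iff inner_vec_def sum_2 axis_def\<close>)
    then show "x * (g (?p + 0 *\<^sub>R axis 2 1) \<bullet> axis 2 1) - 0 * (g (?p + 0 *\<^sub>R axis 2 1) \<bullet> axis 1 1)
       \<le> x * (g (?p + t *\<^sub>R axis 2 1) \<bullet> axis 2 1) - t * (g (?p + t *\<^sub>R axis 2 1) \<bullet> axis 1 1)"
      using g0 by (simp add: inner_axis) (simp add: inner_vec_def sum_2 algebra_simps)
  qed
  then have "0 \<le> x * H ?p $ 2 $ 2" using g0 by (simp add: inner_axis matrix_vector_mult_basis column_def)
  then have "0 \<le> H ?p $ 2 $ 2" using x a r by (simp add: zero_le_mult_iff)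
  then show ?thesis using eqn[OF p] f_pos[of "u ?p"] by (simp add: trace_def sum_2)
qed

end

section \<open>Tilted mirrors and the long semi-axis of the annulus\<close>

definition rotation :: "real \<Rightarrow> real \<Rightarrow> real^2^2" where
  "rotation c s = vector [vector [c, - s], vector [s, c]]"

lemma rotation_nth [simp]:
  "(rotation c s *v p) $ 1 = c * p $ 1 - s * p $ 2" "(rotation c s *v p) $ 2 = s * p $ 1 + c * p $ 2"
  by (simp_all add: rotation_def matrix_vector_mult_def sum_2)

lemma orthogonal_rotation:
  "c\<^sup>2 + s\<^sup>2 = 1 \<Longrightarrow> orthogonal_matrix (rotation c s)"
  by (simp add: orthogonal_matrix)
    (simp add: rotation_def transpose_def matrix_matrix_mult_def mat_def vec_eq_iff forall_2 sum_2
      power2_eq_square algebra_simps)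

lemma norm_rotation_shift:
  assumes "c\<^sup>2 + s\<^sup>2 = 1"
  shows "(norm (pt \<xi> 0 + rotation c s *v p))\<^sup>2
    = \<xi>\<^sup>2 + 2 * \<xi> * (c * p $ 1 - s * p $ 2) + ((p $ 1)\<^sup>2 + (p $ 2)\<^sup>2)"
proof -
  have "(norm (pt \<xi> 0 + rotation c s *v p))\<^sup>2
    = \<xi>\<^sup>2 + 2 * \<xi> * (c * p $ 1 - s * p $ 2) + (c\<^sup>2 + s\<^sup>2) * ((p $ 1)\<^sup>2 + (p $ 2)\<^sup>2)"
    unfolding norm_sq_2 by (simp add: power2_eq_square algebra_simps)
  then show ?thesis using assms by simp
qed

context eccentric
begin

text \<open>If \<open>H $ 2 $ 2 < H $ 1 $ 1\<close>, then on a slightly tilted line through the critical point the normal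
  derivative changes sign there, and the hole meets the line further right: the crossing lemma applies.\<close>

lemma long_hessian_le:
  assumes x0: "- R < x0" "x0 \<le> 0" "x0 < a - r" and g0: "g (pt x0 0) = 0"
  shows "H (pt x0 0) $ 1 $ 1 \<le> H (pt x0 0) $ 2 $ 2"
proof (rule ccontr)
  assume less: "\<not> ?thesis"
  let ?p = "pt x0 0"
  have p: "?p \<in> \<Omega>" using x0 by (simp add: mem_axis)
  define l where "l = a - x0"
  have l: "0 < l" using a x0 by (simp add: l_def)
  \<comment> \<open>The sine of the tilt. The foot of the perpendicular from the hole's centre lies
    at parameter \<open>l * c\<close> on the line and at distance \<open>s * l\<close> from that
    centre, so the foot is in the closed hole; the bound 1/2 keeps the cosine positive.\<close>
  define s where "s = min (r / l) (1 / 2)"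
  have s: "0 < s" "s \<le> 1 / 2" "s * l \<le> r" using r l by (auto simp: s_def min_def field_simps)
  define c where "c = sqrt (1 - s\<^sup>2)"
  have "s\<^sup>2 < 1" using s by (simp add: power_less_one_iff)
  then have cs: "c\<^sup>2 + s\<^sup>2 = 1" "0 < c" by (auto simp: c_def)
  define T where "T = (\<lambda>p. ?p + rotation c s *v p)"
  define D where "D = {p. T p \<in> ball 0 R}"
  define K where "K = {p. T p \<in> cball (pt a 0) r}"
  have Ta: "T p - pt a 0 = pt (- l) 0 + rotation c s *v p" for p
    by (simp add: T_def l_def vec2_eq_iff)
  have memD: "p \<in> D \<longleftrightarrow> (norm (T p))\<^sup>2 < R\<^sup>2" for p
    using R_pos by (simp add: D_def norm_less_2 norm_sq_2)
  have memK: "p \<in> K \<longleftrightarrow> (norm (T p - pt a 0))\<^sup>2 \<le> r\<^sup>2" for p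
    unfolding K_def using r norm_le_2[of r "T p - pt a 0"] by (simp add: norm_sq_2 dist_norm norm_minus_commute)
  have nT: "(norm (T p))\<^sup>2 = x0\<^sup>2 + 2 * x0 * (c * p $ 1 - s * p $ 2) + ((p $ 1)\<^sup>2 + (p $ 2)\<^sup>2)" for p
    unfolding T_def by (rule norm_rotation_shift[OF cs(1)])
  have nTa: "(norm (T p - pt a 0))\<^sup>2 = l\<^sup>2 - 2 * l * (c * p $ 1 - s * p $ 2) + ((p $ 1)\<^sup>2 + (p $ 2)\<^sup>2)" for p
    unfolding Ta using norm_rotation_shift[OF cs(1), of "- l" p] by simp
  interpret t: dirichlet_solution f "{p. ?p + rotation c s *v p \<in> \<Omega>}" "\<lambda>p. u (?p + rotation c s *v p)"
    "\<lambda>p. transpose (rotation c s) *v g (?p + rotation c s *v p)"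
    "\<lambda>p. transpose (rotation c s) ** H (?p + rotation c s *v p) ** rotation c s"
    by (rule transform[OF orthogonal_rotation[OF cs(1)]])
  interpret t: half_plane_reflection f "{p. ?p + rotation c s *v p \<in> \<Omega>}" "\<lambda>p. u (?p + rotation c s *v p)"
    "\<lambda>p. transpose (rotation c s) *v g (?p + rotation c s *v p)"
    "\<lambda>p. transpose (rotation c s) ** H (?p + rotation c s *v p) ** rotation c s" D K
  proof
    show "{p. ?p + rotation c s *v p \<in> \<Omega>} = D - K"
      by (auto simp: D_def K_def T_def Om)
    have conv: "convex {p. T p \<in> S}" if "convex S" for S
    proof -
      have "convex ((\<lambda>p. rotation c s *v p) -` ((+) (- ?p) ` S))"
        by (intro convex_linear_vimage convex_translation that matrix_vector_mul_linear)
      moreover have "(\<lambda>p. rotation c s *v p) -` ((+) (- ?p) ` S) = {p. T p \<in> S}"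
        by (force simp: T_def)
      ultimately show ?thesis by simp
    qed
    show "convex D" "convex K" unfolding D_def K_def by (intro conv convex_ball convex_cball)+
    \<comment> \<open>Both centres lie on or below the tilted mirror, because
      \<open>x0 \<le> 0\<close> and \<open>0 < l\<close>; this is the reason for the three
      properties that follow.\<close>
    show "q + \<sigma> *\<^sub>R axis 2 1 \<notin> D" if q: "q \<notin> D" "0 \<le> q $ 2" "0 \<le> \<sigma>" for q \<sigma>
    proof -
      have "(norm (T (q + \<sigma> *\<^sub>R axis 2 1)))\<^sup>2 = (norm (T q))\<^sup>2 + (- 2 * x0 * s * \<sigma> + 2 * (q $ 2) * \<sigma> + \<sigma>\<^sup>2)"
        unfolding nT by (simp add: axis_def power2_eq_square algebra_simps)
      moreover have "x0 * (s * \<sigma>) \<le> 0" using x0 s q by (intro mult_nonpos_nonneg) auto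
      then have "0 \<le> - 2 * x0 * s * \<sigma>" by (simp add: mult_ac)
      moreover have "0 \<le> 2 * (q $ 2) * \<sigma>" using q by simp
      ultimately show ?thesis using q(1) zero_le_power2[of \<sigma>] unfolding memD by linarith
    qed
    show "refl_x *v q \<in> D" if q: "q \<in> D" "0 \<le> q $ 2" for q
    proof -
      have "(norm (T (refl_x *v q)))\<^sup>2 = (norm (T q))\<^sup>2 + 4 * (x0 * (s * q $ 2))"
        unfolding nT by (simp add: power2_eq_square algebra_simps)
      moreover have "x0 * (s * q $ 2) \<le> 0" using x0 s q by (intro mult_nonpos_nonneg) auto
      ultimately show ?thesis using q(1) unfolding memD by linarith
    qed
    show "refl_x *v q \<in> K" if q: "q \<in> K" "0 \<le> q $ 2" for q
    proof -
      have "(norm (T (refl_x *v q) - pt a 0))\<^sup>2 = (norm (T q - pt a 0))\<^sup>2 - 4 * (l * (s * q $ 2))"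
        unfolding nTa by (simp add: power2_eq_square algebra_simps)
      moreover have "0 \<le> l * (s * q $ 2)" using l s q by (intro mult_nonneg_nonneg) auto
      ultimately show ?thesis using q(1) unfolding memK by linarith
    qed
  qed
  have line: "?p + rotation c s *v pt x 0 = ?p + x *\<^sub>R pt c s" for x by (simp add: vec2_eq_iff)
  define y where "y = (\<lambda>x. (transpose (rotation c s) *v g (?p + rotation c s *v pt x 0)) $ 2)"
  have y_alt: "y x = g (?p + x *\<^sub>R pt c s) \<bullet> pt (- s) c" for x
    unfolding y_def line
    by (simp add: rotation_def transpose_def matrix_vector_mult_def sum_2 inner_vec_def)
  have "(y has_real_derivative (H ?p *v pt c s) \<bullet> pt (- s) c) (at 0)"
    unfolding y_alt using deriv_g_line[of ?p 0 "pt c s" "pt (- s) c"] p by simp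
  \<comment> \<open>The mixed entries vanish by symmetry, so the tilt turns the assumed inequality
    between the diagonal entries into a negative slope of the normal derivative along the line:
    positive to the left of the critical point, negative to the right.\<close>
  moreover have "(H ?p *v pt c s) \<bullet> pt (- s) c = (s * c) * (H ?p $ 2 $ 2 - H ?p $ 1 $ 1)"
    using on_symmetry_axis[OF inv p]
    by (simp add: matrix_vector_mult_def inner_vec_def sum_2 algebra_simps)
  moreover have "(s * c) * (H ?p $ 2 $ 2 - H ?p $ 1 $ 1) < 0"
    using less s cs by (intro mult_pos_neg) auto
  ultimately obtain D0 where D0: "(y has_real_derivative D0) (at 0)" "D0 < 0" by auto
  have y0: "y 0 = 0" using g0 by (simp add: y_alt)
  obtain e1 where e1: "e1 > 0" "\<And>h. 0 < h \<Longrightarrow> h < e1 \<Longrightarrow> y h < 0"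
    using DERIV_neg_dec_right[OF D0] y0 by auto
  obtain e2 where e2: "e2 > 0" "\<And>h. 0 < h \<Longrightarrow> h < e2 \<Longrightarrow> y (- h) > 0"
    using DERIV_neg_dec_left[OF D0] y0 by auto
  obtain e3 where e3: "e3 > 0" "ball ?p e3 \<subseteq> \<Omega>" using op p by (meson openE)
  define h where "h = min (min e1 e2) (min e3 (l * c)) / 2"
  have h: "0 < h" "h < e1" "h < e2" "h < e3" "h < l * c"
    using e1(1) e2(1) e3(1) mult_pos_pos[OF l cs(2)] by (auto simp: h_def)
  have npt: "norm (pt c s) = 1" by (rule power2_eq_imp_eq) (simp_all add: norm_sq_2 cs)
  have inO: "?p + rotation c s *v pt x 0 \<in> \<Omega>" if "\<bar>x\<bar> = h" for x
    unfolding line using e3(2) h that npt by (auto simp: subset_iff dist_norm)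
  have K3: "pt (l * c) 0 \<in> K"
  proof -
    have "(norm (T (pt (l * c) 0) - pt a 0))\<^sup>2 = l\<^sup>2 * (c\<^sup>2 + s\<^sup>2) - l\<^sup>2 * c\<^sup>2"
      unfolding nTa cs(1) by (simp add: power2_eq_square)
    also have "\<dots> = l\<^sup>2 * s\<^sup>2" by (simp add: algebra_simps)
    also have "\<dots> = (s * l)\<^sup>2" by (simp add: power_mult_distrib)
    also have "\<dots> \<le> r\<^sup>2" using s l by (intro power_mono) auto
    finally show ?thesis by (simp add: memK)
  qed
  have D3: "pt (l * c) 0 \<in> D"
  proof -
    have "norm (T (pt (l * c) 0) - pt a 0) \<le> r" using K3 by (simp add: K_def dist_norm norm_minus_commute)
    moreover have "norm (T (pt (l * c) 0)) \<le> norm (T (pt (l * c) 0) - pt a 0) + norm (pt a 0)"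
      using norm_triangle_ineq[of "T (pt (l * c) 0) - pt a 0" "pt a 0"] by simp
    ultimately show ?thesis using aR a by (simp add: D_def)
  qed
  show False
  proof (rule t.crossing[of "- h" h "l * c"])
    show "0 < (transpose (rotation c s) *v g (?p + rotation c s *v pt (- h) 0)) $ 2"
      using e2(2)[of h] h by (simp add: y_def)
    show "(transpose (rotation c s) *v g (?p + rotation c s *v pt h 0)) $ 2 < 0"
      using e1(2)[of h] h by (simp add: y_def)
  qed (use h inO[of h] inO[of "- h"] K3 D3 in auto)
qed

text \<open>A positive abscissa is excluded by \<open>not_critical\<close>, which leaves the range
  of \<open>long_hessian_le\<close>; since the trace is negative, the smaller diagonal entry is
  negative.\<close>

lemma long_hessian:
  assumes x0: "- R < x0" "x0 < a - r" and g0: "g (pt x0 0) = 0"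
  shows "H (pt x0 0) $ 1 $ 1 < 0"
proof -
  have p: "pt x0 0 \<in> \<Omega>" using x0 by (simp add: mem_axis)
  have "x0 \<le> 0" using not_critical[OF p] g0 x0 a r by force
  then show ?thesis
    using long_hessian_le[of x0] x0 g0 eqn[OF p] f_pos[of "u (pt x0 0)"] by (simp add: trace_def sum_2)
qed

text \<open>From a point of the short semi-axis, reflection in a line through the origin moves along
  a circle without decreasing \<open>u\<close>. At a local maximum the value would be unchanged, so
  the image would be a local maximum off the axis, which is not critical.\<close>

lemma local_max_long:
  assumes p: "p \<in> \<Omega>" and V: "open V" "p \<in> V" "\<And>q. q \<in> V \<Longrightarrow> u q \<le> u p"
  shows "p $ 2 = 0 \<and> p $ 1 < a - r"
proof -
  have crit: "g q = 0" if "q \<in> \<Omega>" "q \<in> V" "u q = u p" for q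
    using g_zero_at_extremum[OF that(1) V(1) that(2)] V(3) that(3) by simp
  have p2: "p $ 2 = 0" using not_critical[OF p] crit[OF p V(2)] by blast
  moreover have "p $ 1 < a - r"
  proof (rule ccontr)
    assume n: "\<not> ?thesis"
    define x where "x = p $ 1"
    have pe: "p = pt x 0" using p2 by (simp add: vec2_eq_iff x_def)
    then have "pt x 0 \<in> \<Omega>" using p by simp
    moreover have "\<not> x < a - r" using n by (simp add: x_def)
    ultimately have x: "a + r < x" using mem_axis[of x] by blast
    \<comment> \<open>The mirror image of \<open>p\<close> in the line through the origin at angle
      \<open>t\<close>, which doubles the angle.\<close>
    define \<gamma> where "\<gamma> = (\<lambda>t. pt (x * cos (2 * t)) (x * sin (2 * t)))"
    have "isCont \<gamma> 0"
    proof -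
      have "\<gamma> = (\<lambda>t. (x * cos (2 * t)) *\<^sub>R axis 1 1 + (x * sin (2 * t)) *\<^sub>R axis 2 1)"
        by (rule ext) (simp add: \<gamma>_def vec2_eq_iff axis_def)
      then show ?thesis by (simp add: continuous_intros)
    qed
    moreover have "\<gamma> 0 = p" by (simp add: \<gamma>_def pe)
    ultimately have "\<forall>\<^sub>F t in at 0. \<gamma> t \<in> V \<inter> \<Omega>"
      using V(1,2) op p by (intro topological_tendstoD) (auto simp: isCont_def)
    then obtain d where d: "d > 0" "\<And>t. t \<noteq> 0 \<Longrightarrow> dist t 0 < d \<Longrightarrow> \<gamma> t \<in> V \<inter> \<Omega>"
      unfolding eventually_at by blast
    define t where "t = min d (pi / 2) / 2"
    have t: "0 < t" "t < d" "t < pi / 2" using d(1) pi_gt_zero unfolding t_def min_def by (auto split: if_splits)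
    have st: "0 < sin t" "0 < sin (2 * t)" using t by (auto intro!: sin_gt_zero)
    have gt: "\<gamma> t \<in> V" "\<gamma> t \<in> \<Omega>" using d(2)[of t] t by auto
    define n where "n = pt (sin t) (- cos t)"
    have nn: "norm n = 1" by (rule power2_eq_imp_eq) (simp_all add: norm_sq_2 n_def)
    have pn: "p \<bullet> n = x * sin t" by (simp add: pe n_def inner_vec_def sum_2)
    have "u p \<le> u (p - (2 * (p \<bullet> n - 0)) *\<^sub>R n)"
      by (rule moving_plane[OF nn _ _ p]) (use st a r x pn in \<open>auto simp: n_def\<close>)
    moreover have "p - (2 * (p \<bullet> n - 0)) *\<^sub>R n = \<gamma> t"
      unfolding pn \<gamma>_def cos_double_sin sin_double
      by (simp add: vec2_eq_iff pe n_def power2_eq_square algebra_simps)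
    ultimately have "u (\<gamma> t) = u p" using V(3)[OF gt(1)] by simp
    then have "g (\<gamma> t) = 0" using crit gt by blast
    moreover have "\<gamma> t $ 2 \<noteq> 0" using st x a r by (simp add: \<gamma>_def)
    ultimately show False using not_critical[OF gt(2)] by blast
  qed
  ultimately show ?thesis by blast
qed

section \<open>Counting critical points of the annulus\<close>

lemma critical_axis_iff:
  assumes "pt x 0 \<in> \<Omega>"
  shows "g (pt x 0) = 0 \<longleftrightarrow> g (pt x 0) \<bullet> axis 1 1 = 0"
  using on_symmetry_axis(1)[OF inv assms] by (auto simp: inner_axis vec2_eq_iff)

lemma unique_critical_on_axis:
  assumes seg: "\<alpha> < \<beta>" "\<And>t. \<alpha> < t \<Longrightarrow> t < \<beta> \<Longrightarrow> pt t 0 \<in> \<Omega>" "pt \<alpha> 0 \<notin> \<Omega>" "pt \<beta> 0 \<notin> \<Omega>"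
    and neg: "\<And>t. \<alpha> < t \<Longrightarrow> t < \<beta> \<Longrightarrow> g (pt t 0) = 0 \<Longrightarrow> H (pt t 0) $ 1 $ 1 < 0"
  shows "\<exists>!t. \<alpha> < t \<and> t < \<beta> \<and> g (pt t 0) = 0"
proof -
  have e: "0 + t *\<^sub>R axis 1 1 = pt t 0" for t by (simp add: vec2_eq_iff axis_def)
  have H11: "(H p *v axis 1 1) \<bullet> axis 1 1 = H p $ 1 $ 1" for p
    by (simp add: inner_axis matrix_vector_mult_basis column_def)
  have "\<exists>t. \<alpha> < t \<and> t < \<beta> \<and> g (0 + t *\<^sub>R axis 1 1) \<bullet> axis 1 1 = 0"
    by (rule critical_on_segment) (use seg in \<open>auto simp only: e\<close>)
  moreover have "s = t" if "\<alpha> < s" "s < \<beta>" "g (pt s 0) = 0" "\<alpha> < t" "t < \<beta>" "g (pt t 0) = 0" for s t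
    by (rule critical_unique_on_segment[of \<alpha> \<beta> 0 "axis 1 1"])
      (use seg that neg critical_axis_iff H11 in \<open>auto simp only: e inner_zero_left\<close>)
  ultimately show ?thesis using critical_axis_iff seg(2) unfolding e by blast
qed

lemma unique_critical_long: "\<exists>!t. - R < t \<and> t < a - r \<and> g (pt t 0) = 0"
  by (rule unique_critical_on_axis) (use a r aR long_hessian in \<open>auto simp: mem_axis\<close>)

lemma unique_critical_short: "\<exists>!t. a + r < t \<and> t < R \<and> g (pt t 0) = 0"
  by (rule unique_critical_on_axis) (use a r aR short_hessian in \<open>auto simp: mem_axis\<close>)

lemma card_critical: "card {p \<in> \<Omega>. p $ 2 = 0 \<and> g p = 0} = 2"
proof -
  obtain s where s: "- R < s" "s < a - r" "g (pt s 0) = 0"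
    "\<And>t. - R < t \<Longrightarrow> t < a - r \<Longrightarrow> g (pt t 0) = 0 \<Longrightarrow> t = s"
    using unique_critical_long by blast
  obtain t where t: "a + r < t" "t < R" "g (pt t 0) = 0"
    "\<And>s. a + r < s \<Longrightarrow> s < R \<Longrightarrow> g (pt s 0) = 0 \<Longrightarrow> s = t"
    using unique_critical_short by blast
  have "{p \<in> \<Omega>. p $ 2 = 0 \<and> g p = 0} = {pt s 0, pt t 0}"
  proof (intro set_eqI iffI)
    fix p assume p: "p \<in> {p \<in> \<Omega>. p $ 2 = 0 \<and> g p = 0}"
    define x where "x = p $ 1"
    have pe: "p = pt x 0" using p by (simp add: vec2_eq_iff x_def)
    have "pt x 0 \<in> \<Omega>" "g (pt x 0) = 0" using p unfolding pe by auto
    then have "x = s \<or> x = t" using s(4)[of x] t(4)[of x] mem_axis[of x] by blast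
    then show "p \<in> {pt s 0, pt t 0}" using pe by blast
  next
    fix p assume "p \<in> {pt s 0, pt t 0}"
    then show "p \<in> {p \<in> \<Omega>. p $ 2 = 0 \<and> g p = 0}" using s(1-3) t(1-3) by (auto simp: mem_axis)
  qed
  moreover have "pt s 0 \<noteq> pt t 0" using s(2) t(1) r by (auto simp: vec2_eq_iff)
  ultimately show ?thesis by simp
qed

text \<open>The global maximum lies on the long semi-axis, and the critical point there is unique.
  This excludes saddles on that semi-axis.\<close>

lemma long_critical_max:
  assumes "p \<in> \<Omega>" "g p = 0" "p $ 1 < a - r"
  shows "u q \<le> u p"
proof -
  obtain m where m: "m \<in> \<Omega>" "\<And>q. u q \<le> u m" using global_max_exists assms(1) by blast
  have axis: "pt (x $ 1) 0 = x" "- R < x $ 1" if "x \<in> \<Omega>" "x $ 2 = 0" "x $ 1 < a - r" for x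
  proof -
    show e: "pt (x $ 1) 0 = x" using that by (simp add: vec2_eq_iff)
    show "- R < x $ 1" using that(1,3) mem_axis[of "x $ 1"] r unfolding e by auto
  qed
  have m1: "m $ 2 = 0" "m $ 1 < a - r" using local_max_long[OF m(1), of UNIV] m(2) by auto
  have gm: "g m = 0" using g_zero_at_extremum[OF m(1), of UNIV] m(2) by simp
  have p2: "p $ 2 = 0" using not_critical assms by blast
  have "m $ 1 = p $ 1"
  proof -
    have "g (pt (m $ 1) 0) = 0" "g (pt (p $ 1) 0) = 0"
      using axis(1)[OF m(1) m1] axis(1)[OF assms(1) p2 assms(3)] gm assms(2) by simp_all
    then show ?thesis
      using unique_critical_long axis(2)[OF m(1) m1] axis(2)[OF assms(1) p2 assms(3)] assms(3) m1(2) by blast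
  qed
  then have "m = p" using m1(1) p2 by (simp add: vec2_eq_iff)
  then show ?thesis using m(2) by simp
qed

end

section \<open>Derivatives and the strong maximum principle\<close>

context dirichlet_solution
begin

lemma laplacian_difference:
  assumes "has_laplacian v p (- f (v p))" "has_laplacian w p (- f (w p))"
    and "v p < w p \<Longrightarrow> f (v p) - f (w p) \<le> k * (w p - v p)" "0 \<le> k"
  shows "\<exists>L. has_laplacian (\<lambda>p. w p - v p) p L \<and> L \<le> k * max (w p - v p) 0"
proof (intro exI conjI)
  show "has_laplacian (\<lambda>p. w p - v p) p (- f (w p) - - f (v p))"
    by (intro has_laplacian_diff assms)
  show "- f (w p) - - f (v p) \<le> k * max (w p - v p) 0"
    using assms(3,4) f_anti[of "w p" "v p"] by (cases "v p < w p") (auto simp: max_def)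
qed

text \<open>The reflected difference has a Laplacian of its own, so in
  \<open>strong_max_principle\<close> it serves as its own approximation.\<close>

lemma reflection_strict:
  assumes Q: "orthogonal_matrix Q" and U: "open U" "connected U" "U \<subseteq> \<Omega>"
    and into: "\<And>p. p \<in> U \<Longrightarrow> Q *v p \<in> \<Omega>" and le: "\<And>p. p \<in> U \<Longrightarrow> u p \<le> u (Q *v p)"
    and p0: "p0 \<in> U" "u (Q *v p0) = u p0" and p: "p \<in> U"
  shows "u (Q *v p) = u p"
proof -
  obtain k where k: "k \<ge> 0" "\<And>p q. u q \<le> u p \<Longrightarrow> f (u q) - f (u p) \<le> k * (u p - u q)"
    using lip_const by blast
  have cz: "continuous_on S (\<lambda>p. u (Q *v p) - u p)" for S
    by (intro continuous_on_diff continuous_on_compose2[OF cont] continuous_on_subset[OF cont])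
      (auto intro!: continuous_intros)
  have "u (Q *v p) - u p = 0"
  proof (rule strong_max_principle[OF U(1,2) k(1) cz _ _ p0(1) _ p])
    fix q \<rho> \<eta> assume "cball q \<rho> \<subseteq> U" "0 < (\<eta>::real)"
    moreover have "\<exists>L. has_laplacian (\<lambda>p. u (Q *v p) - u p) p L \<and> L \<le> k * max (u (Q *v p) - u p) 0" if "p \<in> U" for p
      using lap_rigid[OF Q, of 0 p] into[OF that] lap[of p] U(3) that k
      by (intro laplacian_difference) auto
    ultimately show "\<exists>z. continuous_on (cball q \<rho>) z \<and>
         (\<forall>p\<in>ball q \<rho>. \<exists>L. has_laplacian z p L \<and> L \<le> k * max (z p) 0) \<and>
         (\<forall>p\<in>cball q \<rho>. \<bar>z p - (u (Q *v p) - u p)\<bar> \<le> \<eta>)"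
      using cz by (intro exI[of _ "\<lambda>p. u (Q *v p) - u p"]) (auto simp: subset_iff)
  qed (use le p0 in auto)
  then show ?thesis by simp
qed

lemma difference_quotient:
  assumes "0 < h" "\<And>t. 0 \<le> t \<Longrightarrow> t \<le> h \<Longrightarrow> p + t *\<^sub>R w \<in> \<Omega>"
  obtains t where "0 < t" "t < h" "u (p + h *\<^sub>R w) - u p = h * (g (p + t *\<^sub>R w) \<bullet> w)"
proof -
  have "\<exists>z>0. z < h \<and> u (p + h *\<^sub>R w) - u (p + 0 *\<^sub>R w) = (h - 0) * (g (p + z *\<^sub>R w) \<bullet> w)"
    by (rule MVT2[OF assms(1)]) (use deriv_u_line assms(2) in auto)
  then show ?thesis using that by auto
qed

text \<open>The strong maximum principle for a first derivative of \<open>u\<close>, which is only \<open>C\<^sup>1\<close>: it is a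
  locally uniform limit of difference quotients, to which the maximum principle applies.\<close>

lemma strong_max_principle_derivative:
  assumes w: "norm w = 1" and U: "open U" "connected U" "U \<subseteq> \<Omega>"
    and nn: "\<And>p. p \<in> U \<Longrightarrow> 0 \<le> g p \<bullet> w" and p0: "p0 \<in> U" "g p0 \<bullet> w = 0" and p: "p \<in> U"
  shows "g p \<bullet> w = 0"
proof -
  obtain k where k: "k \<ge> 0" "\<And>p q. u q \<le> u p \<Longrightarrow> f (u q) - f (u p) \<le> k * (u p - u q)"
    using lip_const by blast
  have cg: "continuous_on S (\<lambda>p. g p \<bullet> w)" if "S \<subseteq> \<Omega>" for S
    using isCont_g that by (intro continuous_at_imp_continuous_on ballI) (auto intro!: continuous_intros)
  show ?thesis
  proof (rule strong_max_principle[OF U(1,2) k(1) cg[OF U(3)] nn _ p0 p])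
    fix q \<rho> \<eta> assume qr: "cball q \<rho> \<subseteq> U" and \<eta>: "0 < (\<eta>::real)"
    show "\<exists>z. continuous_on (cball q \<rho>) z \<and>
         (\<forall>p\<in>ball q \<rho>. \<exists>L. has_laplacian z p L \<and> L \<le> k * max (z p) 0) \<and>
         (\<forall>p\<in>cball q \<rho>. \<bar>z p - g p \<bullet> w\<bar> \<le> \<eta>)"
    proof (cases "cball q \<rho> = {}")
      case True
      then show ?thesis
        by (intro exI[of _ "\<lambda>p. 0"]) (auto intro: exI[of _ "0::real"] has_laplacian_const)
    next
      case False
      then have \<rho>: "0 \<le> \<rho>" by simp
      \<comment> \<open>A margin around the disc, so that points of the disc shifted by a small step
        stay in \<Omega>.\<close>
      obtain e where e: "e > 0" "{x. infdist x (cball q \<rho>) \<le> e} \<subseteq> \<Omega>"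
        using compact_in_open_separated[OF False compact_cball op] qr U(3) by blast
      have big: "cball q (\<rho> + e) \<subseteq> \<Omega>"
      proof
        fix x assume x: "x \<in> cball q (\<rho> + e)"
        show "x \<in> \<Omega>"
        proof (cases "dist q x \<le> \<rho>")
          case True then show ?thesis using qr U(3) by (auto simp: subset_iff)
        next
          case False
          define d where "d = dist q x"
          have d: "\<rho> < d" "d \<le> \<rho> + e" "0 < d" using False x \<rho> by (auto simp: d_def)
          define y where "y = q + (\<rho> / d) *\<^sub>R (x - q)"
          have "dist q y = \<rho>" using \<rho> d by (simp add: y_def dist_norm d_def norm_minus_commute)
          then have "infdist x (cball q \<rho>) \<le> dist x y" by (intro infdist_le) auto
          also have "x - y = (1 - \<rho> / d) *\<^sub>R (x - q)" by (simp add: y_def algebra_simps)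
          then have "dist x y = (1 - \<rho> / d) * d"
            using d \<rho> by (simp add: dist_norm d_def norm_minus_commute)
          also have "\<dots> = d - \<rho>" using d by (simp add: field_simps)
          finally show ?thesis using d e(2) by auto
        qed
      qed
      have "uniformly_continuous_on (cball q (\<rho> + e)) (\<lambda>p. g p \<bullet> w)"
        by (intro compact_uniformly_continuous cg big) auto
      then obtain \<delta> where \<delta>: "\<delta> > 0" "\<And>x y. x \<in> cball q (\<rho> + e) \<Longrightarrow> y \<in> cball q (\<rho> + e) \<Longrightarrow>
          dist y x < \<delta> \<Longrightarrow> dist (g y \<bullet> w) (g x \<bullet> w) < \<eta>"
        using \<eta> unfolding uniformly_continuous_on_def by blast
      define h where "h = min e \<delta> / 2"
      have h: "0 < h" "h \<le> e" "h < \<delta>" using e(1) \<delta>(1) by (auto simp: h_def)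
      have near: "p + t *\<^sub>R w \<in> cball q (\<rho> + e)" if "p \<in> cball q \<rho>" "0 \<le> t" "t \<le> h" for p t
      proof -
        have "dist q (p + t *\<^sub>R w) \<le> dist q p + dist p (p + t *\<^sub>R w)" by (rule dist_triangle)
        then show ?thesis using that h w by (simp add: dist_norm)
      qed
      \<comment> \<open>By the mean value theorem the quotient is a value of the derivative on the
        connecting segment, hence within \<eta> of its value at \<open>p\<close>. As a difference of
        two solutions it satisfies the differential inequality with second derivatives only.\<close>
      define z where "z = (\<lambda>p. (1 / h) * (u (p + h *\<^sub>R w) - u p))"
      have close: "\<bar>z p - g p \<bullet> w\<bar> \<le> \<eta>" if p: "p \<in> cball q \<rho>" for p
      proof -
        obtain t where t: "0 < t" "t < h" "u (p + h *\<^sub>R w) - u p = h * (g (p + t *\<^sub>R w) \<bullet> w)"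
          using difference_quotient[OF h(1), of p w] near[OF p] big by blast
        have "dist (g (p + t *\<^sub>R w) \<bullet> w) (g p \<bullet> w) < \<eta>"
          by (rule \<delta>(2)) (use near[OF p, of 0] near[OF p, of t] t h w in \<open>auto simp: dist_norm\<close>)
        then show ?thesis using h(1) t(3) by (simp add: z_def dist_real_def)
      qed
      moreover have "\<exists>L. has_laplacian z p L \<and> L \<le> k * max (z p) 0" if p: "p \<in> ball q \<rho>" for p
      proof -
        have pO: "p \<in> \<Omega>" "p + h *\<^sub>R w \<in> \<Omega>"
          using near[of p h] near[of p 0] p big h by auto
        have "has_laplacian (\<lambda>p. u (p + h *\<^sub>R w)) p (- f (u (p + h *\<^sub>R w)))"
          using lap_rigid[of "mat 1" "h *\<^sub>R w" p] pO orthogonal_matrix_id by (simp add: add.commute)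
        then have "\<exists>L. has_laplacian (\<lambda>p. u (p + h *\<^sub>R w) - u p) p L \<and> L \<le> k * max (u (p + h *\<^sub>R w) - u p) 0"
          using lap[OF pO(1)] k by (intro laplacian_difference) auto
        then obtain L where L: "has_laplacian (\<lambda>p. u (p + h *\<^sub>R w) - u p) p L" "L \<le> k * max (u (p + h *\<^sub>R w) - u p) 0"
          by blast
        show ?thesis
        proof (intro exI conjI)
          show "has_laplacian z p ((1 / h) * L)" unfolding z_def by (rule has_laplacian_cmul[OF L(1)])
          have "(1 / h) * L \<le> (1 / h) * (k * max (u (p + h *\<^sub>R w) - u p) 0)"
            using L(2) h(1) by (intro mult_left_mono) auto
          also have "\<dots> = k * max (z p) 0"
            using h(1) by (simp add: z_def max_def zero_le_divide_iff divide_le_0_iff)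
          finally show "(1 / h) * L \<le> k * max (z p) 0" .
        qed
      qed
      moreover have "continuous_on (cball q \<rho>) z"
        unfolding z_def by (intro continuous_intros continuous_on_compose2[OF cont] continuous_on_subset[OF cont]) auto
      ultimately show ?thesis by blast
    qed
  qed
qed

end

lemma refl_twice: "refl_x *v (refl_x *v p) = p" "refl_y *v (refl_y *v p) = p"
  by (simp_all add: vec2_eq_iff)

section \<open>The ellipse with a concentric hole\<close>

locale elliptic = dirichlet_solution +
  fixes A B r :: real
  assumes r: "0 < r" and rB: "r < B" and BA: "B < A"
    and Om: "\<Omega> = {p. (p $ 1 / A)\<^sup>2 + (p $ 2 / B)\<^sup>2 < 1} - cball 0 r"
begin

text \<open>The square of the Minkowski gauge of the filled ellipse.\<close>

definition E :: "real^2 \<Rightarrow> real" where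
  "E p = (p $ 1 / A)\<^sup>2 + (p $ 2 / B)\<^sup>2"

lemma A_pos: "0 < A" and B_pos: "0 < B" using r rB BA by auto

lemma mem_iff: "p \<in> \<Omega> \<longleftrightarrow> E p < 1 \<and> r < norm p"
  by (auto simp: Om E_def)

lemma cont_E: "continuous_on S E"
  unfolding E_def using A_pos B_pos by (intro continuous_intros) auto

lemma E_scale: "E (c *\<^sub>R p) = c\<^sup>2 * E p"
  by (simp add: E_def power2_eq_square algebra_simps)

lemma E_le_norm: "B\<^sup>2 * E p \<le> (norm p)\<^sup>2"
proof -
  have "(B / A)\<^sup>2 \<le> 1" using BA B_pos by (simp add: power_le_one)
  then have "(B / A)\<^sup>2 * (p $ 1)\<^sup>2 \<le> (p $ 1)\<^sup>2" by (simp add: mult_left_le_one_le)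
  moreover have "B\<^sup>2 * E p = (B / A)\<^sup>2 * (p $ 1)\<^sup>2 + (p $ 2)\<^sup>2"
    unfolding E_def using B_pos by (simp add: distrib_left power_divide)
  ultimately show ?thesis unfolding norm_sq_2 by simp
qed

lemma E_pos: "p \<noteq> 0 \<Longrightarrow> 0 < E p"
  using A_pos B_pos by (auto simp: E_def vec2_eq_iff add_pos_nonneg add_nonneg_pos)

lemma inv_x: "refl_x *v p \<in> \<Omega> \<longleftrightarrow> p \<in> \<Omega>"
proof -
  have "norm (refl_x *v p) = norm p" by (rule power2_eq_imp_eq) (simp_all add: norm_sq_2)
  then show ?thesis by (simp add: mem_iff E_def)
qed

lemma inv_y: "refl_y *v p \<in> \<Omega> \<longleftrightarrow> p \<in> \<Omega>"
proof -
  have "norm (refl_y *v p) = norm p" by (rule power2_eq_imp_eq) (simp_all add: norm_sq_2)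
  then show ?thesis by (simp add: mem_iff E_def)
qed

lemmas sym_x = symmetric[OF orthogonal_refl(1) inv_x]
lemmas sym_y = symmetric[OF orthogonal_refl(2) inv_y]

lemma grad_sym_x: "p \<in> \<Omega> \<Longrightarrow> g (refl_x *v p) = refl_x *v g p"
  using grad_symmetric[OF orthogonal_refl(1) inv_x, of "refl_x *v p"] inv_x[of p]
  by (simp add: refl_twice)

lemma grad_sym_y: "p \<in> \<Omega> \<Longrightarrow> g (refl_y *v p) = refl_y *v g p"
  using grad_symmetric[OF orthogonal_refl(2) inv_y, of "refl_y *v p"] inv_y[of p]
  by (simp add: refl_twice)

lemma sym_neg: "u (- p) = u p"
proof -
  have "- p = refl_x *v (refl_y *v p)" by (simp add: vec2_eq_iff)
  then show ?thesis by (simp add: sym_x sym_y)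
qed

section \<open>Monotonicity in the angle about the centre of the ellipse\<close>

lemma sector_connected:
  assumes "c\<^sup>2 + s\<^sup>2 = 1"
  shows "connected {p \<in> \<Omega>. 0 < p \<bullet> pt c s \<and> 0 < p \<bullet> pt (- s) c}"
proof -
  define C where "C = {p. 0 < p \<bullet> pt c s} \<inter> {p. 0 < p \<bullet> pt (- s) c}"
  define P where "P = {0<..<1::real} \<times> C"
  \<comment> \<open>The distance from the centre to the ellipse in the direction of
    \<open>v\<close>. Every ray of the cone meets \<Omega> in the interval from \<open>r\<close> to
    this value, so the sector is a continuous image of an interval times a convex cone.\<close>
  define \<rho> where "\<rho> = (\<lambda>v. norm v / sqrt (E v))"
  define F where "F = (\<lambda>(t, v). (r + t * (\<rho> v - r)) *\<^sub>R ((1 / norm v) *\<^sub>R v))"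
  have C0: "v \<noteq> 0" if "v \<in> C" for v using that by (auto simp: C_def)
  have \<rho>B: "B \<le> \<rho> v" if "v \<noteq> 0" for v
  proof -
    have "sqrt (B\<^sup>2 * E v) \<le> sqrt ((norm v)\<^sup>2)" using E_le_norm by (intro real_sqrt_le_mono)
    then have "B * sqrt (E v) \<le> norm v" using B_pos by (simp add: real_sqrt_mult)
    then show ?thesis using E_pos[OF that] by (simp add: \<rho>_def field_simps)
  qed
  have F_in: "F (t, v) \<in> {p \<in> \<Omega>. 0 < p \<bullet> pt c s \<and> 0 < p \<bullet> pt (- s) c}" if t: "0 < t" "t < 1" and v: "v \<in> C" for t v
  proof -
    define \<mu> where "\<mu> = r + t * (\<rho> v - r)"
    have rv: "r < \<rho> v" using \<rho>B[OF C0[OF v]] rB by simp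
    have "0 < t * (\<rho> v - r)" "t * (\<rho> v - r) < 1 * (\<rho> v - r)"
      using t rv by (simp, intro mult_strict_right_mono) auto
    then have l: "r < \<mu>" "\<mu> < \<rho> v" "0 < \<mu>" using r by (auto simp: \<mu>_def)
    have nv: "0 < norm v" using C0[OF v] by simp
    have Fe: "F (t, v) = (\<mu> / norm v) *\<^sub>R v" by (simp add: F_def \<mu>_def)
    have "norm (F (t, v)) = \<mu>" using nv l by (simp add: Fe)
    moreover have "E (F (t, v)) = (\<mu> / \<rho> v)\<^sup>2"
      unfolding Fe E_scale using E_pos[OF C0[OF v]] nv by (simp add: \<rho>_def power_divide power_mult_distrib)
    moreover have "(\<mu> / \<rho> v)\<^sup>2 < 1" using l by (simp add: power_less_one_iff)
    ultimately show ?thesis using v l nv by (auto simp: mem_iff Fe C_def)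
  qed
  have "{p \<in> \<Omega>. 0 < p \<bullet> pt c s \<and> 0 < p \<bullet> pt (- s) c} = F ` P"
  proof (intro equalityI subsetI)
    fix p assume p: "p \<in> {p \<in> \<Omega>. 0 < p \<bullet> pt c s \<and> 0 < p \<bullet> pt (- s) c}"
    then have pC: "p \<in> C" by (simp add: C_def)
    have pn: "p \<noteq> 0" "0 < norm p" using C0[OF pC] by auto
    have pr: "r < norm p" "E p < 1" using p by (auto simp: mem_iff)
    have "norm p < \<rho> p"
      using E_pos[OF pn(1)] pr(2) pn by (simp add: \<rho>_def field_simps real_less_lsqrt)
    define t where "t = (norm p - r) / (\<rho> p - r)"
    have t: "0 < t" "t < 1" "t * (\<rho> p - r) = norm p - r"
      using pr \<open>norm p < \<rho> p\<close> by (auto simp: t_def)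
    have "F (t, p) = p" using t(3) pn by (simp add: F_def)
    moreover have "(t, p) \<in> P" using t pC by (simp add: P_def)
    ultimately show "p \<in> F ` P" by (metis image_eqI)
  qed (use F_in in \<open>auto simp: P_def\<close>)
  moreover have "connected (F ` P)"
  proof (rule connected_continuous_image)
    show "continuous_on P F"
      unfolding F_def \<rho>_def case_prod_unfold
    proof (intro continuous_intros continuous_on_compose2[OF cont_E[of UNIV]] ballI)
      fix x assume "x \<in> P"
      then have "snd x \<noteq> 0" using C0 by (auto simp: P_def)
      then show "norm (snd x) \<noteq> 0" "sqrt (E (snd x)) \<noteq> 0" using E_pos[of "snd x"] by auto
    qed auto
    have "convex C" unfolding C_def
      using convex_halfspace_gt[of 0 "pt c s"] convex_halfspace_gt[of 0 "pt (- s) c"]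
      by (intro convex_Int) (simp_all add: inner_commute)
    then show "connected P" unfolding P_def by (intro connected_Times convex_connected) auto
  qed
  ultimately show ?thesis by simp
qed


text \<open>A quarter plane and not a half plane: beyond the direction perpendicular to the mirror,
  reflection increases \<open>E\<close> and may lead out of the ellipse. On that perpendicular the
  reflection is \<open>p\<close> to \<open>- p\<close>, where central symmetry gives equality of the
  values.\<close>

definition sector :: "real \<Rightarrow> real \<Rightarrow> (real^2) set" where
  "sector c s = {p \<in> \<Omega>. 0 < p \<bullet> pt c s \<and> 0 < p \<bullet> pt (- s) c}"

lemma sector_frame:
  assumes "c\<^sup>2 + s\<^sup>2 = 1"
  shows "norm (pt c s) = 1" "norm (pt (- s) c) = 1" "pt c s \<bullet> pt (- s) c = 0"
    "p = (p \<bullet> pt c s) *\<^sub>R pt c s + (p \<bullet> pt (- s) c) *\<^sub>R pt (- s) c"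
proof -
  show "norm (pt c s) = 1" "norm (pt (- s) c) = 1"
    by (rule power2_eq_imp_eq; use assms in \<open>simp add: norm_sq_2 add.commute\<close>)+
  show "pt c s \<bullet> pt (- s) c = 0" by (simp add: inner_vec_def sum_2)
  have "(p \<bullet> pt c s) * c - (p \<bullet> pt (- s) c) * s = (c\<^sup>2 + s\<^sup>2) * p $ 1"
    "(p \<bullet> pt c s) * s + (p \<bullet> pt (- s) c) * c = (c\<^sup>2 + s\<^sup>2) * p $ 2"
    by (simp_all add: inner_vec_def sum_2 power2_eq_square algebra_simps)
  then show "p = (p \<bullet> pt c s) *\<^sub>R pt c s + (p \<bullet> pt (- s) c) *\<^sub>R pt (- s) c"
    using assms by (simp add: vec2_eq_iff)
qed

text \<open>In coordinates along and across the mirror, reflection moves an amount \<open>w\<close>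
  from the square of the second coordinate to that of the first, and the first one has the smaller
  weight in \<open>E\<close>.\<close>

lemma sector_reflect:
  assumes cs: "c\<^sup>2 + s\<^sup>2 = 1" "0 < c" "0 < s"
    and p: "0 \<le> p \<bullet> pt c s" "0 \<le> p \<bullet> pt (- s) c"
  shows "norm (householder (pt (- s) c) *v p) = norm p"
    "E (householder (pt (- s) c) *v p) \<le> E p"
    "0 < p \<bullet> pt c s \<Longrightarrow> 0 < p \<bullet> pt (- s) c \<Longrightarrow> E (householder (pt (- s) c) *v p) < E p"
proof -
  define b where "b = p \<bullet> pt c s"
  define d where "d = p \<bullet> pt (- s) c"
  define q where "q = householder (pt (- s) c) *v p"
  have pe: "p $ 1 = b * c - d * s" "p $ 2 = b * s + d * c"
    using arg_cong[OF sector_frame(4)[OF cs(1), of p], of "\<lambda>v. v $ 1"]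
      arg_cong[OF sector_frame(4)[OF cs(1), of p], of "\<lambda>v. v $ 2"]
    by (simp_all add: b_def d_def)
  have qe: "q $ 1 = b * c + d * s" "q $ 2 = b * s - d * c"
    unfolding q_def householder_mult d_def[symmetric] by (simp_all add: pe)
  have "(norm q)\<^sup>2 = (norm p)\<^sup>2"
    unfolding norm_sq_2 pe qe by (simp add: power2_eq_square algebra_simps)
  then show "norm q = norm p" by (rule power2_eq_imp_eq) simp_all
  define w where "w = 4 * (b * d * (c * s))"
  have "(q $ 1)\<^sup>2 = (p $ 1)\<^sup>2 + w" "(q $ 2)\<^sup>2 = (p $ 2)\<^sup>2 - w"
    unfolding pe qe w_def by (simp_all add: power2_eq_square algebra_simps)
  then have "E q = ((p $ 1)\<^sup>2 + w) / A\<^sup>2 + ((p $ 2)\<^sup>2 - w) / B\<^sup>2"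
    unfolding E_def power_divide by simp
  then have "E q = E p - w * (1 / B\<^sup>2 - 1 / A\<^sup>2)"
    unfolding E_def power_divide by (simp add: diff_divide_distrib add_divide_distrib right_diff_distrib)
  moreover have pos: "0 < 1 / B\<^sup>2 - 1 / A\<^sup>2"
    using BA B_pos power_strict_mono[OF BA, of 2] by (simp add: divide_strict_left_mono)
  moreover have "0 \<le> w" "0 < b \<Longrightarrow> 0 < d \<Longrightarrow> 0 < w"
    using p cs by (auto simp: b_def d_def w_def)
  ultimately show "E q \<le> E p" "0 < b \<Longrightarrow> 0 < d \<Longrightarrow> E q < E p" by (simp_all add: mult_nonneg_nonneg)
qed

lemma sector_open: "open (sector c s)"
proof -
  have "sector c s = \<Omega> \<inter> {p. 0 < pt c s \<bullet> p} \<inter> {p. 0 < pt (- s) c \<bullet> p}"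
    by (auto simp: sector_def inner_commute)
  then show ?thesis using op by (simp add: open_Int open_halfspace_gt)
qed

lemma sector_le:
  assumes cs: "c\<^sup>2 + s\<^sup>2 = 1" "0 < c" "0 < s" and p: "p \<in> sector c s"
  shows "u p \<le> u (householder (pt (- s) c) *v p)"
proof -
  have e: "p - (2 * (p \<bullet> n - 0)) *\<^sub>R n = householder n *v p" for p n
    by (simp add: householder_mult)
  have "u p \<le> u (p - (2 * (p \<bullet> pt (- s) c - 0)) *\<^sub>R pt (- s) c)"
  proof (rule reflection_comparison[OF sector_frame(2)[OF cs(1)] sector_open _ _ _ p])
    show "q - (2 * (q \<bullet> pt (- s) c - 0)) *\<^sub>R pt (- s) c \<in> \<Omega>" if "q \<in> sector c s" for q
      unfolding e using sector_reflect(1,2)[OF cs, of q] that by (auto simp: sector_def mem_iff)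
    show "u q \<le> u (q - (2 * (q \<bullet> pt (- s) c - 0)) *\<^sub>R pt (- s) c)"
      if q: "q \<in> \<Omega>" "q \<in> frontier (sector c s)" for q
    proof -
      have "closure (sector c s) \<subseteq> {p. 0 \<le> pt c s \<bullet> p} \<inter> {p. 0 \<le> pt (- s) c \<bullet> p}"
        by (rule closure_minimal[OF _ closed_Int[OF closed_halfspace_ge closed_halfspace_ge]])
          (auto simp: sector_def inner_commute)
      then have "0 \<le> q \<bullet> pt c s" "0 \<le> q \<bullet> pt (- s) c" using q by (auto simp: frontier_def inner_commute)
      moreover have "q \<notin> sector c s" using q sector_open by (auto simp: frontier_def interior_open)
      ultimately consider "q \<bullet> pt c s = 0" | "q \<bullet> pt (- s) c = 0" using q(1) by (force simp: sector_def)
      then show ?thesis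
      proof cases
        case 1
        then have qe: "q = (q \<bullet> pt (- s) c) *\<^sub>R pt (- s) c" using sector_frame(4)[OF cs(1), of q] by simp
        have "q - (2 * (q \<bullet> pt (- s) c - 0)) *\<^sub>R pt (- s) c = q - 2 *\<^sub>R ((q \<bullet> pt (- s) c) *\<^sub>R pt (- s) c)" by simp
        also have "\<dots> = - q" unfolding qe[symmetric] by (simp add: vec2_eq_iff)
        finally have "u (q - (2 * (q \<bullet> pt (- s) c - 0)) *\<^sub>R pt (- s) c) = u q" by (simp only: sym_neg)
        then show ?thesis by (rule eq_refl[OF sym])
      qed simp
    qed
  qed (simp add: sector_def)
  then show ?thesis unfolding e .
qed

text \<open>By the strong maximum principle equality at one point spreads over the sector, and by
  continuity to the point where its bisector meets the ellipse. There \<open>u\<close> is zero,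
  while the mirror image lies inside \<Omega>, where \<open>u\<close> is positive.\<close>

lemma sector_strict:
  assumes cs: "c\<^sup>2 + s\<^sup>2 = 1" "0 < c" "0 < s" and p: "p \<in> sector c s"
  shows "u p < u (householder (pt (- s) c) *v p)"
proof (rule ccontr)
  define n where "n = pt (- s) c"
  assume "\<not> ?thesis"
  then have eq: "u (householder n *v p) = u p" using sector_le[OF cs p] by (simp add: n_def)
  have n: "norm n = 1" using sector_frame(2)[OF cs(1)] by (simp add: n_def)
  have con: "connected (sector c s)" using sector_connected[OF cs(1)] by (simp add: sector_def)
  have all: "u (householder n *v q) = u q" if "q \<in> sector c s" for q
  proof (rule reflection_strict[OF orthogonal_householder[OF n] sector_open con _ _ _ p eq that])
    show "householder n *v q \<in> \<Omega>" if "q \<in> sector c s" for q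
      using sector_reflect(1,2)[OF cs, of q] that by (auto simp: sector_def mem_iff n_def)
    show "u q \<le> u (householder n *v q)" if "q \<in> sector c s" for q
      using sector_le[OF cs that] by (simp add: n_def)
  qed (simp add: sector_def)
  define v where "v = pt c s + n"
  have fr: "pt c s \<bullet> pt c s = 1" "n \<bullet> n = 1" "pt c s \<bullet> n = 0" "n \<bullet> pt c s = 0"
    using sector_frame(1-3)[OF cs(1)] by (simp_all add: n_def dot_square_norm inner_commute)
  have ve: "v \<bullet> pt c s = 1" "v \<bullet> n = 1" by (simp_all add: v_def inner_add_left fr)
  then have v0: "v \<noteq> 0" by auto
  define q where "q = (1 / sqrt (E v)) *\<^sub>R v"
  have Eq: "E q = 1" unfolding q_def E_scale using E_pos[OF v0] by (simp add: power_divide)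
  have qe: "0 < q \<bullet> pt c s" "0 < q \<bullet> n" using ve E_pos[OF v0] by (simp_all add: q_def)
  have "B\<^sup>2 \<le> (norm q)\<^sup>2" using E_le_norm[of q] Eq by simp
  then have "B \<le> norm q" by (rule power2_le_imp_le) simp
  then have qr: "r < norm q" using rB by simp
  have "householder n *v q \<in> \<Omega>"
    using sector_reflect(1,3)[OF cs, of q] qe qr Eq by (simp add: mem_iff n_def)
  then have "0 < u (householder n *v q)" by (rule u_pos)
  moreover have "u q = 0" using Eq zero[of q] by (simp add: mem_iff)
  moreover have "u (householder n *v q) = u q"
  proof -
    define \<gamma> where "\<gamma> = (\<lambda>t. u (householder n *v (t *\<^sub>R q)) - u (t *\<^sub>R q))"
    have c\<gamma>: "isCont \<gamma> 1"
    proof -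
      have "continuous_on UNIV \<gamma>"
        unfolding \<gamma>_def matrix_vector_mult_scaleR by (intro continuous_intros continuous_on_compose2[OF cont]) auto
      then show ?thesis by (simp add: continuous_on_eq_continuous_at)
    qed
    have "(\<gamma> \<longlongrightarrow> \<gamma> 1) (at_left 1)" using c\<gamma> by (simp add: isCont_def filterlim_at_split)
    moreover have "\<forall>\<^sub>F t in at_left 1. \<gamma> t = 0"
    proof -
      have "\<forall>\<^sub>F t in at_left 1. max 0 (r / norm q) < t \<and> t < (1::real)"
        using qr r by (intro eventually_conj eventually_at_left_real[THEN eventually_mono])
          (auto simp: eventually_at_filter divide_less_eq_1)
      then show ?thesis
      proof eventually_elim
        case (elim t)
        have "0 < norm q" using qr r by linarith
        then have t: "0 < t" "t < 1" "r < t * norm q" using elim by (simp_all add: pos_divide_less_eq)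
        have "t *\<^sub>R q \<in> sector c s"
          using t qe Eq by (simp add: sector_def mem_iff E_scale n_def power_less_one_iff)
        then show ?case using all by (simp add: \<gamma>_def)
      qed
    qed
    then have "(\<gamma> \<longlongrightarrow> 0) (at_left 1)" by (rule tendsto_eventually)
    ultimately have "\<gamma> 1 = 0" by (intro tendsto_unique) auto
    then show ?thesis by (simp add: \<gamma>_def)
  qed
  ultimately show False by simp
qed

text \<open>Hopf's lemma at a point of the mirror, which is interior to \<Omega>: the reflected
  difference is positive in a disc touching the mirror there, and the barrier forces it to grow at
  least linearly away from the mirror. Its derivative is \<open>- 2\<close> times the normal
  derivative of \<open>u\<close>.\<close>

lemma grad_ray:
  assumes cs: "c\<^sup>2 + s\<^sup>2 = 1" "0 < c" "0 < s" and b: "0 < b" "b *\<^sub>R pt c s \<in> \<Omega>"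
  shows "g (b *\<^sub>R pt c s) \<bullet> pt (- s) c < 0"
proof -
  define e where "e = pt c s"
  define n where "n = pt (- s) c"
  define p where "p = b *\<^sub>R e"
  have p: "p \<in> \<Omega>" using b by (simp add: p_def e_def)
  have fr: "e \<bullet> e = 1" "n \<bullet> n = 1" "e \<bullet> n = 0" "n \<bullet> e = 0" "norm n = 1" "norm e = 1"
    using sector_frame(1-3)[OF cs(1)] by (simp_all add: e_def n_def dot_square_norm inner_commute)
  obtain k where k: "k \<ge> 0" "\<And>p q. u q \<le> u p \<Longrightarrow> f (u q) - f (u p) \<le> k * (u p - u q)"
    using lip_const by blast
  obtain \<delta> where \<delta>: "\<delta> > 0" "ball p \<delta> \<subseteq> \<Omega>" using op p by (meson openE)
  \<comment> \<open>The disc of radius \<rho> about \<open>q\<close> touches the mirror at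
    \<open>p\<close>. Its points are within \<open>2 * \<rho>\<close> of \<open>p\<close>, hence in
    \<Omega> and on the positive side of the perpendicular through the centre.\<close>
  define \<rho> where "\<rho> = min \<delta> b / 3"
  have \<rho>: "0 < \<rho>" "2 * \<rho> < \<delta>" "2 * \<rho> < b" using \<delta>(1) b(1) by (auto simp: \<rho>_def min_def)
  define q where "q = p + \<rho> *\<^sub>R n"
  define z where "z = (\<lambda>x. u (householder n *v x) - u x)"
  have cz: "continuous_on S z" for S
    unfolding z_def
    by (intro continuous_on_diff continuous_on_compose2[OF cont] continuous_on_subset[OF cont])
      (auto intro!: continuous_intros)
  have inU: "x \<in> \<Omega>" "0 < x \<bullet> e" "0 \<le> x \<bullet> n" "dist q x < \<rho> \<Longrightarrow> 0 < x \<bullet> n" if x: "dist q x \<le> \<rho>" for x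
  proof -
    have "dist p q = \<rho>" using \<rho> fr by (simp add: q_def dist_norm)
    then have px: "dist p x \<le> 2 * \<rho>" using x dist_triangle[of p x q] by simp
    then show "x \<in> \<Omega>" using \<delta>(2) \<rho> by auto
    have "(p - x) \<bullet> e \<le> dist p x" using norm_cauchy_schwarz[of "p - x" e] fr by (simp add: dist_norm)
    then show "0 < x \<bullet> e" using px \<rho> fr by (simp add: p_def inner_diff_left)
    have "(q - x) \<bullet> n \<le> dist q x" using norm_cauchy_schwarz[of "q - x" n] fr by (simp add: dist_norm)
    then show "0 \<le> x \<bullet> n" "dist q x < \<rho> \<Longrightarrow> 0 < x \<bullet> n"
      using x fr by (auto simp: q_def p_def inner_diff_left inner_add_left)
  qed
  have z_pos: "0 < z x" if "dist q x < \<rho>" for x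
    using sector_strict[OF cs, of x] inU[of x] that by (simp add: z_def n_def e_def sector_def)
  have z_nn: "0 \<le> z x" if "dist q x \<le> \<rho>" for x
  proof (cases "x \<bullet> n = 0")
    case True then show ?thesis by (simp add: z_def householder_mult)
  next
    case False
    then show ?thesis
      using sector_strict[OF cs, of x] inU[of x] that by (simp add: z_def n_def e_def sector_def)
  qed
  have cb: "compact (cball q (\<rho> / 2))" "cball q (\<rho> / 2) \<noteq> {}" using \<rho> by auto
  then obtain x0 where x0: "x0 \<in> cball q (\<rho> / 2)" "\<And>x. x \<in> cball q (\<rho> / 2) \<Longrightarrow> z x0 \<le> z x"
    using continuous_attains_inf[OF cb cz] by blast
  have cpos: "0 < z x0" using z_pos[of x0] x0(1) \<rho> by simp
  have e2: "0 < \<rho> / 2" "\<rho> / 2 < \<rho>" using \<rho> by auto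
  define m where "m = barrier_const (\<rho> / 2) \<rho> k"
  have m: "m > 0" unfolding m_def using \<rho> k by (intro barrier_const_pos) auto
  have low: "z x0 * m * (\<rho> - dist q x) - 0 \<le> z x" if "\<rho> / 2 \<le> dist q x" "dist q x \<le> \<rho>" for x
    unfolding m_def
  proof (rule barrier[OF e2 k(1) cpos _ cz _ _ _ that])
    show "\<exists>L. has_laplacian z y L \<and> L \<le> k * max (z y) 0" if y: "y \<in> ball q \<rho>" for y
    proof -
      have yO: "y \<in> \<Omega>" "0 < y \<bullet> e" "0 < y \<bullet> n" using inU[of y] y by auto
      have "householder n *v y \<in> \<Omega>"
        using sector_reflect(1,2)[OF cs, of y] yO by (simp add: mem_iff n_def e_def)
      then show ?thesis unfolding z_def
        using lap_rigid[OF orthogonal_householder[OF fr(5)], of 0 y] lap[OF yO(1)] k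
        by (intro laplacian_difference) auto
    qed
  qed (use z_nn x0(2) in auto)
  have d3: "((\<lambda>t. z x0 * m * t) has_real_derivative z x0 * m * 1) (at 0)"
    by (intro DERIV_cmult DERIV_ident)
  have "0 \<le> - 2 * (g p \<bullet> n) - z x0 * m * 1"
  proof (rule nonneg_derivative_at_right[OF DERIV_diff[OF deriv_reflected_difference[OF p] d3] e2(1)])
    fix t :: real assume t: "0 < t" "t < \<rho> / 2"
    have "q - (p + t *\<^sub>R n) = (\<rho> - t) *\<^sub>R n" by (simp add: q_def algebra_simps)
    then have dq: "dist q (p + t *\<^sub>R n) = \<rho> - t" using fr t \<rho> by (simp add: dist_norm)
    have "householder n *v (p + t *\<^sub>R n) = p + (- t) *\<^sub>R n"
      unfolding householder_mult using fr by (simp add: p_def inner_add_left vec2_eq_iff)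
    then have "z (p + t *\<^sub>R n) = u (p + (- t) *\<^sub>R n) - u (p + t *\<^sub>R n)" by (simp add: z_def)
    then show "u (p + (- 0) *\<^sub>R n) - u (p + 0 *\<^sub>R n) - z x0 * m * 0
        \<le> u (p + (- t) *\<^sub>R n) - u (p + t *\<^sub>R n) - z x0 * m * t"
      using low[of "p + t *\<^sub>R n"] t dq by simp
  qed
  moreover have "0 < z x0 * m" using cpos m by simp
  ultimately show ?thesis by (simp add: p_def e_def n_def)
qed

lemma quadrant_grad:
  assumes "p \<in> \<Omega>" "0 < p $ 1" "0 < p $ 2"
  shows "p $ 1 * g p $ 2 - p $ 2 * g p $ 1 < 0"
proof -
  have np: "0 < norm p" using assms by auto
  define c where "c = p $ 1 / norm p"
  define s where "s = p $ 2 / norm p"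
  have cs: "c\<^sup>2 + s\<^sup>2 = 1" "0 < c" "0 < s"
    using assms np norm_sq_2[of p] by (simp_all add: c_def s_def power_divide add_divide_distrib[symmetric])
  have pe: "p = norm p *\<^sub>R pt c s" using np by (simp add: vec2_eq_iff c_def s_def)
  have "g p \<bullet> pt (- s) c < 0" using grad_ray[OF cs np] assms(1) unfolding pe[symmetric] by blast
  moreover have "g p \<bullet> pt (- s) c = (p $ 1 * g p $ 2 - p $ 2 * g p $ 1) / norm p"
    by (simp add: c_def s_def inner_vec_def sum_2 diff_divide_distrib mult.commute)
  ultimately show ?thesis using np by (simp add: divide_less_0_iff)
qed

lemma critical_on_axes:
  assumes p: "p \<in> \<Omega>" "g p = 0"
  shows "p $ 1 = 0 \<or> p $ 2 = 0"
proof (rule ccontr)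
  assume n: "\<not> ?thesis"
  define q where "q = (if p $ 1 < 0 then refl_y *v p else p)"
  have q: "q \<in> \<Omega>" "g q = 0" "0 < q $ 1" "q $ 2 \<noteq> 0"
    using p n inv_y[of p] grad_sym_y[of p] by (auto simp: q_def)
  define w where "w = (if q $ 2 < 0 then refl_x *v q else q)"
  have "w \<in> \<Omega>" "g w = 0" "0 < w $ 1" "0 < w $ 2"
    using q inv_x[of q] grad_sym_x[of q] by (auto simp: w_def)
  then show False using quadrant_grad[of w] by simp
qed

end

section \<open>Vertical mirrors in the ellipse\<close>

definition swap_xy :: "real^2^2" where
  "swap_xy = vector [vector [0, 1], vector [1, 0]]"

lemma swap_xy_nth [simp]: "(swap_xy *v p) $ 1 = p $ 2" "(swap_xy *v p) $ 2 = p $ 1"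
  by (simp_all add: swap_xy_def matrix_vector_mult_def sum_2)

lemma swap_xy_orthogonal: "orthogonal_matrix swap_xy" "transpose swap_xy = swap_xy"
proof -
  show t: "transpose swap_xy = swap_xy" by (simp add: swap_xy_def transpose_def vec_eq_iff forall_2)
  show "orthogonal_matrix swap_xy"
    unfolding orthogonal_matrix t
    by (simp add: swap_xy_def matrix_matrix_mult_def mat_def vec_eq_iff forall_2 sum_2)
qed

context elliptic
begin

lemma E_convex: "convex {p. E p < 1}"
proof -
  define S :: "real^2^2" where "S = vector [vector [1 / A, 0], vector [0, 1 / B]]"
  have "(norm (S *v p))\<^sup>2 = E p" for p
    unfolding norm_sq_2 E_def by (simp add: S_def matrix_vector_mult_def sum_2)
  then have "{p. E p < 1} = (\<lambda>p. S *v p) -` ball 0 1"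
    using norm_less_2[of 1] norm_sq_2 by (metis (no_types, lifting) Collect_cong mem_ball_0 vimage_def
        one_power2 zero_less_one)
  then show ?thesis by (simp add: convex_linear_vimage matrix_vector_mul_linear)
qed

text \<open>A negative value between two positive ones, at heights \<open>y'\<close> and, by
  symmetry, \<open>- y'\<close>, is an alternation of signs that the crossing lemma forbids. As
  \<open>l\<close> is nonnegative, the parts of ellipse and hole to the right of the mirror reflect
  inwards.\<close>

lemma vertical_sign:
  assumes l: "0 \<le> l" and y: "\<bar>y\<bar> < y'" and p': "pt l y' \<in> \<Omega>" "0 < g (pt l y') $ 1" and p: "pt l y \<in> \<Omega>"
  shows "0 \<le> g (pt l y) $ 1"
proof (rule ccontr)
  assume neg: "\<not> ?thesis"
  define D where "D = {p. E (pt l 0 + swap_xy *v p) < 1}"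
  define K where "K = {p. norm (pt l 0 + swap_xy *v p) \<le> r}"
  have ET: "E (pt l 0 + swap_xy *v p) = (l + p $ 2)\<^sup>2 / A\<^sup>2 + (p $ 1)\<^sup>2 / B\<^sup>2" for p
    by (simp add: E_def power_divide)
  have nT: "p \<in> K \<longleftrightarrow> (l + p $ 2)\<^sup>2 + (p $ 1)\<^sup>2 \<le> r\<^sup>2" for p
    unfolding K_def using r norm_le_2[of r "pt l 0 + swap_xy *v p"] by simp
  \<comment> \<open>Swapping the coordinates turns the vertical line into the horizontal mirror of
    \<open>half_plane_reflection\<close>.\<close>
  interpret t: dirichlet_solution f "{p. pt l 0 + swap_xy *v p \<in> \<Omega>}" "\<lambda>p. u (pt l 0 + swap_xy *v p)"
    "\<lambda>p. transpose swap_xy *v g (pt l 0 + swap_xy *v p)"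
    "\<lambda>p. transpose swap_xy ** H (pt l 0 + swap_xy *v p) ** swap_xy"
    by (rule transform[OF swap_xy_orthogonal(1)])
  interpret t: half_plane_reflection f "{p. pt l 0 + swap_xy *v p \<in> \<Omega>}" "\<lambda>p. u (pt l 0 + swap_xy *v p)"
    "\<lambda>p. transpose swap_xy *v g (pt l 0 + swap_xy *v p)"
    "\<lambda>p. transpose swap_xy ** H (pt l 0 + swap_xy *v p) ** swap_xy" D K
  proof
    show "{p. pt l 0 + swap_xy *v p \<in> \<Omega>} = D - K"
      by (auto simp: D_def K_def mem_iff)
    have conv: "convex {p. pt l 0 + swap_xy *v p \<in> S}" if "convex S" for S
    proof -
      have "convex ((\<lambda>p. swap_xy *v p) -` ((+) (- pt l 0) ` S))"
        by (intro convex_linear_vimage convex_translation that matrix_vector_mul_linear)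
      moreover have "(\<lambda>p. swap_xy *v p) -` ((+) (- pt l 0) ` S) = {p. pt l 0 + swap_xy *v p \<in> S}"
        by force
      ultimately show ?thesis by simp
    qed
    show "convex D" using conv[OF E_convex] by (simp add: D_def)
    show "convex K" using conv[OF convex_cball[of 0 r]] by (simp add: K_def)
    show "q + \<sigma> *\<^sub>R axis 2 1 \<notin> D" if q: "q \<notin> D" "0 \<le> q $ 2" "0 \<le> \<sigma>" for q \<sigma>
    proof -
      have "(l + q $ 2)\<^sup>2 \<le> (l + (q $ 2 + \<sigma>))\<^sup>2" using l q by (intro power_mono) auto
      then have "(l + q $ 2)\<^sup>2 / A\<^sup>2 \<le> (l + (q $ 2 + \<sigma>))\<^sup>2 / A\<^sup>2" by (rule divide_right_mono) simp
      then show ?thesis using q(1) unfolding D_def mem_Collect_eq ET by (simp add: axis_def)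
    qed
    have sq: "(l - q $ 2)\<^sup>2 \<le> (l + q $ 2)\<^sup>2" if "0 \<le> q $ 2" for q :: "real^2"
      using mult_nonneg_nonneg[OF l that] by (simp add: power2_eq_square algebra_simps)
    show "refl_x *v q \<in> D" if q: "q \<in> D" "0 \<le> q $ 2" for q
    proof -
      have "(l - q $ 2)\<^sup>2 / A\<^sup>2 \<le> (l + q $ 2)\<^sup>2 / A\<^sup>2" using sq[OF q(2)] by (rule divide_right_mono) simp
      then show ?thesis using q(1) unfolding D_def mem_Collect_eq ET by simp
    qed
    show "refl_x *v q \<in> K" if q: "q \<in> K" "0 \<le> q $ 2" for q
      using q(1) sq[OF q(2)] unfolding nT by simp
  qed
  have line: "pt l 0 + swap_xy *v pt x 0 = pt l x" for x by (simp add: vec2_eq_iff)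
  have G: "(transpose swap_xy *v g (pt l 0 + swap_xy *v pt x 0)) $ 2 = g (pt l x) $ 1" for x
    unfolding line by (simp add: swap_xy_orthogonal)
  have r1: "refl_x *v pt l y' = pt l (- y')" by (simp add: vec2_eq_iff)
  have pm: "pt l (- y') \<in> \<Omega>" "g (pt l (- y')) $ 1 = g (pt l y') $ 1"
    using inv_x[of "pt l y'"] grad_sym_x[OF p'(1)] p'(1) unfolding r1 by simp_all
  have memO: "pt x 0 \<in> {p. pt l 0 + swap_xy *v p \<in> \<Omega>} \<longleftrightarrow> pt l x \<in> \<Omega>" for x
    by (simp only: mem_Collect_eq line)
  have y'D: "pt y' 0 \<in> D" unfolding D_def mem_Collect_eq line using p'(1) by (simp add: mem_iff)
  have "- y' < y" "y < y'" using y by auto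
  moreover have "0 < g (pt l (- y')) $ 1" "g (pt l y) $ 1 < 0" using pm p'(2) neg by simp_all
  ultimately show False
    using t.crossing[of "- y'" y y', unfolded memO G] pm(1) p p'(2) y'D by blast
qed

lemma E_on_vertical: "\<bar>y\<bar> \<le> \<bar>y'\<bar> \<Longrightarrow> E (pt x y) \<le> E (pt x y')"
proof -
  assume "\<bar>y\<bar> \<le> \<bar>y'\<bar>"
  then have "y\<^sup>2 \<le> y'\<^sup>2" by (simp add: abs_le_square_iff)
  then show ?thesis using B_pos by (simp add: E_def power_divide divide_right_mono)
qed

lemma norm_ge_fst: "p $ 1 \<le> norm (p::real^2)"
  using component_le_norm_cart[of p 1] by linarith

text \<open>A positive derivative at height \<open>b\<close> persists on nearby vertical lines, and
  \<open>vertical_sign\<close> spreads it, as a weak inequality, over a rectangle about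
  \<open>pt x 0\<close>. The derivative vanishes at the centre of the rectangle, hence on all of it,
  and by continuity also at height \<open>b\<close>.\<close>

lemma critical_vertical_nonpos:
  assumes x: "r < x" and g0: "g (pt x 0) $ 1 = 0" and p: "pt x y \<in> \<Omega>"
  shows "g (pt x y) $ 1 \<le> 0"
proof (rule ccontr)
  assume "\<not> ?thesis"
  then have gy: "0 < g (pt x y) $ 1" by simp
  define b where "b = \<bar>y\<bar>"
  have b: "pt x b \<in> \<Omega>" "0 < g (pt x b) $ 1"
  proof -
    have r1: "refl_x *v pt x y = pt x (- y)" by (simp add: vec2_eq_iff)
    have "pt x (- y) \<in> \<Omega>" "g (pt x (- y)) $ 1 = g (pt x y) $ 1"
      using inv_x[of "pt x y"] grad_sym_x[OF p] p unfolding r1 by simp_all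
    then show "pt x b \<in> \<Omega>" "0 < g (pt x b) $ 1" using p gy by (auto simp: b_def abs_if)
  qed
  have b0: "0 < b" using gy g0 by (auto simp: b_def)
  have "isCont (\<lambda>t. pt x b + t *\<^sub>R axis 1 1) 0" by (intro continuous_intros)
  then have tt: "((\<lambda>t. pt x b + t *\<^sub>R axis 1 1) \<longlongrightarrow> pt x b) (at 0)" by (simp add: isCont_def)
  have "((\<lambda>t. g (pt x b + t *\<^sub>R axis 1 1) $ 1) \<longlongrightarrow> g (pt x b) $ 1) (at 0)"
    using isCont_tendsto_compose[OF isCont_g[OF b(1)] tt] by (intro tendsto_intros)
  then have "\<forall>\<^sub>F t in at 0. 0 < g (pt x b + t *\<^sub>R axis 1 1) $ 1" using b(2) by (rule order_tendstoD)
  moreover have "\<forall>\<^sub>F t in at 0. pt x b + t *\<^sub>R axis 1 1 \<in> \<Omega>"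
    using topological_tendstoD[OF tt op b(1)] .
  ultimately have "\<forall>\<^sub>F t in at 0. 0 < g (pt x b + t *\<^sub>R axis 1 1) $ 1 \<and> pt x b + t *\<^sub>R axis 1 1 \<in> \<Omega>"
    by (rule eventually_conj)
  then obtain d where d: "d > 0" "\<And>t. t \<noteq> 0 \<Longrightarrow> dist t 0 < d \<Longrightarrow>
      0 < g (pt x b + t *\<^sub>R axis 1 1) $ 1 \<and> pt x b + t *\<^sub>R axis 1 1 \<in> \<Omega>"
    unfolding eventually_at by blast
  have db: "0 < g (pt z b) $ 1 \<and> pt z b \<in> \<Omega>" if "\<bar>z - x\<bar> < d" for z
  proof (cases "z = x")
    case False
    have "pt x b + (z - x) *\<^sub>R axis 1 1 = pt z b" by (simp add: vec2_eq_iff axis_def)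
    then show ?thesis using d(2)[of "z - x"] False that by simp
  qed (use b in simp)
  \<comment> \<open>The entry \<open>x - r\<close> keeps the rectangle to the right of the hole. The
    heights up to \<open>b\<close> stay in the ellipse because the points at height \<open>b\<close>
    do.\<close>
  define e where "e = min d (x - r)"
  have e: "0 < e" "e \<le> d" "e \<le> x - r" using d(1) x by (auto simp: e_def)
  define W where "W = {p. x - e < axis 1 1 \<bullet> p} \<inter> {p. axis 1 1 \<bullet> p < x + e} \<inter>
    ({p. - b < axis 2 1 \<bullet> p} \<inter> {p::real^2. axis 2 1 \<bullet> p < b})"
  have memW: "p \<in> W \<longleftrightarrow> \<bar>p $ 1 - x\<bar> < e \<and> \<bar>p $ 2\<bar> < b" for p
    by (auto simp: W_def inner_axis' abs_less_iff)
  have W: "open W" "connected W"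
    unfolding W_def
    by (intro open_Int open_halfspace_gt open_halfspace_lt)
      (intro convex_connected convex_Int convex_halfspace_gt convex_halfspace_lt)
  have peta: "pt (p $ 1) (p $ 2) = p" for p :: "real^2" by (simp add: vec2_eq_iff)
  have WO: "W \<subseteq> \<Omega>"
  proof
    fix p assume p: "p \<in> W"
    then have 1: "\<bar>p $ 1 - x\<bar> < d" "\<bar>p $ 2\<bar> < b" "r < p $ 1" using e by (auto simp: memW)
    have "E (pt (p $ 1) (p $ 2)) \<le> E (pt (p $ 1) b)" using 1 b0 by (intro E_on_vertical) auto
    also have "\<dots> < 1" using db[OF 1(1)] by (simp add: mem_iff)
    finally have "E p < 1" by (simp only: peta)
    then show "p \<in> \<Omega>" using 1(3) norm_ge_fst[of p] by (simp add: mem_iff)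
  qed
  have g1: "g p \<bullet> axis 1 1 = g p $ 1" for p by (simp add: inner_axis)
  have zero: "g p $ 1 = 0" if "p \<in> W" for p
  proof -
    have "g p \<bullet> axis 1 1 = 0"
    proof (rule strong_max_principle_derivative[OF _ W WO, of "axis 1 1" "pt x 0"])
      fix p assume pW: "p \<in> W"
      have "0 \<le> g (pt (p $ 1) (p $ 2)) $ 1"
        by (rule vertical_sign[where y' = b])
          (use pW db[of "p $ 1"] e r WO peta in \<open>auto simp: memW\<close>)
      then show "0 \<le> g p \<bullet> axis 1 1" by (simp only: g1 peta)
    qed (use g0 e b0 that in \<open>auto simp: memW g1\<close>)
    then show ?thesis by (simp add: g1)
  qed
  \<comment> \<open>\<open>pt x b\<close> lies on the edge of the rectangle and is approached from
    inside along the vertical segment.\<close>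
  have c: "isCont (\<lambda>t. t *\<^sub>R pt 0 b + pt x 0) 1" by (intro continuous_intros)
  have s1: "1 *\<^sub>R pt 0 b + pt x 0 = pt x b" by (simp add: vec2_eq_iff)
  have "((\<lambda>t. t *\<^sub>R pt 0 b + pt x 0) \<longlongrightarrow> pt x b) (at_left 1)"
    using c unfolding isCont_def s1 by (simp add: filterlim_at_split)
  then have "((\<lambda>t. g (t *\<^sub>R pt 0 b + pt x 0) $ 1) \<longlongrightarrow> g (pt x b) $ 1) (at_left 1)"
    using isCont_tendsto_compose[OF isCont_g[OF b(1)]] by (intro tendsto_intros)
  moreover have "\<forall>\<^sub>F t in at_left 1. g (t *\<^sub>R pt 0 b + pt x 0) $ 1 = 0"
  proof -
    have "\<forall>\<^sub>F t in at_left 1. t \<in> {0<..<1::real}" by (rule eventually_at_left_real) simp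
    then show ?thesis
    proof eventually_elim
      case (elim t)
      then have "t * b < 1 * b" "0 < t * b" using b0 by (auto intro!: mult_strict_right_mono)
      then have "t *\<^sub>R pt 0 b + pt x 0 \<in> W" using e by (simp add: memW)
      then show ?case by (rule zero)
    qed
  qed
  then have "((\<lambda>t. g (t *\<^sub>R pt 0 b + pt x 0) $ 1) \<longlongrightarrow> 0) (at_left 1)" by (rule tendsto_eventually)
  ultimately have "g (pt x b) $ 1 = 0" using tendsto_unique by (metis trivial_limit_at_left_real)
  then show False using b(2) by simp
qed


section \<open>Horizontal difference quotients up to the outer ellipse\<close>

lemma norm_le_E: "(norm p)\<^sup>2 \<le> A\<^sup>2 * E p"
proof -
  have "1 \<le> (A / B)\<^sup>2" using BA B_pos by (intro one_le_power) simp
  then have "1 * (p $ 2)\<^sup>2 \<le> (A / B)\<^sup>2 * (p $ 2)\<^sup>2" by (intro mult_right_mono) auto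
  moreover have "A\<^sup>2 * E p = (p $ 1)\<^sup>2 + (A / B)\<^sup>2 * (p $ 2)\<^sup>2"
    unfolding E_def using A_pos by (simp add: distrib_left power_divide)
  ultimately show ?thesis unfolding norm_sq_2 by simp
qed

lemma norm_le_A: "E p \<le> 1 \<Longrightarrow> norm p \<le> A"
proof -
  assume "E p \<le> 1"
  then have "A\<^sup>2 * E p \<le> A\<^sup>2 * 1" by (intro mult_left_mono) auto
  then have "(norm p)\<^sup>2 \<le> A\<^sup>2" using norm_le_E[of p] by simp
  then show ?thesis by (rule power2_le_imp_le) (use A_pos in simp)
qed

lemma fst_le_A: "E p \<le> 1 \<Longrightarrow> \<bar>p $ 1\<bar> \<le> A"
  using norm_le_A[of p] component_le_norm_cart[of p 1] by linarith

lemma E_shift: "E (p + t *\<^sub>R axis 1 1) = E p + (2 * p $ 1 * t + t\<^sup>2) / A\<^sup>2"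
proof -
  have "(p $ 1 + t)\<^sup>2 = (p $ 1)\<^sup>2 + (2 * p $ 1 * t + t\<^sup>2)" by (simp add: power2_eq_square algebra_simps)
  then have "((p $ 1 + t) / A)\<^sup>2 = (p $ 1 / A)\<^sup>2 + (2 * p $ 1 * t + t\<^sup>2) / A\<^sup>2"
    unfolding power_divide by (simp add: add_divide_distrib)
  then show ?thesis by (simp add: E_def axis_def)
qed

lemma E_shift_ge: "0 \<le> t \<Longrightarrow> - t / 2 \<le> p $ 1 \<Longrightarrow> E p \<le> E (p + t *\<^sub>R axis 1 1)"
proof -
  assume t: "0 \<le> t" "- t / 2 \<le> p $ 1"
  then have "0 \<le> t * (2 * p $ 1 + t)" by (intro mult_nonneg_nonneg) auto
  then have "0 \<le> 2 * p $ 1 * t + t\<^sup>2" by (simp add: power2_eq_square algebra_simps)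
  then show ?thesis unfolding E_shift by simp
qed

lemma E_shift_close:
  assumes p: "E p \<le> 1" and t: "0 \<le> t" "t \<le> \<kappa> * A / 8" and k: "0 < \<kappa>" "\<kappa> \<le> 1"
  shows "\<bar>E (p + t *\<^sub>R axis 1 1) - E p\<bar> \<le> \<kappa> / 2"
proof -
  have "\<bar>2 * p $ 1 * t + t\<^sup>2\<bar> \<le> 2 * (\<bar>p $ 1\<bar> * t) + t * t"
    using t abs_triangle_ineq[of "2 * p $ 1 * t" "t\<^sup>2"] by (simp add: abs_mult power2_eq_square)
  also have "\<dots> \<le> 2 * (A * (\<kappa> * A / 8)) + (\<kappa> * A / 8) * (\<kappa> * A / 8)"
    using fst_le_A[OF p] t k A_pos by (intro add_mono mult_left_mono mult_mono) auto
  also have "\<dots> = A\<^sup>2 * (\<kappa> / 4 + \<kappa> * \<kappa> / 64)" by (simp add: power2_eq_square algebra_simps)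
  also have "\<dots> \<le> A\<^sup>2 * (\<kappa> / 2)"
  proof (rule mult_left_mono)
    have "\<kappa> * \<kappa> \<le> \<kappa>" using mult_left_mono[OF k(2), of \<kappa>] k by simp
    then show "\<kappa> / 4 + \<kappa> * \<kappa> / 64 \<le> \<kappa> / 2" using k by linarith
  qed simp
  finally have "\<bar>2 * p $ 1 * t + t\<^sup>2\<bar> / A\<^sup>2 \<le> \<kappa> / 2" using A_pos by (simp add: pos_divide_le_eq mult.commute)
  then show ?thesis unfolding E_shift by simp
qed

text \<open>Where the shift increases \<open>u\<close>, the shifted value is positive, so the
  shifted point lies in \<Omega> by itself; the difference is then subharmonic because
  \<open>f\<close> decreases.\<close>

lemma lap_shift:
  assumes "p \<in> \<Omega>" "u p < u (p + h *\<^sub>R axis 1 1)"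
  shows "\<exists>L\<ge>0. has_laplacian (\<lambda>p. u (p + h *\<^sub>R axis 1 1) - u p) p L"
proof -
  have "p + h *\<^sub>R axis 1 1 \<in> \<Omega>" using assms u_nonneg[of p] u_pos_iff by force
  then have "has_laplacian (\<lambda>p. u (p + h *\<^sub>R axis 1 1)) p (- f (u (p + h *\<^sub>R axis 1 1)))"
    using lap_rigid[of "mat 1" "h *\<^sub>R axis 1 1" p] orthogonal_matrix_id by (simp add: add.commute)
  then have "has_laplacian (\<lambda>p. u (p + h *\<^sub>R axis 1 1) - u p) p (- f (u (p + h *\<^sub>R axis 1 1)) - - f (u p))"
    using lap[OF assms(1)] by (rule has_laplacian_diff)
  moreover have "0 \<le> - f (u (p + h *\<^sub>R axis 1 1)) - - f (u p)" using f_anti assms(2) by (simp add: less_imp_le)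
  ultimately show ?thesis by blast
qed

lemma cont_shift: "continuous_on S (\<lambda>p. u (p + h *\<^sub>R axis 1 1) - u p)"
  by (intro continuous_intros continuous_on_compose2[OF cont] continuous_on_subset[OF cont]) auto

lemma has_laplacian_E: "has_laplacian E p (2 / A\<^sup>2 + 2 / B\<^sup>2)"
proof -
  have "E = (\<lambda>p. 1 / A\<^sup>2 * (p $ 1)\<^sup>2 + 1 / B\<^sup>2 * (p $ 2)\<^sup>2)"
    by (rule ext) (simp add: E_def power_divide)
  then show ?thesis using has_laplacian_quadratic[of "1 / A\<^sup>2" "1 / B\<^sup>2" p] by simp
qed

lemma E_gt_mem: "r\<^sup>2 < B\<^sup>2 * E p \<Longrightarrow> E p < 1 \<Longrightarrow> p \<in> \<Omega>"
proof -
  assume "r\<^sup>2 < B\<^sup>2 * E p" "E p < 1"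
  then have "r\<^sup>2 < (norm p)\<^sup>2" using E_le_norm[of p] by simp
  then have "r < norm p" by (rule power_less_imp_less_base) simp
  then show ?thesis using \<open>E p < 1\<close> by (simp add: mem_iff)
qed

text \<open>The gradient of \<open>u\<close> need not extend to the boundary. The estimate below replaces the boundary
  inequality \<open>\<partial>u/\<partial>x \<le> 0\<close> on the right half of the ellipse; it holds since \<open>1 - E\<close> is a
  superharmonic function vanishing there.\<close>

lemma boundary_estimate:
  obtains C \<kappa> h0 where "0 < C" "0 < \<kappa>" "\<kappa> \<le> 1" "0 < h0"
    "\<And>h p. 0 < h \<Longrightarrow> h \<le> h0 \<Longrightarrow> - h / 2 \<le> p $ 1 \<Longrightarrow> 1 - \<kappa> \<le> E p \<Longrightarrow> E p \<le> 1 \<Longrightarrow>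
      u (p + h *\<^sub>R axis 1 1) - u p \<le> C * h * (1 - E p)"
proof -
  \<comment> \<open>A quarter of the gap \<open>1 - (r / B)\<^sup>2\<close>, so that even the wider
    layer \<open>1 - 3 / 2 * \<kappa> \<le> E\<close> avoids the hole.\<close>
  define \<kappa> where "\<kappa> = (1 - (r / B)\<^sup>2) / 4"
  have "(r / B)\<^sup>2 < 1" using r rB B_pos by (simp add: power_less_one_iff)
  then have \<kappa>: "0 < \<kappa>" "\<kappa> \<le> 1" using zero_le_power2[of "r / B"] by (simp_all add: \<kappa>_def, linarith)
  have gtr: "r\<^sup>2 < B\<^sup>2 * e" if "1 - 3 / 2 * \<kappa> \<le> e" for e
  proof -
    have "(r / B)\<^sup>2 < 1 - 3 / 2 * \<kappa>"
    proof -
      have "x < 1 - 3 / 2 * ((1 - x) / 4)" if "x < 1" for x :: real using that by (simp add: field_simps)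
      then show ?thesis unfolding \<kappa>_def using \<open>(r / B)\<^sup>2 < 1\<close> by blast
    qed
    then have "B\<^sup>2 * (r / B)\<^sup>2 < B\<^sup>2 * e" using that B_pos by (intro mult_strict_left_mono) auto
    then show ?thesis using B_pos by (simp add: power_divide)
  qed
  \<comment> \<open>A compact layer inside \<Omega> around the curve
    \<open>E = 1 - \<kappa>\<close>; a shift by at most \<open>h0\<close> changes \<open>E\<close>
    by at most \<open>\<kappa> / 2\<close> and so cannot leave it.\<close>
  define K where "K = {p. 1 - 3 / 2 * \<kappa> \<le> E p} \<inter> {p. E p \<le> 1 - \<kappa> / 2}"
  have "closed K" unfolding K_def
    by (intro closed_Int closed_Collect_le continuous_intros cont_E)
  moreover have "bounded K" unfolding bounded_iff
    using norm_le_A \<kappa> by (intro exI[of _ A]) (auto simp: K_def)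
  ultimately have K: "compact K" by (simp add: compact_eq_bounded_closed)
  have KO: "K \<subseteq> \<Omega>"
  proof
    fix p assume "p \<in> K"
    then show "p \<in> \<Omega>" using gtr[of "E p"] \<kappa> by (intro E_gt_mem) (auto simp: K_def)
  qed
  have "continuous_on K (\<lambda>p. g p $ 1)"
    using isCont_g KO by (intro continuous_at_imp_continuous_on ballI) (auto intro!: continuous_intros)
  then have "bounded ((\<lambda>p. g p $ 1) ` K)" using K by (intro compact_imp_bounded compact_continuous_image)
  then obtain M where M: "M > 0" "\<And>p. p \<in> K \<Longrightarrow> \<bar>g p $ 1\<bar> \<le> M"
    unfolding bounded_pos by auto
  define h0 where "h0 = \<kappa> * A / 8"
  have h0: "0 < h0" using \<kappa> A_pos by (simp add: h0_def)
  \<comment> \<open>With this factor the multiple of \<open>1 - E\<close> equals \<open>M\<close> on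
    the curve \<open>E = 1 - \<kappa>\<close>, where the difference quotient is at most
    \<open>M\<close>.\<close>
  have C: "0 < M / \<kappa>" using M \<kappa> by simp
  have main: "u (p + h *\<^sub>R axis 1 1) - u p \<le> M / \<kappa> * h * (1 - E p)"
    if h: "0 < h" "h \<le> h0" and p: "- h / 2 \<le> p $ 1" "1 - \<kappa> \<le> E p" "E p \<le> 1" for h p
  proof -
    define \<psi> where "\<psi> = (\<lambda>p. M / \<kappa> * h * (1 - E p) - (u (p + h *\<^sub>R axis 1 1) - u p))"
    \<comment> \<open>On the left edge, a point and its shift by \<open>h\<close> are mirror images
      in the minor axis, so the difference of the two values vanishes.\<close>
    define G where "G = {p. - h / 2 < p $ 1} \<inter> ({p. E p < 1} \<inter> {p. 1 - \<kappa> < E p})"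
    have bd: "0 \<le> \<psi> q" if q: "- h / 2 \<le> q $ 1" "1 - \<kappa> \<le> E q" "E q \<le> 1" "q \<notin> G" for q
    proof -
      consider "q $ 1 = - h / 2" | "E q = 1" | "E q = 1 - \<kappa>" using q by (fastforce simp: G_def)
      then show ?thesis
      proof cases
        case 1
        then have "q + h *\<^sub>R axis 1 1 = refl_y *v q" by (simp add: vec2_eq_iff axis_def)
        then have "u (q + h *\<^sub>R axis 1 1) = u q" by (simp add: sym_y)
        moreover have "0 \<le> M / \<kappa> * h * (1 - E q)"
          using h q by (intro mult_nonneg_nonneg less_imp_le[OF C]) auto
        ultimately show ?thesis by (simp add: \<psi>_def)
      next
        case 2
        then have "1 \<le> E (q + h *\<^sub>R axis 1 1)" using E_shift_ge[of h q] q h by simp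
        then have "u (q + h *\<^sub>R axis 1 1) = 0" "u q = 0" using 2 by (auto intro!: zero simp: mem_iff)
        then show ?thesis by (simp add: \<psi>_def 2)
      next
        case 3
        have inK: "q + t *\<^sub>R axis 1 1 \<in> K" if "0 \<le> t" "t \<le> h" for t
        proof -
          have "t \<le> \<kappa> * A / 8" using that h by (simp add: h0_def)
          then have "\<bar>E (q + t *\<^sub>R axis 1 1) - E q\<bar> \<le> \<kappa> / 2"
            by (rule E_shift_close[OF q(3) that(1) _ \<kappa>])
          then have "1 - 3 / 2 * \<kappa> \<le> E (q + t *\<^sub>R axis 1 1) \<and> E (q + t *\<^sub>R axis 1 1) \<le> 1 - \<kappa> / 2"
            using 3 by linarith
          then show ?thesis by (simp add: K_def)
        qed
        obtain t where t: "0 < t" "t < h"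
          "u (q + h *\<^sub>R axis 1 1) - u q = h * (g (q + t *\<^sub>R axis 1 1) \<bullet> axis 1 1)"
          using difference_quotient[OF h(1), of q "axis 1 1"] inK KO by blast
        have "g (q + t *\<^sub>R axis 1 1) $ 1 \<le> M" using M(2)[OF inK[of t]] t by simp
        then have "h * g (q + t *\<^sub>R axis 1 1) $ 1 \<le> h * M" using h by simp
        then show ?thesis using t(3) 3 \<kappa> by (simp add: \<psi>_def inner_axis mult.commute)
      qed
    qed
    have GO: "q \<in> \<Omega>" if "q \<in> G" for q
      using that gtr[of "E q"] \<kappa> by (intro E_gt_mem) (auto simp: G_def)
    have "0 \<le> \<psi> p"
    proof (cases "p \<in> G")
      case True
      have G: "open G" unfolding G_def
        by (intro open_Int open_Collect_less continuous_intros cont_E)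
      have "bounded G" using GO bdd bounded_subset by blast
      have clG: "closure G \<subseteq> {p. - h / 2 \<le> p $ 1} \<inter> ({p. E p \<le> 1} \<inter> {p. 1 - \<kappa> \<le> E p})"
      proof (rule closure_minimal)
        show "closed ({p::real^2. - h / 2 \<le> p $ 1} \<inter> ({p. E p \<le> 1} \<inter> {p. 1 - \<kappa> \<le> E p}))"
          by (intro closed_Int closed_Collect_le continuous_intros cont_E)
      qed (auto simp: G_def)
      show ?thesis
      proof (rule max_principle[OF G \<open>bounded G\<close> _ _ _ True])
        show "continuous_on (closure G) \<psi>"
          unfolding \<psi>_def by (intro continuous_on_diff[OF _ cont_shift] continuous_intros cont_E)
        show "0 \<le> \<psi> q" if "q \<in> frontier G" for q
          using that clG G by (intro bd) (auto simp: frontier_def interior_open)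
        show "\<exists>L\<le>0. has_laplacian \<psi> q L" if q: "q \<in> G" "\<psi> q < 0" for q
        proof -
          have "0 \<le> M / \<kappa> * h * (1 - E q)"
            using h q by (intro mult_nonneg_nonneg less_imp_le[OF C]) (auto simp: G_def)
          then have "u q < u (q + h *\<^sub>R axis 1 1)" using q(2) by (simp add: \<psi>_def)
          then obtain L where L: "L \<ge> 0" "has_laplacian (\<lambda>p. u (p + h *\<^sub>R axis 1 1) - u p) q L"
            using lap_shift[OF GO[OF q(1)]] by blast
          have "has_laplacian \<psi> q (M / \<kappa> * h * (0 - (2 / A\<^sup>2 + 2 / B\<^sup>2)) - L)"
            unfolding \<psi>_def
            by (intro has_laplacian_diff has_laplacian_cmul has_laplacian_const has_laplacian_E L)
          moreover have "M / \<kappa> * h * (0 - (2 / A\<^sup>2 + 2 / B\<^sup>2)) - L \<le> 0"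
          proof -
            have "0 \<le> M / \<kappa> * h * (2 / A\<^sup>2 + 2 / B\<^sup>2)"
              using h by (intro mult_nonneg_nonneg less_imp_le[OF C]) auto
            then show ?thesis using L(1) unfolding right_diff_distrib mult_zero_right by linarith
          qed
          ultimately show ?thesis by blast
        qed
      qed
    qed (use bd p in blast)
    then show ?thesis by (simp add: \<psi>_def)
  qed
  show ?thesis by (rule that[OF C \<kappa> h0 main])
qed

text \<open>As the gradient has no boundary values, the bound is proved for differences: to the
  right of the line, the increment of \<open>u\<close> under a small step \<open>h\<close> is at
  most \<open>\<epsilon> * h\<close>. On the line this comes from uniform continuity of the gradient
  away from the ellipse and from \<open>boundary_estimate\<close> close to it.\<close>

lemma right_nonpos:
  assumes x: "r < x" and line: "\<And>y. pt x y \<in> \<Omega> \<Longrightarrow> g (pt x y) $ 1 \<le> 0"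
    and p: "p \<in> \<Omega>" "x < p $ 1"
  shows "g p $ 1 \<le> 0"
proof (rule field_le_epsilon)
  fix \<epsilon> :: real assume \<epsilon>: "0 < \<epsilon>"
  obtain C \<kappa>0 h0 where C: "0 < C" "0 < \<kappa>0" "\<kappa>0 \<le> 1" "0 < h0"
    "\<And>h p. 0 < h \<Longrightarrow> h \<le> h0 \<Longrightarrow> - h / 2 \<le> p $ 1 \<Longrightarrow> 1 - \<kappa>0 \<le> E p \<Longrightarrow> E p \<le> 1 \<Longrightarrow>
      u (p + h *\<^sub>R axis 1 1) - u p \<le> C * h * (1 - E p)"
    using boundary_estimate by blast
  \<comment> \<open>Where \<open>1 - E\<close> is at most \<kappa>, the boundary estimate
    \<open>C * h * (1 - E)\<close> is at most \<open>\<epsilon> * h\<close>.\<close>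
  define \<kappa> where "\<kappa> = min \<kappa>0 (\<epsilon> / C)"
  have \<kappa>: "0 < \<kappa>" "\<kappa> \<le> 1" "\<kappa> \<le> \<kappa>0" "\<kappa> \<le> \<epsilon> / C" using C(1-3) \<epsilon> by (auto simp: \<kappa>_def)
  then have C\<kappa>: "C * \<kappa> \<le> \<epsilon>" using C(1) by (simp add: pos_le_divide_eq mult.commute)
  define S where "S = {p. x \<le> p $ 1} \<inter> {p. E p \<le> 1 - \<kappa> / 2}"
  have "closed S" unfolding S_def by (intro closed_Int closed_Collect_le continuous_intros cont_E)
  moreover have "bounded S" unfolding bounded_iff
    using norm_le_A \<kappa> by (intro exI[of _ A]) (auto simp: S_def)
  ultimately have S: "compact S" by (simp add: compact_eq_bounded_closed)
  have SO: "q \<in> \<Omega>" if "q \<in> S" for q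
    using that x norm_ge_fst[of q] \<kappa> by (auto simp: S_def mem_iff)
  have "continuous_on S (\<lambda>p. g p $ 1)"
    using isCont_g SO by (intro continuous_at_imp_continuous_on ballI) (auto intro!: continuous_intros)
  then have "uniformly_continuous_on S (\<lambda>p. g p $ 1)" using S by (intro compact_uniformly_continuous)
  then obtain \<delta> where \<delta>: "\<delta> > 0" "\<And>y z. y \<in> S \<Longrightarrow> z \<in> S \<Longrightarrow> dist z y < \<delta> \<Longrightarrow> dist (g z $ 1) (g y $ 1) < \<epsilon>"
    using \<epsilon> unfolding uniformly_continuous_on_def by blast
  define h1 where "h1 = min (min h0 (\<kappa> * A / 8)) (\<delta> / 2)"
  have h1: "0 < h1" "h1 \<le> h0" "h1 \<le> \<kappa> * A / 8" "h1 < \<delta>"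
    using C(4) \<kappa>(1) A_pos \<delta>(1) by (auto simp: h1_def)
  have main: "u (p + h *\<^sub>R axis 1 1) - u p \<le> \<epsilon> * h" if h: "0 < h" "h \<le> h1" for h
  proof -
    define G where "G = {p. x < p $ 1} \<inter> {p. E p < 1}"
    have G: "open G" unfolding G_def by (intro open_Int open_Collect_less continuous_intros cont_E)
    have GO: "q \<in> \<Omega>" if "q \<in> G" for q
      using that x norm_ge_fst[of q] by (auto simp: G_def mem_iff)
    have "bounded G" using GO bdd bounded_subset by blast
    have clG: "closure G \<subseteq> {p. x \<le> p $ 1} \<inter> {p. E p \<le> 1}"
    proof (rule closure_minimal)
      show "closed ({p::real^2. x \<le> p $ 1} \<inter> {p. E p \<le> 1})"
        by (intro closed_Int closed_Collect_le continuous_intros cont_E)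
    qed (auto simp: G_def)
    have pG: "p \<in> G" using p by (simp add: G_def mem_iff)
    have "0 \<le> \<epsilon> * h - (u (p + h *\<^sub>R axis 1 1) - u p)"
    proof (rule max_principle[OF G \<open>bounded G\<close> _ _ _ pG])
      show "continuous_on (closure G) (\<lambda>p. \<epsilon> * h - (u (p + h *\<^sub>R axis 1 1) - u p))"
        by (intro continuous_on_diff[OF _ cont_shift] continuous_intros)
      show "0 \<le> \<epsilon> * h - (u (q + h *\<^sub>R axis 1 1) - u q)" if "q \<in> frontier G" for q
      proof -
        have q: "x \<le> q $ 1" "E q \<le> 1" "q \<notin> G"
          using that clG G by (auto simp: frontier_def interior_open)
        then consider "E q = 1" | "q $ 1 = x" "1 - \<kappa> \<le> E q" "E q < 1" | "q $ 1 = x" "E q < 1 - \<kappa>"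
          by (fastforce simp: G_def)
        then show ?thesis
        proof cases
          case 1
          then have "1 \<le> E (q + h *\<^sub>R axis 1 1)" using E_shift_ge[of h q] q h x r by simp
          then have "u (q + h *\<^sub>R axis 1 1) = 0" "u q = 0" using 1 by (auto intro!: zero simp: mem_iff)
          then show ?thesis using \<epsilon> h by simp
        next
          case 2
          have "u (q + h *\<^sub>R axis 1 1) - u q \<le> C * h * (1 - E q)"
            by (rule C(5)) (use h h1 x r 2 \<kappa> in auto)
          also have "\<dots> \<le> C * h * \<kappa>" using C h 2 by (intro mult_left_mono) auto
          also have "\<dots> = (C * \<kappa>) * h" by simp
          also have "\<dots> \<le> \<epsilon> * h" using C\<kappa> h by (intro mult_right_mono) auto
          finally show ?thesis by simp
        next
          case 3
          have inS: "q + t *\<^sub>R axis 1 1 \<in> S" if "0 \<le> t" "t \<le> h" for t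
          proof -
            have "t \<le> \<kappa> * A / 8" using that h h1 by simp
            then have "\<bar>E (q + t *\<^sub>R axis 1 1) - E q\<bar> \<le> \<kappa> / 2"
              by (rule E_shift_close[OF q(2) that(1) _ \<kappa>(1,2)])
            then have "E (q + t *\<^sub>R axis 1 1) \<le> 1 - \<kappa> / 2" using 3 by linarith
            moreover have "x \<le> (q + t *\<^sub>R axis 1 1) $ 1" using 3 that by (simp add: axis_def)
            ultimately show ?thesis by (simp add: S_def)
          qed
          obtain t where t: "0 < t" "t < h"
            "u (q + h *\<^sub>R axis 1 1) - u q = h * (g (q + t *\<^sub>R axis 1 1) \<bullet> axis 1 1)"
            using difference_quotient[OF h(1), of q "axis 1 1"] inS SO by blast
          have qe: "q = pt x (q $ 2)" using 3 by (simp add: vec2_eq_iff)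
          have "g q $ 1 \<le> 0" using line[of "q $ 2"] SO[OF inS[of 0]] h unfolding qe[symmetric] by simp
          moreover have "dist (g (q + t *\<^sub>R axis 1 1) $ 1) (g q $ 1) < \<epsilon>"
            by (rule \<delta>(2)) (use inS[of 0] inS[of t] t h h1 in \<open>auto simp: dist_norm\<close>)
          ultimately have "g (q + t *\<^sub>R axis 1 1) $ 1 \<le> \<epsilon>" by (simp add: dist_real_def)
          then have "h * g (q + t *\<^sub>R axis 1 1) $ 1 \<le> h * \<epsilon>" using h by simp
          then show ?thesis using t(3) by (simp add: inner_axis mult.commute)
        qed
      qed
      show "\<exists>L\<le>0. has_laplacian (\<lambda>p. \<epsilon> * h - (u (p + h *\<^sub>R axis 1 1) - u p)) q L"
        if q: "q \<in> G" "\<epsilon> * h - (u (q + h *\<^sub>R axis 1 1) - u q) < 0" for q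
      proof -
        have "0 < \<epsilon> * h" using \<epsilon> h by simp
        then have "u q < u (q + h *\<^sub>R axis 1 1)" using q(2) by simp
        then obtain L where L: "L \<ge> 0" "has_laplacian (\<lambda>p. u (p + h *\<^sub>R axis 1 1) - u p) q L"
          using lap_shift[OF GO[OF q(1)]] by blast
        have "has_laplacian (\<lambda>p. \<epsilon> * h - (u (p + h *\<^sub>R axis 1 1) - u p)) q (0 - L)"
          by (intro has_laplacian_diff has_laplacian_const L)
        then show ?thesis using L(1) by (intro exI[of _ "0 - L"]) auto
      qed
    qed
    then show ?thesis by simp
  qed
  have d1: "((\<lambda>t. u (p + t *\<^sub>R axis 1 1)) has_real_derivative (g p $ 1)) (at 0)"
    using deriv_u_line[of p 0 "axis 1 1"] p by (simp add: inner_axis)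
  have "0 \<le> \<epsilon> * 1 - (g p $ 1 - 0)"
  proof (rule nonneg_derivative_at_right[OF _ h1(1), where W = "\<lambda>t. \<epsilon> * t - (u (p + t *\<^sub>R axis 1 1) - u p)"])
    show "((\<lambda>t. \<epsilon> * t - (u (p + t *\<^sub>R axis 1 1) - u p)) has_real_derivative \<epsilon> * 1 - (g p $ 1 - 0)) (at 0)"
      by (intro DERIV_diff DERIV_cmult DERIV_ident d1 DERIV_const)
    show "\<epsilon> * 0 - (u (p + 0 *\<^sub>R axis 1 1) - u p) \<le> \<epsilon> * t - (u (p + t *\<^sub>R axis 1 1) - u p)"
      if "0 < t" "t < h1" for t
      using main[of t] that by simp
  qed
  then show "g p $ 1 \<le> 0 + \<epsilon>" by simp
qed

lemma axis_mem: "pt t 0 \<in> \<Omega> \<longleftrightarrow> r < \<bar>t\<bar> \<and> \<bar>t\<bar> < A" "pt 0 t \<in> \<Omega> \<longleftrightarrow> r < \<bar>t\<bar> \<and> \<bar>t\<bar> < B"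
proof -
  have sq: "(t / c)\<^sup>2 < 1 \<longleftrightarrow> \<bar>t\<bar> < c" if "0 < c" for c
    using that abs_square_less_1[of "t / c"] by (simp add: abs_divide)
  show "pt t 0 \<in> \<Omega> \<longleftrightarrow> r < \<bar>t\<bar> \<and> \<bar>t\<bar> < A" "pt 0 t \<in> \<Omega> \<longleftrightarrow> r < \<bar>t\<bar> \<and> \<bar>t\<bar> < B"
    using sq[OF A_pos] sq[OF B_pos] by (auto simp: mem_iff E_def)
qed

text \<open>To the right of \<open>x1\<close> the horizontal derivative is nonpositive and vanishes
  at the interior point \<open>pt x2 0\<close>, so it vanishes throughout. Then \<open>u\<close> is
  constant from \<open>pt x2 0\<close> to the vertex of the ellipse, where it is zero.\<close>

lemma critical_right_unique:
  assumes x: "r < x1" "x1 < x2" "x2 < A" and g0: "g (pt x1 0) $ 1 = 0" "g (pt x2 0) $ 1 = 0"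
  shows False
proof -
  have np: "g p $ 1 \<le> 0" if "p \<in> \<Omega>" "x1 < p $ 1" for p
    using right_nonpos[OF x(1) critical_vertical_nonpos[OF x(1) g0(1)] that] .
  define U where "U = {p. E p < 1} \<inter> {p. x1 < axis 1 1 \<bullet> p}"
  have "open U" unfolding U_def
    by (intro open_Int open_Collect_less open_halfspace_gt continuous_intros cont_E)
  moreover have "connected U" unfolding U_def
    by (intro convex_connected convex_Int E_convex convex_halfspace_gt)
  moreover have UO: "U \<subseteq> \<Omega>"
  proof
    fix p assume "p \<in> U"
    then show "p \<in> \<Omega>" using x norm_ge_fst[of p] by (auto simp: U_def mem_iff inner_axis')
  qed
  moreover have memU: "pt t 0 \<in> U" if "x1 < t" "t < A" for t
    using that x r axis_mem(1)[of t] by (auto simp: U_def inner_axis' mem_iff)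
  moreover have "0 \<le> g p \<bullet> (- axis 1 1)" if "p \<in> U" for p
    using np[of p] UO that by (auto simp: U_def inner_axis inner_axis')
  ultimately have z: "g p \<bullet> (- axis 1 1) = 0" if "p \<in> U" for p
    using strong_max_principle_derivative[of "- axis 1 1" U "pt x2 0" p] that x g0
    by (simp add: inner_axis)
  have e: "0 + t *\<^sub>R axis 1 1 = pt t 0" for t by (simp add: vec2_eq_iff axis_def)
  have "u (0 + A *\<^sub>R axis 1 1) = u (0 + x2 *\<^sub>R axis 1 1)"
  proof (rule DERIV_isconst_end[OF x(3)])
    show "continuous_on {x2..A} (\<lambda>t. u (0 + t *\<^sub>R axis 1 1))"
      by (intro continuous_on_compose2[OF cont] continuous_intros) auto
    fix t assume t: "x2 < t" "t < A"
    then have "pt t 0 \<in> U" using memU x by auto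
    then have "g (pt t 0) \<bullet> axis 1 1 = 0" "pt t 0 \<in> \<Omega>" using z[of "pt t 0"] UO by auto
    then show "((\<lambda>t. u (0 + t *\<^sub>R axis 1 1)) has_real_derivative 0) (at t)"
      using deriv_u_line[of 0 t "axis 1 1"] unfolding e by simp
  qed
  then have "u (pt A 0) = u (pt x2 0)" unfolding e .
  moreover have "u (pt A 0) = 0" using axis_mem(1)[of A] A_pos by (intro zero) auto
  moreover have "u (pt x2 0) > 0" using axis_mem(1)[of x2] x r by (intro u_pos) auto
  ultimately show False by simp
qed


section \<open>Semi-axes of the ellipse: uniqueness, counting, maxima\<close>

lemma axis_symmetric:
  "pt t 0 \<in> \<Omega> \<Longrightarrow> g (pt t 0) $ 2 = 0" "pt 0 t \<in> \<Omega> \<Longrightarrow> g (pt 0 t) $ 1 = 0"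
proof -
  assume p: "pt 0 t \<in> \<Omega>"
  have "refl_y *v pt 0 t = pt 0 t" by (simp add: vec2_eq_iff)
  then have "g (pt 0 t) $ 1 = - g (pt 0 t) $ 1" using grad_sym_y[OF p] by (metis refl_nth(3))
  then show "g (pt 0 t) $ 1 = 0" by simp
qed (use on_symmetry_axis(1)[OF inv_x] in simp)

text \<open>Differentiating the angular inequality of \<open>quadrant_grad\<close> across the minor
  axis gives a nonnegative horizontal second derivative; the negative trace leaves a negative one
  along the axis.\<close>

lemma short_hessian:
  assumes y: "r < y" "y < B" and g0: "g (pt 0 y) = 0"
  shows "H (pt 0 y) $ 2 $ 2 < 0"
proof -
  let ?p = "pt 0 y"
  have p: "?p \<in> \<Omega>" using y r by (simp add: axis_mem)
  obtain d where d: "d > 0" "ball ?p d \<subseteq> \<Omega>" using op p by (meson openE)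
  have "((\<lambda>t. y * (g (?p + t *\<^sub>R axis 1 1) \<bullet> axis 1 1) - t * (g (?p + t *\<^sub>R axis 1 1) \<bullet> axis 2 1))
     has_real_derivative y * ((H ?p *v axis 1 1) \<bullet> axis 1 1) -
       (1 * (g (?p + 0 *\<^sub>R axis 1 1) \<bullet> axis 2 1) + ((H ?p *v axis 1 1) \<bullet> axis 2 1) * 0)) (at 0)"
    using deriv_g_line[of ?p 0 "axis 1 1"] p
    by (intro DERIV_diff DERIV_cmult DERIV_mult DERIV_ident) simp_all
  then have "0 \<le> y * ((H ?p *v axis 1 1) \<bullet> axis 1 1) -
       (1 * (g (?p + 0 *\<^sub>R axis 1 1) \<bullet> axis 2 1) + ((H ?p *v axis 1 1) \<bullet> axis 2 1) * 0)"
  proof (rule nonneg_derivative_at_right[OF _ d(1)])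
    fix t :: real assume t: "0 < t" "t < d"
    have q: "?p + t *\<^sub>R axis 1 1 \<in> \<Omega>" using d(2) t by (auto simp: subset_iff dist_norm)
    have "(?p + t *\<^sub>R axis 1 1) $ 1 = t" "(?p + t *\<^sub>R axis 1 1) $ 2 = y" by (simp_all add: axis_def)
    then have "t * g (?p + t *\<^sub>R axis 1 1) $ 2 - y * g (?p + t *\<^sub>R axis 1 1) $ 1 < 0"
      using quadrant_grad[OF q] t y r by simp
    then show "y * (g (?p + 0 *\<^sub>R axis 1 1) \<bullet> axis 1 1) - 0 * (g (?p + 0 *\<^sub>R axis 1 1) \<bullet> axis 2 1)
       \<le> y * (g (?p + t *\<^sub>R axis 1 1) \<bullet> axis 1 1) - t * (g (?p + t *\<^sub>R axis 1 1) \<bullet> axis 2 1)"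
      using g0 by (simp add: inner_axis)
  qed
  then have "0 \<le> y * H ?p $ 1 $ 1" using g0 by (simp add: inner_axis matrix_vector_mult_basis column_def)
  then have "0 \<le> H ?p $ 1 $ 1" using y r by (simp add: zero_le_mult_iff)
  then show ?thesis using eqn[OF p] f_pos[of "u ?p"] by (simp add: trace_def sum_2)
qed

lemma unique_critical_long: "\<exists>!t. r < t \<and> t < A \<and> g (pt t 0) = 0"
proof -
  have e: "0 + t *\<^sub>R axis 1 1 = pt t 0" for t by (simp add: vec2_eq_iff axis_def)
  have "\<exists>t. r < t \<and> t < A \<and> g (0 + t *\<^sub>R axis 1 1) \<bullet> axis 1 1 = 0"
    by (rule critical_on_segment) (use r rB BA in \<open>auto simp only: e axis_mem\<close>)
  then obtain t where t: "r < t" "t < A" "g (pt t 0) $ 1 = 0" unfolding e by (auto simp: inner_axis)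
  have "g (pt t 0) $ 2 = 0" using t r by (intro axis_symmetric) (auto simp: axis_mem)
  then have "g (pt t 0) = 0" using t(3) by (simp add: vec2_eq_iff)
  moreover have "s = t" if "r < s" "s < A" "g (pt s 0) = 0" for s
    using critical_right_unique[of s t] critical_right_unique[of t s] that t by (cases s t rule: linorder_cases) auto
  ultimately show ?thesis using t by blast
qed

lemma unique_critical_short: "\<exists>!t. r < t \<and> t < B \<and> g (pt 0 t) = 0"
proof -
  have e: "0 + t *\<^sub>R axis 2 1 = pt 0 t" for t by (simp add: vec2_eq_iff axis_def)
  have mem: "pt 0 t \<in> \<Omega>" if "r < t" "t < B" for t using that r by (simp add: axis_mem)
  have crit: "g (pt 0 t) = 0 \<longleftrightarrow> g (pt 0 t) \<bullet> axis 2 1 = 0" if "r < t" "t < B" for t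
    using axis_symmetric(2)[OF mem[OF that]] by (auto simp: inner_axis vec2_eq_iff)
  have H22: "(H p *v axis 2 1) \<bullet> axis 2 1 = H p $ 2 $ 2" for p
    by (simp add: inner_axis matrix_vector_mult_basis column_def)
  have "\<exists>t. r < t \<and> t < B \<and> g (0 + t *\<^sub>R axis 2 1) \<bullet> axis 2 1 = 0"
    by (rule critical_on_segment) (use r rB in \<open>auto simp only: e axis_mem\<close>)
  moreover have "s = t" if "r < s" "s < B" "g (pt 0 s) = 0" "r < t" "t < B" "g (pt 0 t) = 0" for s t
    by (rule critical_unique_on_segment[of r B 0 "axis 2 1"])
      (use that mem crit short_hessian H22 in \<open>auto simp only: e inner_zero_left\<close>)
  ultimately show ?thesis using crit unfolding e by blast
qed

lemma critical_neg: "p \<in> \<Omega> \<Longrightarrow> - p \<in> \<Omega> \<and> (g (- p) = 0 \<longleftrightarrow> g p = 0)"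
proof -
  assume p: "p \<in> \<Omega>"
  have e: "- p = refl_x *v (refl_y *v p)" by (simp add: vec2_eq_iff)
  have "refl_y *v p \<in> \<Omega>" using inv_y p by simp
  then have "- p \<in> \<Omega>" "g (- p) = refl_x *v (refl_y *v g p)"
    using inv_x grad_sym_x[of "refl_y *v p"] grad_sym_y[OF p] by (simp_all add: e)
  then show ?thesis by (simp add: vec2_eq_iff)
qed

text \<open>An odd parametrisation \<open>e\<close> of the line covers both axes: central symmetry
  pairs the unique critical point of one half with its opposite.\<close>

lemma card_critical:
  assumes ax: "\<And>t. e t \<in> \<Omega> \<longleftrightarrow> r < \<bar>t\<bar> \<and> \<bar>t\<bar> < M" "\<And>t. e (- t) = - e t" "inj e"
    and line: "\<And>p. p \<in> L \<longleftrightarrow> p \<in> range e" and uniq: "\<exists>!t. r < t \<and> t < M \<and> g (e t) = 0"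
  shows "card {p \<in> \<Omega> \<inter> L. g p = 0} = 2"
proof -
  obtain s where s: "r < s" "s < M" "g (e s) = 0"
    "\<And>t. r < t \<Longrightarrow> t < M \<Longrightarrow> g (e t) = 0 \<Longrightarrow> t = s"
    using uniq by blast
  have sO: "e s \<in> \<Omega>" using s(1,2) r by (simp add: ax)
  have "{p \<in> \<Omega> \<inter> L. g p = 0} = {e s, e (- s)}"
  proof (intro equalityI subsetI)
    fix p assume p: "p \<in> {p \<in> \<Omega> \<inter> L. g p = 0}"
    then obtain t where t: "p = e t" using line by blast
    have O: "e t \<in> \<Omega>" "g (e t) = 0" using p by (auto simp: t)
    have "g (e \<bar>t\<bar>) = 0" using O critical_neg[OF O(1)] by (cases "0 \<le> t") (auto simp: ax(2)[symmetric])
    then have "\<bar>t\<bar> = s" using s(4)[of "\<bar>t\<bar>"] O(1) ax(1)[of t] by blast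
    then have "t = s \<or> t = - s" by linarith
    then show "p \<in> {e s, e (- s)}" using t by blast
  next
    fix p assume "p \<in> {e s, e (- s)}"
    moreover have "e s \<in> L" "e (- s) \<in> L" using line by auto
    ultimately show "p \<in> {p \<in> \<Omega> \<inter> L. g p = 0}" using sO s(3) critical_neg[OF sO] ax(2) by auto
  qed
  moreover have "e s \<noteq> e (- s)" using assms(3) s(1) r by (auto simp: inj_eq)
  ultimately show ?thesis by simp
qed

lemma card_critical_x: "card {p \<in> \<Omega> \<inter> x_axis. g p = 0} = 2"
proof (rule card_critical[of "\<lambda>t. pt t 0" A])
  show "p \<in> x_axis \<longleftrightarrow> p \<in> range (\<lambda>t. pt t 0)" for p
    by (auto simp: x_axis_def image_iff vec2_eq_iff)
  show "inj (\<lambda>t. pt t 0)" by (auto simp: inj_def vec2_eq_iff)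
qed (use axis_mem(1) unique_critical_long in \<open>auto simp: vec2_eq_iff\<close>)

lemma card_critical_y: "card {p \<in> \<Omega> \<inter> y_axis. g p = 0} = 2"
proof (rule card_critical[of "\<lambda>t. pt 0 t" B])
  show "p \<in> y_axis \<longleftrightarrow> p \<in> range (\<lambda>t. pt 0 t)" for p
    by (auto simp: y_axis_def image_iff vec2_eq_iff)
  show "inj (\<lambda>t. pt 0 t)" by (auto simp: inj_def vec2_eq_iff)
qed (use axis_mem(2) unique_critical_short in \<open>auto simp: vec2_eq_iff\<close>)

text \<open>Reflecting a point of the minor axis in a line through the centre, turned by a small
  \<open>t\<close> towards the major axis, moves it along a circle by the angle \<open>2 * t\<close>
  and strictly increases \<open>u\<close> by \<open>sector_strict\<close>.\<close>

lemma local_max_long: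
  assumes p: "p \<in> \<Omega>" and V: "open V" "p \<in> V" "\<And>q. q \<in> V \<Longrightarrow> u q \<le> u p"
  shows "p $ 2 = 0"
proof (rule ccontr)
  assume p2: "p $ 2 \<noteq> 0"
  have "g p = 0" using g_zero_at_extremum[OF p V(1,2)] V(3) by simp
  then have p1: "p $ 1 = 0" using critical_on_axes[OF p] p2 by blast
  define y where "y = \<bar>p $ 2\<bar>"
  have y: "0 < y" using p2 by (simp add: y_def)
  have pe: "p = pt 0 (p $ 2)" using p1 by (simp add: vec2_eq_iff)
  have qO: "pt 0 y \<in> \<Omega>" using p axis_mem(2)[of "p $ 2"] axis_mem(2)[of y] unfolding pe[symmetric] by (simp add: y_def)
  define \<gamma> where "\<gamma> = (\<lambda>t. pt (y * sin (2 * t)) (p $ 2 * cos (2 * t)))"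
  have "isCont \<gamma> 0"
  proof -
    have "\<gamma> = (\<lambda>t. (y * sin (2 * t)) *\<^sub>R axis 1 1 + (p $ 2 * cos (2 * t)) *\<^sub>R axis 2 1)"
      by (rule ext) (simp add: \<gamma>_def vec2_eq_iff axis_def)
    then show ?thesis by (simp add: continuous_intros)
  qed
  moreover have "\<gamma> 0 = p" unfolding \<gamma>_def by (simp add: vec2_eq_iff p1)
  ultimately have "\<forall>\<^sub>F t in at 0. \<gamma> t \<in> V"
    using V(1,2) by (intro topological_tendstoD) (auto simp: isCont_def)
  then obtain d where d: "d > 0" "\<And>t. t \<noteq> 0 \<Longrightarrow> dist t 0 < d \<Longrightarrow> \<gamma> t \<in> V"
    unfolding eventually_at by blast
  define t where "t = min d (pi / 2) / 2"
  have t: "0 < t" "t < d" "t < pi / 2" using d(1) pi_gt_zero unfolding t_def min_def by (auto split: if_splits)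
  have sc: "(sin t)\<^sup>2 + (cos t)\<^sup>2 = 1" "0 < sin t" "0 < cos t" using t by (auto intro!: sin_gt_zero cos_gt_zero)
  have "pt 0 y \<in> sector (sin t) (cos t)"
    using qO y sc by (simp add: sector_def inner_vec_def sum_2)
  then have less: "u (pt 0 y) < u (householder (pt (- cos t) (sin t)) *v pt 0 y)"
    by (rule sector_strict[OF sc])
  have he: "householder (pt (- cos t) (sin t)) *v pt 0 y = pt (y * sin (2 * t)) (y * cos (2 * t))"
    unfolding householder_mult cos_double_sin sin_double
    by (simp add: inner_vec_def sum_2 vec2_eq_iff power2_eq_square algebra_simps)
  have "u (\<gamma> t) = u (pt (y * sin (2 * t)) (y * cos (2 * t))) \<and> u p = u (pt 0 y)"
  proof (cases "0 < p $ 2")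
    case True
    then have "p = pt 0 y" using p1 by (simp add: vec2_eq_iff y_def)
    then show ?thesis using True by (simp add: \<gamma>_def y_def)
  next
    case False
    then have n: "p $ 2 = - y" by (simp add: y_def)
    then have "\<gamma> t = refl_x *v pt (y * sin (2 * t)) (y * cos (2 * t))" "p = refl_x *v pt 0 y"
      using p1 by (simp_all add: vec2_eq_iff \<gamma>_def)
    then show ?thesis using sym_x by simp
  qed
  moreover have "\<gamma> t \<in> V" using d(2)[of t] t by simp
  ultimately show False using V(3)[of "\<gamma> t"] less unfolding he by simp
qed

text \<open>The global maximum lies on the major axis, where the critical points form one pair of
  opposite points; \<open>u\<close> takes the same value at both.\<close>

lemma long_critical_max:
  assumes "p \<in> \<Omega>" "g p = 0" "p $ 2 = 0"
  shows "u q \<le> u p"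
proof -
  obtain m where m: "m \<in> \<Omega>" "\<And>q. u q \<le> u m" using global_max_exists assms(1) by blast
  have m2: "m $ 2 = 0" using local_max_long[OF m(1), of UNIV] m(2) by auto
  have gm: "g m = 0" using g_zero_at_extremum[OF m(1), of UNIV] m(2) by simp
  have right: "r < \<bar>x $ 1\<bar> \<and> \<bar>x $ 1\<bar> < A \<and> g (pt \<bar>x $ 1\<bar> 0) = 0 \<and> u x = u (pt \<bar>x $ 1\<bar> 0)"
    if x: "x \<in> \<Omega>" "g x = 0" "x $ 2 = 0" for x
  proof -
    have e: "pt (x $ 1) 0 = x" using x(3) by (simp add: vec2_eq_iff)
    have e': "pt \<bar>x $ 1\<bar> 0 = x \<or> pt \<bar>x $ 1\<bar> 0 = - x" using x(3) by (simp add: vec2_eq_iff abs_if)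
    have "r < \<bar>x $ 1\<bar> \<and> \<bar>x $ 1\<bar> < A" using axis_mem(1)[of "x $ 1"] x(1) unfolding e by blast
    moreover have "g (pt \<bar>x $ 1\<bar> 0) = 0 \<and> u x = u (pt \<bar>x $ 1\<bar> 0)"
      using e' critical_neg[OF x(1)] x(2) sym_neg[of x] by auto
    ultimately show ?thesis by blast
  qed
  have "\<bar>m $ 1\<bar> = \<bar>p $ 1\<bar>"
    using unique_critical_long right[OF m(1) gm m2] right[OF assms] by blast
  then have "u m = u p" using right[OF m(1) gm m2] right[OF assms] by simp
  then show ?thesis using m(2)[of q] by simp
qed

end

section \<open>Analytic nonlinearities and rigid motions\<close>

lemma real_analytic_C1:
  assumes "real_analytic f"
  shows "(f has_real_derivative deriv f x) (at x)" "isCont (deriv f) x"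
proof -
  obtain d c where d: "d > 0" and c: "\<And>y. \<bar>y - x\<bar> < d \<Longrightarrow> (\<lambda>n. c n * (y - x) ^ n) sums f y"
    using assms unfolding real_analytic_def by meson
  have sm: "summable (\<lambda>n. c n * z ^ n)" if "norm z < d" for z
    using c[of "x + z"] that by (simp add: sums_iff)
  have sm': "summable (\<lambda>n. diffs c n * z ^ n)" if "norm z < d" for z
    by (rule termdiff_converges[OF that sm])
  have dy: "(f has_real_derivative (\<Sum>n. diffs c n * (y - x) ^ n)) (at y)" if y: "\<bar>y - x\<bar> < d" for y
  proof -
    have "((\<lambda>z. \<Sum>n. c n * z ^ n) has_real_derivative (\<Sum>n. diffs c n * (y - x) ^ n)) (at (y - x))"
      by (rule termdiffs_strong'[OF sm]) (use y in auto)
    then have "((\<lambda>w. \<Sum>n. c n * (w - x) ^ n) has_real_derivative (\<Sum>n. diffs c n * (y - x) ^ n) * (1 - 0)) (at y)"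
      by (rule DERIV_chain2[where g="\<lambda>w. w - x"]) (intro derivative_intros)
    then have "((\<lambda>w. \<Sum>n. c n * (w - x) ^ n) has_real_derivative (\<Sum>n. diffs c n * (y - x) ^ n)) (at y)" by simp
    then show ?thesis
    proof (rule has_field_derivative_transform_within_open)
      show "open (ball x d)" "y \<in> ball x d" using y by (auto simp: dist_real_def)
      show "(\<Sum>n. c n * (w - x) ^ n) = f w" if "w \<in> ball x d" for w
        using c[of w] that by (simp add: sums_iff dist_real_def abs_minus_commute)
    qed
  qed
  show "(f has_real_derivative deriv f x) (at x)"
    using dy[of x] d DERIV_imp_deriv by fastforce
  have "isCont (\<lambda>z. \<Sum>n. diffs c n * z ^ n) (x - x)"
    by (rule DERIV_isCont[OF termdiffs_strong'[OF sm']]) (use d in auto)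
  then have "isCont (\<lambda>y. \<Sum>n. diffs c n * (y - x) ^ n) x"
    by (rule isCont_o2[where f="\<lambda>y. y - x", rotated]) (intro continuous_intros)
  moreover have "\<forall>\<^sub>F y in nhds x. (\<Sum>n. diffs c n * (y - x) ^ n) = deriv f y"
    unfolding eventually_nhds_metric
  proof (intro exI conjI allI impI)
    show "(\<Sum>n. diffs c n * (y - x) ^ n) = deriv f y" if "dist y x < d" for y
      using DERIV_imp_deriv[OF dy[of y]] that by (simp add: dist_real_def)
  qed (rule d)
  ultimately show "isCont (deriv f) x" by (simp add: isCont_cong)
qed

lemma real_analytic_lipschitz:
  assumes "real_analytic f"
  shows "\<exists>k\<ge>0. \<forall>s t. 0 \<le> s \<and> s \<le> t \<and> t \<le> M \<longrightarrow> f s - f t \<le> k * (t - s)"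
proof -
  have "continuous_on {0..M} (deriv f)"
    using real_analytic_C1(2)[OF assms] by (intro continuous_at_imp_continuous_on) auto
  then have "bounded (deriv f ` {0..M})" by (intro compact_imp_bounded compact_continuous_image) auto
  then obtain k where k: "k > 0" "\<And>x. x \<in> {0..M} \<Longrightarrow> \<bar>deriv f x\<bar> \<le> k"
    unfolding bounded_pos by auto
  have "f s - f t \<le> k * (t - s)" if st: "0 \<le> s" "s \<le> t" "t \<le> M" for s t
  proof (cases "s = t")
    case False
    then have "\<exists>z>s. z < t \<and> f t - f s = (t - s) * deriv f z"
      using st by (intro MVT2 real_analytic_C1(1)[OF assms]) auto
    then obtain z where z: "s < z" "z < t" "f t - f s = (t - s) * deriv f z" by blast
    have "- k \<le> deriv f z" using k(2)[of z] z st by (simp add: abs_le_iff)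
    then have "(t - s) * (- k) \<le> (t - s) * deriv f z" using st by (intro mult_left_mono) auto
    then show ?thesis using z(3) by (simp add: algebra_simps)
  qed simp
  then show ?thesis using k(1) by (intro exI[of _ k]) auto
qed

lemma deriv_nonpos_antimono:
  assumes "real_analytic f" "\<forall>t. deriv f t \<le> 0" "s \<le> t"
  shows "f t \<le> f s"
  using DERIV_nonpos_imp_nonincreasing[OF assms(3)] real_analytic_C1(1)[OF assms(1)] assms(2) by blast

text \<open>Analyticity enters here: a nonnegative decreasing function with a zero vanishes on a half line.\<close>

lemma real_analytic_pos_or_zero:
  assumes an: "real_analytic f" and nn: "\<forall>t. f t \<ge> 0" and dec: "\<forall>t. deriv f t \<le> 0"
  shows "(\<forall>t. 0 < f t) \<or> (\<forall>t. f t = 0)"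
proof (rule ccontr)
  assume "\<not> ?thesis"
  then obtain t0 s0 where t0: "f t0 = 0" and s0: "f s0 \<noteq> 0" using nn by (metis less_eq_real_def)
  have z: "f t = 0" if "t0 \<le> t" for t
    using deriv_nonpos_antimono[OF an dec that] nn t0 by (metis order_antisym)
  define S where "S = {t. f t \<noteq> 0}"
  have S: "S \<noteq> {}" "bdd_above S"
  proof -
    show "S \<noteq> {}" using s0 by (auto simp: S_def)
    have "t \<le> t0" if "t \<in> S" for t using z[of t] that by (cases "t \<le> t0") (auto simp: S_def)
    then show "bdd_above S" by (rule bdd_aboveI)
  qed
  \<comment> \<open>The right end of the set where \<open>f\<close> is nonzero. The power series of
    \<open>f\<close> at \<open>T\<close> vanishes to the right, so its zero at \<open>T\<close> is
    not isolated and all coefficients vanish; then \<open>f\<close> is zero to the left of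
    \<open>T\<close> as well, against the choice of \<open>T\<close>.\<close>
  define T where "T = Sup S"
  have right: "f t = 0" if "T < t" for t
  proof (rule ccontr)
    assume "f t \<noteq> 0"
    then have "t \<le> Sup S" by (intro cSup_upper S(2)) (simp add: S_def)
    then show False using that by (simp add: T_def)
  qed
  have "isCont f T" using real_analytic_C1(1)[OF an] DERIV_isCont by blast
  then have "(f \<longlongrightarrow> f T) (at_right T)" by (simp add: isCont_def filterlim_at_split)
  moreover have "(f \<longlongrightarrow> 0) (at_right T)"
    by (rule tendsto_eventually) (use right in \<open>auto simp: eventually_at_filter\<close>)
  ultimately have fT: "f T = 0" using tendsto_unique trivial_limit_at_right_real by blast
  obtain d c where d: "d > 0" and c: "\<And>y. \<bar>y - T\<bar> < d \<Longrightarrow> (\<lambda>n. c n * (y - T) ^ n) sums f y"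
    using an unfolding real_analytic_def by meson
  have "c n = 0" if "n > 0" for n :: nat
  proof (rule ccontr)
    assume "c n \<noteq> 0"
    have c': "(\<lambda>n. c n * (y - T) ^ n) sums f y" if "norm (y - T) < d" for y using c that by simp
    obtain s where s: "0 < s" "\<And>z. z \<in> cball T s - {T} \<Longrightarrow> f z \<noteq> 0"
      using powser_0_nonzero[OF d c' fT \<open>c n \<noteq> 0\<close> \<open>n > 0\<close>] by blast
    show False using s(2)[of "T + s"] s(1) right[of "T + s"] by (auto simp: dist_real_def)
  qed
  moreover have "c 0 = 0" using c[of T] d fT by (simp add: sums_iff)
  ultimately have "c n = 0" for n by (cases "n = 0") auto
  then have near: "f y = 0" if "\<bar>y - T\<bar> < d" for y using c[OF that] by (simp add: sums_iff)
  have "T - d < Sup S" using d by (simp add: T_def)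
  then obtain t where t: "t \<in> S" "T - d < t" using less_cSup_iff[OF S] by blast
  have "t \<le> T" using cSup_upper[OF t(1) S(2)] by (simp add: T_def)
  then show False using near[of t] t d by (simp add: S_def)
qed

section \<open>From the classical problem to the locale\<close>

definition gradient :: "(real^2 \<Rightarrow> real) \<Rightarrow> real^2 \<Rightarrow> real^2" where
  "gradient u p = (\<chi> i. partial_deriv i u p)"

definition hessian :: "(real^2 \<Rightarrow> real) \<Rightarrow> real^2 \<Rightarrow> real^2^2" where
  "hessian u p = (\<chi> i j. partial_deriv j (partial_deriv i u) p)"

lemma has_derivative_gradient:
  assumes "u differentiable (at p)"
  shows "(u has_derivative (\<lambda>h. gradient u p \<bullet> h)) (at p)"
proof -
  have D: "(u has_derivative frechet_derivative u (at p)) (at p)"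
    using assms frechet_derivative_works by blast
  interpret linear "frechet_derivative u (at p)" using D has_derivative_linear by blast
  have "frechet_derivative u (at p) = (\<lambda>h. gradient u p \<bullet> h)"
  proof
    fix h :: "real^2"
    have "h = h $ 1 *\<^sub>R axis 1 1 + h $ 2 *\<^sub>R axis 2 1" by (simp add: vec2_eq_iff axis_def)
    then have "frechet_derivative u (at p) h = frechet_derivative u (at p) (h $ 1 *\<^sub>R axis 1 1 + h $ 2 *\<^sub>R axis 2 1)"
      by simp
    also have "\<dots> = gradient u p \<bullet> h"
      unfolding add scale by (simp add: gradient_def partial_deriv_def inner_vec_def sum_2)
    finally show "frechet_derivative u (at p) h = gradient u p \<bullet> h" .
  qed
  then show ?thesis using D by simp
qed

lemma has_derivative_hessian:
  assumes "\<And>i. partial_deriv i u differentiable (at p)"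
  shows "(gradient u has_derivative (\<lambda>h. hessian u p *v h)) (at p)"
proof -
  have "((\<lambda>q. gradient u q \<bullet> b) has_derivative (\<lambda>h. (hessian u p *v h) \<bullet> b)) (at p)" if bB: "b \<in> Basis" for b
  proof -
    obtain i where b: "b = axis i 1" using bB by (auto simp: Basis_vec_def)
    have "(\<lambda>q. gradient u q \<bullet> b) = partial_deriv i u"
      by (rule ext) (simp add: b inner_axis gradient_def)
    moreover have "(\<lambda>h. (hessian u p *v h) \<bullet> b) = (\<lambda>h. gradient (partial_deriv i u) p \<bullet> h)"
      unfolding b inner_axis
      by (rule ext) (simp add: hessian_def gradient_def matrix_vector_mult_def inner_vec_def)
    ultimately show ?thesis using has_derivative_gradient[OF assms[of i]] by simp
  qed
  then show ?thesis using has_derivative_componentwise_within by blast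
qed

text \<open>Zero boundary values make the extension continuous on the plane. The derivative is
  recorded for both functions, since the locale speaks of the extension and critical points are
  those of \<open>u\<close>.\<close>

lemma classical_solution_extension:
  assumes sol: "classical_dirichlet_solution f \<Omega> u" and \<Omega>: "open \<Omega>"
  defines "v \<equiv> \<lambda>p. if p \<in> \<Omega> then u p else 0"
  shows "continuous_on UNIV v"
    and "p \<in> \<Omega> \<Longrightarrow> (u has_derivative (\<lambda>h. gradient u p \<bullet> h)) (at p)"
    and "p \<in> \<Omega> \<Longrightarrow> (v has_derivative (\<lambda>h. gradient u p \<bullet> h)) (at p)"
    and "p \<in> \<Omega> \<Longrightarrow> (gradient u has_derivative (\<lambda>h. hessian u p *v h)) (at p)"
    and "p \<in> \<Omega> \<Longrightarrow> trace (hessian u p) = - f (v p)"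
proof -
  have C2: "C2_on u \<Omega>" and cont: "continuous_on (closure \<Omega>) u"
    and eq: "\<And>p. p \<in> \<Omega> \<Longrightarrow> laplacian u p + f (u p) = 0" and fr: "\<And>p. p \<in> frontier \<Omega> \<Longrightarrow> u p = 0"
    using sol unfolding classical_dirichlet_solution_def by auto
  have "continuous_on (closure \<Omega> \<union> - \<Omega>) v"
    unfolding v_def
  proof (rule continuous_on_cases[OF _ _ cont])
    show "\<forall>p. p \<in> closure \<Omega> \<and> p \<notin> \<Omega> \<or> p \<in> - \<Omega> \<and> p \<in> \<Omega> \<longrightarrow> u p = 0"
      using fr \<Omega> by (auto simp: frontier_def interior_open)
  qed (use \<Omega> in auto)
  moreover have "closure \<Omega> \<union> - \<Omega> = UNIV" using closure_subset by blast
  ultimately show "continuous_on UNIV v" by simp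
  show d: "(u has_derivative (\<lambda>h. gradient u p \<bullet> h)) (at p)" if "p \<in> \<Omega>" for p
    using C2 that by (intro has_derivative_gradient) (simp add: C2_on_def)
  show "(v has_derivative (\<lambda>h. gradient u p \<bullet> h)) (at p)" if "p \<in> \<Omega>"
    by (rule has_derivative_transform_within_open[OF d[OF that] \<Omega> that]) (simp add: v_def)
  show "(gradient u has_derivative (\<lambda>h. hessian u p *v h)) (at p)" if "p \<in> \<Omega>"
    using C2 that by (intro has_derivative_hessian) (simp add: C2_on_def)
  show "trace (hessian u p) = - f (v p)" if "p \<in> \<Omega>"
    using eq[OF that] that by (simp add: laplacian_def trace_def hessian_def v_def)
qed

text \<open>In the other case of \<open>real_analytic_pos_or_zero\<close> the solution is harmonic
  with zero boundary values, hence zero and so constant.\<close>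

lemma nonlinearity_pos:
  fixes \<Omega> :: "(real^2) set"
  assumes \<Omega>: "open \<Omega>" "bounded \<Omega>" and an: "real_analytic f" "\<forall>t. f t \<ge> 0" "\<forall>t. deriv f t \<le> 0"
    and sol: "classical_dirichlet_solution f \<Omega> u" and nc: "\<not> u constant_on \<Omega>"
  shows "0 < f t"
proof (rule ccontr)
  assume "\<not> 0 < f t"
  then have f0: "f t = 0" for t using real_analytic_pos_or_zero[OF an] by blast
  define v where "v = (\<lambda>p. if p \<in> \<Omega> then u p else 0)"
  note ext = classical_solution_extension[OF sol \<Omega>(1), folded v_def]
  have lap: "has_laplacian v p 0" if "p \<in> \<Omega>" for p
    using ext(3,4,5) \<Omega>(1) that f0 by (intro has_laplacianI[of \<Omega> p v "gradient u" "hessian u p"]) auto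
  have fr: "v p = 0" if "p \<in> frontier \<Omega>" for p
    using that \<Omega>(1) by (auto simp: v_def frontier_def interior_open)
  have c: "continuous_on S v" for S using ext(1) continuous_on_subset by blast
  have "v p = 0" if p: "p \<in> \<Omega>" for p
  proof -
    have "0 \<le> v p"
      by (rule max_principle[OF \<Omega> c _ _ p]) (use fr lap in auto)
    moreover have "0 \<le> (-1) * v p"
    proof (rule max_principle[OF \<Omega> _ _ _ p])
      show "continuous_on (closure \<Omega>) (\<lambda>p. (-1) * v p)" by (intro continuous_intros c)
      show "\<exists>L\<le>0. has_laplacian (\<lambda>p. (-1) * v p) q L" if "q \<in> \<Omega>" for q
        using has_laplacian_cmul[OF lap[OF that], of "-1"] by auto
    qed (use fr in auto)
    ultimately show ?thesis by simp
  qed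
  then have "u p = 0" if "p \<in> \<Omega>" for p using that by (simp add: v_def split: if_splits)
  then show False using nc unfolding constant_on_def by blast
qed

text \<open>Maxima are transferred in two ways: a local maximum of \<open>u\<close> is pulled back
  to one of the model solution, and a global maximum of the model solution is pushed forward. The
  second is what excludes saddles at critical points of the long semi-axes.\<close>

lemma rigid_motion_reduction:
  fixes \<Omega>0 :: "(real^2) set"
  assumes T: "rigid_motion T" and \<Omega>: "open \<Omega>0" "bounded \<Omega>0"
    and an: "real_analytic f" "\<forall>t. f t \<ge> 0" "\<forall>t. deriv f t \<le> 0"
    and sol: "classical_dirichlet_solution f (T ` \<Omega>0) u" and nc: "\<not> u constant_on T ` \<Omega>0"
  obtains v g H where "inj T" "dirichlet_solution f \<Omega>0 v g H"
    "\<And>p. p \<in> \<Omega>0 \<Longrightarrow> critical_point u (T p) \<longleftrightarrow> g p = 0"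
    "\<And>p. p \<in> \<Omega>0 \<Longrightarrow> maximum_point u (T p) \<Longrightarrow> \<exists>V. open V \<and> p \<in> V \<and> (\<forall>q\<in>V. v q \<le> v p)"
    "\<And>p. p \<in> \<Omega>0 \<Longrightarrow> (\<And>q. v q \<le> v p) \<Longrightarrow> maximum_point u (T p)"
proof -
  obtain c h where h: "orthogonal_transformation h" "T = (\<lambda>p. c + h p)"
    using T unfolding rigid_motion_def by blast
  define Q where "Q = matrix h"
  have Q: "orthogonal_matrix Q" "h p = Q *v p" for p
    using h(1) fun_cong[OF matrix_vector_mul(2)[OF orthogonal_transformation_linear[OF h(1)]], of p]
    by (auto simp: Q_def orthogonal_transformation_matrix)
  have Te: "T p = c + Q *v p" for p by (simp add: h(2) Q(2))
  have inj: "inj T" using orthogonal_transformation_inj[OF h(1)] by (auto simp: h(2) inj_def)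
  define \<Omega> where "\<Omega> = T ` \<Omega>0"
  define Qt where "Qt = transpose Q"
  have QQ: "Qt *v (Q *v p) = p" "Q *v (Qt *v p) = p" for p
    using Q(1) unfolding matrix_vector_mul_assoc orthogonal_matrix_def Qt_def by simp_all
  have "\<Omega> = (\<lambda>q. Qt *v (q - c)) -` \<Omega>0"
  proof (intro equalityI subsetI)
    fix q assume "q \<in> (\<lambda>q. Qt *v (q - c)) -` \<Omega>0"
    moreover have "q = T (Qt *v (q - c))" by (simp add: Te QQ)
    ultimately show "q \<in> \<Omega>" unfolding \<Omega>_def by blast
  qed (auto simp: \<Omega>_def Te QQ)
  moreover have "open ((\<lambda>q. Qt *v (q - c)) -` \<Omega>0)"
    using \<Omega>(1) unfolding matrix_vector_mult_diff_distrib by (intro open_vimage) (auto intro!: continuous_intros)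
  ultimately have op: "open \<Omega>" by simp
  have bd: "bounded \<Omega>"
  proof -
    have "bounded (h ` \<Omega>0)"
      using \<Omega>(2) orthogonal_transformation_linear[OF h(1)]
      by (intro bounded_linear_image) (auto simp: linear_conv_bounded_linear)
    then have "bounded ((\<lambda>x. c + x) ` (h ` \<Omega>0))" by (rule bounded_translation)
    then show ?thesis by (simp add: \<Omega>_def h(2) image_image)
  qed
  note sol' = sol[folded \<Omega>_def] and nc' = nc[folded \<Omega>_def]
  define w where "w = (\<lambda>p. if p \<in> \<Omega> then u p else 0)"
  note ext = classical_solution_extension[OF sol' op, folded w_def]
  have ds: "dirichlet_solution f \<Omega> w (gradient u) (hessian u)"
  proof
    show "0 < f t" for t by (rule nonlinearity_pos[OF op bd an sol' nc'])
    show "f t \<le> f s" if "s \<le> t" for s t using deriv_nonpos_antimono[OF an(1,3) that] .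
    show "\<exists>k\<ge>0. \<forall>s t. 0 \<le> s \<and> s \<le> t \<and> t \<le> M \<longrightarrow> f s - f t \<le> k * (t - s)" for M
      by (rule real_analytic_lipschitz[OF an(1)])
    show "w p = 0" if "p \<notin> \<Omega>" for p using that by (simp add: w_def)
    show "trace (hessian u p) = - f (w p)" if "p \<in> \<Omega>" for p
      using ext(5)[OF that] that by (simp add: w_def)
  qed (use op bd ext in auto)
  have mem: "T p \<in> \<Omega> \<longleftrightarrow> p \<in> \<Omega>0" for p using inj by (auto simp: \<Omega>_def inj_image_mem_iff)
  have "{p. c + Q *v p \<in> \<Omega>} = \<Omega>0" using mem by (auto simp: Te)
  then have sol0: "dirichlet_solution f \<Omega>0 (\<lambda>p. w (T p)) (\<lambda>p. Qt *v gradient u (T p))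
      (\<lambda>p. Qt ** hessian u (T p) ** Q)"
    using dirichlet_solution.transform[OF ds Q(1), of c, folded Qt_def] by (simp add: Te)
  show ?thesis
  proof (rule that[OF inj sol0])
    fix p assume p: "p \<in> \<Omega>0"
    then have Tp: "T p \<in> \<Omega>" by (simp add: mem)
    have "critical_point u (T p) \<longleftrightarrow> gradient u (T p) = 0"
    proof
      assume "critical_point u (T p)"
      then have "(u has_derivative (\<lambda>h. 0 \<bullet> h)) (at (T p))"
        by (simp add: critical_point_def gderiv_def inner_commute)
      from has_derivative_unique[OF this ext(2)[OF Tp]]
      have "0 \<bullet> h = gradient u (T p) \<bullet> h" for h by metis
      then show "gradient u (T p) = 0" by (metis inner_eq_zero_iff inner_zero_left)
    next
      assume "gradient u (T p) = 0"
      then show "critical_point u (T p)" using ext(2)[OF Tp] by (simp add: critical_point_def gderiv_def)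
    qed
    also have "\<dots> \<longleftrightarrow> Qt *v gradient u (T p) = 0"
      using QQ(2)[of "gradient u (T p)"] by (metis matrix_vector_mult_0_right)
    finally show "critical_point u (T p) \<longleftrightarrow> Qt *v gradient u (T p) = 0" .
  next
    fix p assume p: "p \<in> \<Omega>0" and mx: "maximum_point u (T p)"
    obtain W where W: "open W" "T p \<in> W" "\<And>q. q \<in> W \<Longrightarrow> u q \<le> u (T p)"
      using mx unfolding maximum_point_def eventually_nhds by blast
    have "open (T -` (W \<inter> \<Omega>))"
      using W(1) op by (intro open_vimage) (auto simp: Te intro!: continuous_intros)
    moreover have "p \<in> T -` (W \<inter> \<Omega>)" using W(2) p mem by simp
    moreover have "w (T q) \<le> w (T p)" if "q \<in> T -` (W \<inter> \<Omega>)" for q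
      using W(3)[of "T q"] that p mem by (simp add: w_def)
    ultimately show "\<exists>V. open V \<and> p \<in> V \<and> (\<forall>q\<in>V. w (T q) \<le> w (T p))" by blast
  next
    fix p assume p: "p \<in> \<Omega>0" and mx: "\<And>q. w (T q) \<le> w (T p)"
    have "u q \<le> u (T p)" if q: "q \<in> \<Omega>" for q
    proof -
      obtain q' where "q = T q'" "q' \<in> \<Omega>0" using q by (auto simp: \<Omega>_def)
      then show ?thesis using mx[of q'] p mem by (simp add: w_def)
    qed
    then show "maximum_point u (T p)"
      unfolding maximum_point_def eventually_nhds using op mem p by blast
  qed
qed

theorem theoremC:
  fixes \<Omega> :: "(real ^ 2) set"
    and axes longs shorts :: "(real ^ 2) set set"
    and f :: "real \<Rightarrow> real"
    and u :: "real ^ 2 \<Rightarrow> real"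
  assumes "eccentric_circle_annular_domain \<Omega> axes longs shorts \<or>
           elliptic_exterior_petal_domain \<Omega> axes longs shorts"
    and "real_analytic f"
    and "\<forall>t. f t \<ge> 0"
    and "\<forall>t. deriv f t \<le> 0"
    and "classical_dirichlet_solution f \<Omega> u"
    and "\<not> u constant_on \<Omega>"
  shows "(\<forall>l\<in>axes. card {p \<in> \<Omega> \<inter> l. critical_point u p} = 2) \<and>
         (\<forall>p\<in>\<Omega>. critical_point u p \<longrightarrow> p \<in> \<Union> axes) \<and>
         (\<forall>p\<in>\<Omega>. maximum_point u p \<longrightarrow> p \<in> \<Union> longs) \<and>
         (\<forall>p\<in>\<Omega>. saddle_point u p \<longrightarrow> p \<in> \<Union> shorts)"
  using assms(1)
proof
  assume "eccentric_circle_annular_domain \<Omega> axes longs shorts"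
  then obtain T a r R where T: "rigid_motion T" and par: "0 < a" "0 < r" "a + r < R"
    and \<Omega>: "\<Omega> = T ` eccentric_annulus a r R" and axes: "axes = {T ` x_axis}"
    and longs: "longs = {T ` {p. p $ 2 = 0 \<and> - R < p $ 1 \<and> p $ 1 < a - r}}"
    and shorts: "shorts = {T ` {p. p $ 2 = 0 \<and> a + r < p $ 1 \<and> p $ 1 < R}}"
    unfolding eccentric_circle_annular_domain_def by blast
  let ?W = "eccentric_annulus a r R"
  have W: "open ?W" "bounded ?W" by (auto simp: eccentric_annulus_def bounded_diff)
  obtain v g H where inj: "inj T" and sol: "dirichlet_solution f ?W v g H"
    and crit: "\<And>p. p \<in> ?W \<Longrightarrow> critical_point u (T p) \<longleftrightarrow> g p = 0"
    and lmax: "\<And>p. p \<in> ?W \<Longrightarrow> maximum_point u (T p) \<Longrightarrow> \<exists>V. open V \<and> p \<in> V \<and> (\<forall>q\<in>V. v q \<le> v p)"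
    and gmax: "\<And>p. p \<in> ?W \<Longrightarrow> (\<And>q. v q \<le> v p) \<Longrightarrow> maximum_point u (T p)"
    using rigid_motion_reduction[OF T W assms(2-4) assms(5,6)[unfolded \<Omega>]] by blast
  interpret eccentric f ?W v g H a r R
    using sol par by (simp add: eccentric_def eccentric_axioms_def eccentric_annulus_def)
  have ax: "(- R < p $ 1 \<and> p $ 1 < a - r) \<or> (a + r < p $ 1 \<and> p $ 1 < R)" if "p \<in> ?W" "p $ 2 = 0" for p
  proof -
    have "pt (p $ 1) 0 = p" using that by (simp add: vec2_eq_iff)
    then show ?thesis using that mem_axis[of "p $ 1"] by simp
  qed
  have "{p \<in> \<Omega> \<inter> T ` x_axis. critical_point u p} = T ` {p \<in> ?W. p $ 2 = 0 \<and> g p = 0}"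
    using inj crit by (auto simp: \<Omega> x_axis_def inj_eq)
  then have "card {p \<in> \<Omega> \<inter> T ` x_axis. critical_point u p} = 2"
    using card_critical inj by (simp add: card_image inj_on_subset)
  moreover have "p $ 2 = 0" if "p \<in> ?W" "critical_point u (T p)" for p
    using not_critical crit that by blast
  moreover have "p $ 2 = 0 \<and> - R < p $ 1 \<and> p $ 1 < a - r" if "p \<in> ?W" "maximum_point u (T p)" for p
  proof -
    have "p $ 2 = 0 \<and> p $ 1 < a - r" using lmax[OF that] local_max_long that(1) by blast
    then show ?thesis using ax[OF that(1)] par by auto
  qed
  moreover have "p $ 2 = 0 \<and> a + r < p $ 1 \<and> p $ 1 < R" if p: "p \<in> ?W" "saddle_point u (T p)" for p
  proof -
    have "g p = 0" using p crit by (simp add: saddle_point_def)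
    moreover from this have "p $ 2 = 0" using not_critical p(1) by blast
    \<comment> \<open>A critical point there is a global maximum of the model solution, so it is no
      saddle.\<close>
    moreover have "\<not> p $ 1 < a - r"
      using long_critical_max[OF p(1) \<open>g p = 0\<close>] gmax[OF p(1)] p(2) by (auto simp: saddle_point_def)
    ultimately show ?thesis using ax[OF p(1)] by blast
  qed
  ultimately show ?thesis by (auto simp: axes longs shorts \<Omega> x_axis_def)
next
  assume "elliptic_exterior_petal_domain \<Omega> axes longs shorts"
  then obtain T A B r where T: "rigid_motion T" and par: "0 < r" "r < B" "B < A"
    and \<Omega>: "\<Omega> = T ` ellipse_petal A B r" and axes: "axes = {T ` x_axis, T ` y_axis}"
    and longs: "longs = components (\<Omega> \<inter> T ` x_axis)"
    and shorts: "shorts = components (\<Omega> \<inter> T ` y_axis)"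
    unfolding elliptic_exterior_petal_domain_def by blast
  let ?W = "ellipse_petal A B r"
  have W: "open ?W" "bounded ?W"
  proof -
    have nz: "A \<noteq> 0" "B \<noteq> 0" using par by auto
    have "open {p::real^2. (p $ 1 / A)\<^sup>2 + (p $ 2 / B)\<^sup>2 < 1}"
      using nz by (intro open_Collect_less continuous_intros) auto
    then show "open ?W" unfolding ellipse_petal_def by auto
    have "norm p \<le> \<bar>A\<bar> + \<bar>B\<bar>" if "p \<in> ?W" for p
    proof -
      have "(p $ 1 / A)\<^sup>2 + (p $ 2 / B)\<^sup>2 < 1" using that by (simp add: ellipse_petal_def)
      then have "(p $ 1 / A)\<^sup>2 < 1" "(p $ 2 / B)\<^sup>2 < 1"
        using zero_le_power2[of "p $ 1 / A"] zero_le_power2[of "p $ 2 / B"]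
        by (meson add_increasing add_increasing2 le_less_trans order_refl)+
      then have "\<bar>p $ 1 / A\<bar> < 1" "\<bar>p $ 2 / B\<bar> < 1" using abs_square_less_1 by blast+
      then have "\<bar>p $ 1\<bar> < \<bar>A\<bar>" "\<bar>p $ 2\<bar> < \<bar>B\<bar>" using nz by (simp_all add: abs_divide)
      then show ?thesis using norm_le_l1_cart[of p] by (simp add: sum_2)
    qed
    then show "bounded ?W" unfolding bounded_iff by blast
  qed
  obtain v g H where inj: "inj T" and sol: "dirichlet_solution f ?W v g H"
    and crit: "\<And>p. p \<in> ?W \<Longrightarrow> critical_point u (T p) \<longleftrightarrow> g p = 0"
    and lmax: "\<And>p. p \<in> ?W \<Longrightarrow> maximum_point u (T p) \<Longrightarrow> \<exists>V. open V \<and> p \<in> V \<and> (\<forall>q\<in>V. v q \<le> v p)"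
    and gmax: "\<And>p. p \<in> ?W \<Longrightarrow> (\<And>q. v q \<le> v p) \<Longrightarrow> maximum_point u (T p)"
    using rigid_motion_reduction[OF T W assms(2-4) assms(5,6)[unfolded \<Omega>]] by blast
  interpret elliptic f ?W v g H A B r
    using sol par by (simp add: elliptic_def elliptic_axioms_def ellipse_petal_def)
  have "{p \<in> \<Omega> \<inter> T ` L. critical_point u p} = T ` {p \<in> ?W \<inter> L. g p = 0}" for L
    using inj crit by (auto simp: \<Omega> inj_eq)
  then have "card {p \<in> \<Omega> \<inter> T ` L. critical_point u p} = card {p \<in> ?W \<inter> L. g p = 0}" for L
    using inj by (simp add: card_image inj_on_subset)
  then have cards: "\<forall>l\<in>axes. card {p \<in> \<Omega> \<inter> l. critical_point u p} = 2"
    using card_critical_x card_critical_y by (simp add: axes)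
  have onaxes: "p \<in> x_axis \<or> p \<in> y_axis" if "p \<in> ?W" "critical_point u (T p)" for p
    using critical_on_axes[OF that(1)] crit that by (auto simp: x_axis_def y_axis_def)
  have maxx: "p \<in> x_axis" if "p \<in> ?W" "maximum_point u (T p)" for p
    using lmax[OF that] local_max_long that(1) by (auto simp: x_axis_def)
  have saddley: "p \<in> y_axis" if p: "p \<in> ?W" "saddle_point u (T p)" for p
  proof -
    have g0: "g p = 0" using p crit by (simp add: saddle_point_def)
    have "p $ 2 \<noteq> 0"
      using long_critical_max[OF p(1) g0] gmax[OF p(1)] p(2) by (auto simp: saddle_point_def)
    then show ?thesis using critical_on_axes[OF p(1) g0] by (simp add: y_axis_def)
  qed
  show ?thesis
    \<comment> \<open>The union of the components is the whole intersection with the axis, so it is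
      enough to find the axis.\<close>
    unfolding longs shorts Union_components
  proof (intro conjI ballI impI)
    fix q assume "q \<in> \<Omega>"
    then obtain p where p: "q = T p" "p \<in> ?W" unfolding \<Omega> by blast
    show "q \<in> \<Union> axes" if "critical_point u q" using onaxes[OF p(2)] that unfolding p(1) axes by blast
    show "q \<in> \<Omega> \<inter> T ` x_axis" if "maximum_point u q"
      using maxx[OF p(2)] that \<open>q \<in> \<Omega>\<close> unfolding p(1) by blast
    show "q \<in> \<Omega> \<inter> T ` y_axis" if "saddle_point u q"
      using saddley[OF p(2)] that \<open>q \<in> \<Omega>\<close> unfolding p(1) by blast
  qed (use cards in blast)
qed

end
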